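(* Let $N\ge 1$ be an integer and let $p,q$ be real numbers with $\frac{2N}{N+1}<p<2$ and $\frac p2<q<p-\frac{N}{N+1}$. Set $\alpha=\frac{p-q}{2q-p}$, $\beta=\frac{q-p+1}{2q-p}$, $\mu=\frac{p}{2-p}$. Then there is a unique nonnegative, not identically zero solution $f$ on $[0,\infty)$ to the ordinary differential equation $$(|f'|^{p-2}f')'(r)+\frac{N-1}{r}(|f'|^{p-2}f')(r)+\alpha f(r)+\beta r f'(r)-|f'(r)|^q=0,\qquad r>0,$$ which satisfies $f'(0)=0$ and $$\lim_{r\to\infty} r^{(p-q)/(q-p+1)}f(r)=0.$$ In fact, this solution satisfies $$\lim_{r\to\infty} r^{p/(2-p)}f(r)=w^*,\qquad\text{where } w^*:=\left(\frac{\mu^{p-1}(\mu-N)}{\mu\beta-\alpha}\right)^{1/(2-p)}>0 .$$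
   Context: A solution on $[0,\infty)$ is a function $f\in C^1([0,\infty))$ such that $|f'|^{p-2}f'$ (understood as $0$ where $f'=0$) belongs to $C^1([0,\infty))$ and the equation holds for all $r>0$. Under the stated assumptions on $p,q$ one has $\mu>N$ and $\mu\beta-\alpha=1/(2-p)>0$, so that $w^*$ is well defined and positive. *)

theory Defs
  imports "HOL-Analysis.Analysis"
begin

text \<open>
  Functions on the half-line are total functions on the reals of which only the values
  on \<open>{0..}\<close> are used. The derivative is taken within \<open>{0..}\<close>: it is one-sided at 0
  and the usual derivative at every positive point.
\<close>

definition deriv_halfline :: "(real \<Rightarrow> real) \<Rightarrow> real \<Rightarrow> real" where
  "deriv_halfline f r = vector_derivative f (at r within {0..})"

definition C1_halfline :: "(real \<Rightarrow> real) \<Rightarrow> bool" where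
  "C1_halfline f \<longleftrightarrow> f differentiable_on {0..} \<and> continuous_on {0..} (deriv_halfline f)"

text \<open>Since \<open>0 powr a = 0\<close> and because of the second factor, the flux vanishes where the derivative does.\<close>

definition p_flux :: "real \<Rightarrow> (real \<Rightarrow> real) \<Rightarrow> real \<Rightarrow> real" where
  "p_flux p f r = \<bar>deriv_halfline f r\<bar> powr (p - 2) * deriv_halfline f r"

definition alpha_exp :: "real \<Rightarrow> real \<Rightarrow> real" where
  "alpha_exp p q = (p - q) / (2 * q - p)"

definition beta_exp :: "real \<Rightarrow> real \<Rightarrow> real" where
  "beta_exp p q = (q - p + 1) / (2 * q - p)"

definition mu_exp :: "real \<Rightarrow> real" where
  "mu_exp p = p / (2 - p)"

definition w_star :: "nat \<Rightarrow> real \<Rightarrow> real \<Rightarrow> real" where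
  "w_star N p q =
     (mu_exp p powr (p - 1) * (mu_exp p - real N) / (mu_exp p * beta_exp p q - alpha_exp p q))
       powr (1 / (2 - p))"

definition profile_solution :: "nat \<Rightarrow> real \<Rightarrow> real \<Rightarrow> (real \<Rightarrow> real) \<Rightarrow> bool" where
  "profile_solution N p q f \<longleftrightarrow>
     C1_halfline f \<and> C1_halfline (p_flux p f) \<and>
     (\<forall>r>0. deriv_halfline (p_flux p f) r + (real N - 1) / r * p_flux p f r
            + alpha_exp p q * f r + beta_exp p q * r * deriv_halfline f r
            - \<bar>deriv_halfline f r\<bar> powr q = 0)"

definition fast_decay_profile :: "nat \<Rightarrow> real \<Rightarrow> real \<Rightarrow> (real \<Rightarrow> real) \<Rightarrow> bool" where
  "fast_decay_profile N p q f \<longleftrightarrow>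
     profile_solution N p q f \<and>
     (\<forall>r\<ge>0. f r \<ge> 0) \<and> (\<exists>r\<ge>0. f r \<noteq> 0) \<and>
     deriv_halfline f 0 = 0 \<and>
     ((\<lambda>r. r powr ((p - q) / (q - p + 1)) * f r) \<longlongrightarrow> 0) at_top"

end

theory Submission
  imports Defs
begin

text \<open>
  With \<open>v = - |f'|^(p-2) f'\<close>, \<open>h = 1 / (p - 1)\<close> and \<open>k = q / (p - 1)\<close> the equation becomes the
  system \<open>f' = - v^h\<close>, \<open>v' + (N - 1) v / r = \<alpha> f - \<beta> r v^h - v^k\<close>, which is locally Lipschitz even for
  \<open>q < 1\<close> because \<open>h, k > 1\<close>. Rescaling to \<open>f 0 = 1\<close> puts a coefficient \<open>\<nu>\<close> in front of \<open>v^k\<close>, and \<open>\<nu>\<close> becomes the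
  shooting parameter. In the variables \<open>s = ln r\<close>, \<open>W = r^\<mu> f\<close>, \<open>Z = r^(\<mu>-1) v\<close> the system is autonomous
  up to the decaying term \<open>\<nu> e^(-\<kappa>s) Z^k\<close>, rescaling is translation in \<open>s\<close>, and the fast decay solutions are
  the orbits with \<open>W\<close> increasing to the saddle point \<open>w*\<close>.

  Existence: the \<open>\<nu>\<close> for which \<open>W'\<close> becomes negative and those for which \<open>W\<close> exceeds \<open>w*\<close> form disjoint open
  sets, the first containing all small and the second some large \<open>\<nu>\<close>; any \<open>\<nu> > 0\<close> in neither gives a solution.

  Uniqueness: for \<open>\<nu>1 < \<nu>2\<close> the translates \<open>W1 (s + \<tau>)\<close>, \<open>\<tau> > 0\<close>, cannot touch \<open>W2\<close> from above, so that \<open>W2\<close>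
  stays ahead of \<open>W1\<close> by at least a fixed \<open>\<tau> > 0\<close>. Both tend to \<open>w*\<close>, hence some multiple \<open>K W1 (s + \<tau>)\<close>, \<open>K \<ge> 1\<close>, touches \<open>W2\<close>
  from above at a large \<open>s\<close>; this is impossible as well, since \<open>\<alpha> f + \<beta> r f' < 0\<close> there.
\<close>

section \<open>One-variable calculus\<close>

text \<open>Why touching is impossible: two orbits with the same \<open>W\<close> and
  \<open>W'\<close> at some \<open>s\<close> also have the same \<open>Z\<close>, so their second
  derivatives differ only through the absorption terms, and these are strictly ordered. Translation
  by \<tau> > 0 keeps the order, since it multiplies the smaller coefficient by
  \<open>exp (- \<kappa> * \<tau>) < 1\<close>. A multiple \<open>K W1\<close> behaves worse: the
  powers scale differently, and a remainder
  \<open>(K - K^(1/h)) (\<alpha> W1 - \<beta> Z1^h)\<close> appears, whose sign is known only near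
  the equilibrium. This is why sliding has to come first: it provides a large \<open>a\<close> and a
  translate that meets \<open>W2\<close> at \<open>a\<close> and stays below it, and the
  multiplicative comparison then takes place on \<open>{a..}\<close> only. Neither linearisation at
  the saddle nor an invariant manifold is used. Limits are identified by barriers for
  \<open>ln Z\<close>: for fixed \<open>s\<close> and \<open>W\<close> the rate \<open>Z'/Z\<close>
  decreases in \<open>Z\<close>, so its sign at one level controls all levels above or below. A
  limit of \<open>W\<close> off the equilibrium would then force \<open>W'\<close> to stay away from
  0.\<close>

lemma first_zero_from_neg:
  fixes g :: "real \<Rightarrow> real"
  assumes "a \<le> b" "continuous_on {a..b} g" "g a < 0" "g b \<ge> 0"
  obtains c where "a < c" "c \<le> b" "g c = 0" "\<And>t. a \<le> t \<Longrightarrow> t < c \<Longrightarrow> g t < 0"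
proof -
  define S where "S = {t \<in> {a..b}. g t \<ge> 0}"
  have "closed S"
    unfolding S_def using assms(2) by (intro continuous_on_closed_Collect_le continuous_intros) auto
  moreover have "b \<in> S" using assms by (auto simp: S_def)
  moreover have "bdd_below S" by (rule bdd_belowI[of _ a]) (auto simp: S_def)
  ultimately have c: "Inf S \<in> S" using closed_contains_Inf by blast
  define c where "c = Inf S"
  have c1: "a \<le> c" "c \<le> b" "g c \<ge> 0" using c by (auto simp: S_def c_def)
  have neg: "g t < 0" if "a \<le> t" "t < c" for t
  proof (rule ccontr)
    assume "\<not> g t < 0"
    then have "t \<in> S" using that c1 by (auto simp: S_def)
    then have "c \<le> t" unfolding c_def using \<open>bdd_below S\<close> by (rule cInf_lower)
    then show False using that by simp
  qed
  have "a < c" using c1 assms(3) by (cases "a = c") auto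
  have "g c \<le> 0"
  proof (rule ccontr)
    assume "\<not> g c \<le> 0"
    have "\<exists>x\<ge>a. x \<le> c \<and> g x = 0"
      using assms(3) c1 \<open>a < c\<close>
      by (intro IVT') (auto intro: continuous_on_subset[OF assms(2)])
    then obtain x where "a \<le> x" "x \<le> c" "g x = 0" by auto
    then show False using neg[of x] \<open>\<not> g c \<le> 0\<close> by (cases "x = c") auto
  qed
  then show ?thesis using that[of c] \<open>a < c\<close> c1 neg by force
qed

lemma last_zero_to_neg:
  fixes g :: "real \<Rightarrow> real"
  assumes "a \<le> b" "continuous_on {a..b} g" "g a \<ge> 0" "g b < 0"
  obtains c where "a \<le> c" "c < b" "g c = 0" "\<And>t. c < t \<Longrightarrow> t \<le> b \<Longrightarrow> g t < 0"
proof -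
  have "continuous_on {-b..-a} (\<lambda>x. g (- x))"
    by (rule continuous_on_compose2[OF assms(2)]) (auto intro!: continuous_intros)
  then obtain c where c: "-b < c" "c \<le> -a" "g (-c) = 0" "\<And>t. -b \<le> t \<Longrightarrow> t < c \<Longrightarrow> g (-t) < 0"
    using first_zero_from_neg[of "-b" "-a" "\<lambda>x. g (-x)"] assms by auto
  show ?thesis
    using that[of "-c"] c(1-3) c(4)[of "- t" for t] by force
qed

text \<open>Below the level the growth rate is at least \<delta>, so the level is reached in finite
  time. It cannot be undercut later: after the last passage through \<open>c\<close> the function
  would have to fall while its derivative is positive.\<close>

lemma eventually_ge_barrier:
  fixes y y' :: "real \<Rightarrow> real"
  assumes der: "\<And>s. s \<ge> s1 \<Longrightarrow> DERIV y s :> y' s"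
    and d: "\<delta> > 0" and low: "\<And>s. s \<ge> s1 \<Longrightarrow> y s \<le> c \<Longrightarrow> y' s \<ge> \<delta>"
  shows "\<exists>s2\<ge>s1. \<forall>s\<ge>s2. y s \<ge> c"
proof -
  have cont: "continuous_on {a..b} y" if "a \<ge> s1" for a b
    using that by (intro continuous_at_imp_continuous_on ballI) (auto intro!: DERIV_isCont[OF der])
  have "\<exists>s2\<ge>s1. y s2 \<ge> c"
  proof (rule ccontr)
    assume "\<not> ?thesis"
    then have lt: "y s < c" if "s \<ge> s1" for s using that by force
    \<comment> \<open>The time at which the line of slope \<delta> through \<open>(s1, y s1)\<close>
      reaches \<open>c\<close>.\<close>
    define T where "T = s1 + (c - y s1) / \<delta>"
    have T: "s1 \<le> T" using lt[of s1] d by (simp add: T_def)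
    have "y s1 - \<delta> * s1 \<le> y T - \<delta> * T"
    proof (rule DERIV_nonneg_imp_nondecreasing[OF T])
      fix x assume x: "s1 \<le> x" "x \<le> T"
      have "DERIV (\<lambda>x. y x - \<delta> * x) x :> y' x - \<delta>"
        using der[OF x(1)] by (auto intro!: derivative_eq_intros)
      moreover have "y' x - \<delta> \<ge> 0" using low[OF x(1)] lt[OF x(1)] by simp
      ultimately show "\<exists>z. DERIV (\<lambda>x. y x - \<delta> * x) x :> z \<and> 0 \<le> z" by blast
    qed
    then have "y T \<ge> c" using d by (simp add: T_def field_simps)
    then show False using lt[OF T] by simp
  qed
  then obtain s2 where s2: "s2 \<ge> s1" "y s2 \<ge> c" by auto
  have "y s \<ge> c" if ss2: "s \<ge> s2" for s
  proof (rule ccontr)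
    assume "\<not> y s \<ge> c"
    then have less: "y s - c < 0" by simp
    have "continuous_on {s2..s} (\<lambda>t. y t - c)"
      by (intro continuous_intros cont s2)
    then obtain u where u: "s2 \<le> u" "u < s" "y u - c = 0" "\<And>t. u < t \<Longrightarrow> t \<le> s \<Longrightarrow> y t - c < 0"
      using last_zero_to_neg[of s2 s "\<lambda>t. y t - c"] s2 ss2 less by auto
    have "y u \<le> y s"
    proof (rule DERIV_nonneg_imp_nondecreasing[where f = y])
      show "u \<le> s" using u by simp
      fix x assume x: "u \<le> x" "x \<le> s"
      then have "y x \<le> c" using u(3) u(4)[of x] by (cases "x = u") auto
      then show "\<exists>z. DERIV y x :> z \<and> 0 \<le> z"
        using der[of x] low[of x] x u s2 d by (intro exI[of _ "y' x"]) auto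
    qed
    then show False using u \<open>\<not> y s \<ge> c\<close> by simp
  qed
  then show ?thesis using s2 by auto
qed

lemma eventually_le_barrier:
  fixes y y' :: "real \<Rightarrow> real"
  assumes "\<And>s. s \<ge> s1 \<Longrightarrow> DERIV y s :> y' s"
    and "\<delta> > 0" and "\<And>s. s \<ge> s1 \<Longrightarrow> y s \<ge> c \<Longrightarrow> y' s \<le> - \<delta>"
  shows "\<exists>s2\<ge>s1. \<forall>s\<ge>s2. y s \<le> c"
proof -
  have "\<exists>s2\<ge>s1. \<forall>s\<ge>s2. - y s \<ge> - c"
  proof (rule eventually_ge_barrier[where y' = "\<lambda>s. - y' s" and \<delta> = \<delta>])
    show "DERIV (\<lambda>s. - y s) s :> - y' s" if "s \<ge> s1" for s
      using assms(1)[OF that] by (auto intro!: derivative_eq_intros)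
  qed (use assms in force)+
  then show ?thesis by simp
qed

lemma deriv_unbounded_below:
  fixes y y' :: "real \<Rightarrow> real"
  assumes "\<And>s. s \<ge> s1 \<Longrightarrow> DERIV y s :> y' s"
    and "\<delta> > 0" and "\<And>s. s \<ge> s1 \<Longrightarrow> y' s \<le> - \<delta>"
  shows "\<exists>s\<ge>s1. y s < c"
proof -
  obtain s where "s \<ge> s1" "y s \<le> c - 1"
    using eventually_le_barrier[of s1 y y' \<delta> "c - 1"] assms by blast
  then show ?thesis by (intro exI[of _ s]) auto
qed

lemma deriv_unbounded_above:
  fixes y y' :: "real \<Rightarrow> real"
  assumes "\<And>s. s \<ge> s1 \<Longrightarrow> DERIV y s :> y' s"
    and "\<delta> > 0" and "\<And>s. s \<ge> s1 \<Longrightarrow> y' s \<ge> \<delta>"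
  shows "\<exists>s\<ge>s1. y s > c"
proof -
  obtain s where "s \<ge> s1" "y s \<ge> c + 1"
    using eventually_ge_barrier[of s1 y y' \<delta> "c + 1"] assms by blast
  then show ?thesis by (intro exI[of _ s]) auto
qed

text \<open>If \<open>l < 0\<close>, then \<open>g\<close> is negative just to the right of
  \<open>c\<close> and \<open>x\<close> drops below its minimum 0.\<close>

lemma touching_second_derivative:
  fixes x g :: "real \<Rightarrow> real"
  assumes d: "\<delta> > 0"
    and der: "\<And>s. \<bar>s - c\<bar> < \<delta> \<Longrightarrow> DERIV x s :> g s"
    and nn: "\<And>s. \<bar>s - c\<bar> < \<delta> \<Longrightarrow> x s \<ge> 0" and z: "x c = 0"
    and g': "DERIV g c :> l"
  shows "g c = 0" "l \<ge> 0"
proof -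
  show g0: "g c = 0"
    by (rule DERIV_local_min[OF der[of c] d]) (use d z nn in \<open>auto simp: abs_minus_commute\<close>)
  show "l \<ge> 0"
  proof (rule ccontr)
    assume "\<not> l \<ge> 0"
    then obtain e where e: "e > 0" "\<And>h. 0 < h \<Longrightarrow> h < e \<Longrightarrow> g (c + h) < g c"
      using DERIV_neg_dec_right[OF g'] by force
    define m where "m = min e \<delta> / 2"
    have m: "m > 0" "m < e" "m < \<delta>" using e d by (auto simp: m_def)
    have "x (c + m) < x c"
    proof (rule DERIV_neg_imp_decreasing_open[where f = x])
      show "c < c + m" using m by simp
      show "\<exists>y. DERIV x s :> y \<and> y < 0" if "c < s" "s < c + m" for s
        using der[of s] e(2)[of "s - c"] that m g0 by auto
      show "continuous_on {c..c + m} x"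
        using m by (intro continuous_at_imp_continuous_on ballI) (auto intro!: DERIV_isCont[OF der])
    qed
    then show False using nn[of "c + m"] z m by auto
  qed
qed

text \<open>Mean value theorem; \<open>z powr (k - 1)\<close> is largest at \<open>B\<close> because
  \<open>k \<ge> 1\<close>. This is how exponents above 1 make the system locally Lipschitz even at
  zero flux.\<close>

lemma powr_lipschitz:
  fixes x y B k :: real
  assumes "k \<ge> 1" "x \<in> {0..B}" "y \<in> {0..B}"
  shows "\<bar>x powr k - y powr k\<bar> \<le> k * B powr (k - 1) * \<bar>x - y\<bar>"
proof -
  have main: "b powr k - a powr k \<le> k * B powr (k - 1) * (b - a)" if "0 \<le> a" "a < b" "b \<le> B" for a b
  proof -
    have "\<exists>l z. a < z \<and> z < b \<and> DERIV (\<lambda>x. x powr k) z :> l \<and>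
        b powr k - a powr k = (b - a) * l"
    proof (rule MVT[OF that(2)])
      show "continuous_on {a..b} (\<lambda>x. x powr k)"
        using assms(1) that by (intro continuous_on_powr') (auto intro!: continuous_intros)
      show "(\<lambda>x. x powr k) differentiable at x" if "a < x" for x
        using that \<open>0 \<le> a\<close> has_real_derivative_powr[of x k] by (auto simp: real_differentiable_def)
    qed
    then obtain l z where z: "a < z" "z < b" "DERIV (\<lambda>x. x powr k) z :> l"
       "b powr k - a powr k = (b - a) * l" by blast
    have "l = k * z powr (k - 1)"
      using DERIV_unique[OF z(3) has_real_derivative_powr] z that by auto
    also have "\<dots> \<le> k * B powr (k - 1)"
      using assms(1) z that by (intro mult_left_mono powr_mono2) auto
    finally show ?thesis using z(4) that by (simp add: mult.commute mult_left_mono)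
  qed
  have B: "a powr k \<le> b powr k" if "0 \<le> a" "a \<le> b" for a b
    using that assms(1) by (intro powr_mono2) auto
  show ?thesis
    using main[of x y] main[of y x] assms B[of x y] B[of y x]
    by (cases x y rule: linorder_cases) (auto simp: abs_if)
qed

lemma deriv_nonneg_if_max_from_left:
  fixes g :: "real \<Rightarrow> real"
  assumes "a < c" "\<And>t. a < t \<Longrightarrow> t < c \<Longrightarrow> g t \<le> g c" "DERIV g c :> l"
  shows "l \<ge> 0"
proof (rule ccontr)
  assume "\<not> l \<ge> 0"
  then obtain e where e: "e > 0" "\<And>x. 0 < x \<Longrightarrow> x < e \<Longrightarrow> g c < g (c - x)"
    using DERIV_neg_dec_left[OF assms(3)] by force
  define x where "x = min e (c - a) / 2"
  have "0 < x" "x < e" "x < c - a" using e assms(1) by (auto simp: x_def)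
  then show False using e(2)[of x] assms(2)[of "c - x"] by force
qed

lemma mono_at_top_cases:
  fixes W :: "real \<Rightarrow> real"
  assumes m: "\<And>s t. a \<le> s \<Longrightarrow> s \<le> t \<Longrightarrow> W s \<le> W t"
  shows "(\<exists>l. (W \<longlongrightarrow> l) at_top \<and> (\<forall>s\<ge>a. W s \<le> l)) \<or> filterlim W at_top at_top"
proof (cases "bdd_above (W ` {a..})")
  case True
  define l where "l = Sup (W ` {a..})"
  have le: "W s \<le> l" if "s \<ge> a" for s
    unfolding l_def using True that by (intro cSup_upper) auto
  have "(W \<longlongrightarrow> l) at_top"
  proof (rule order_tendstoI)
    fix y assume "y < l"
    then obtain s where s: "s \<ge> a" "y < W s"
      unfolding l_def using less_cSup_iff[OF _ True, of y] by auto
    show "eventually (\<lambda>t. y < W t) at_top"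
      unfolding eventually_at_top_linorder using s m[OF s(1)] by (intro exI[of _ s]) force
  next
    fix y assume "l < y"
    then show "eventually (\<lambda>t. W t < y) at_top"
      unfolding eventually_at_top_linorder using le by (intro exI[of _ a]) force
  qed
  then show ?thesis using le by blast
next
  case False
  have "filterlim W at_top at_top"
    unfolding filterlim_at_top
  proof
    fix y
    obtain s where s: "s \<ge> a" "W s \<ge> y"
      using False unfolding bdd_above_def by (force simp: not_le intro: less_imp_le)
    show "eventually (\<lambda>t. y \<le> W t) at_top"
      unfolding eventually_at_top_linorder using s m[OF s(1)] by (intro exI[of _ s]) force
  qed
  then show ?thesis ..
qed

lemma halfline_tendsto_at_right:
  fixes g :: "real \<Rightarrow> real"
  assumes "continuous_on {0..} g"
  shows "(g \<longlongrightarrow> g 0) (at_right 0)"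
proof -
  have "(g \<longlongrightarrow> g 0) (at 0 within {0..})" using assms by (auto simp: continuous_on_def)
  then show ?thesis by (rule tendsto_mono[rotated]) (auto intro: at_le)
qed

text \<open>\<open>r ^ (n - 1)\<close> is the integrating factor of the singular term
  \<open>(n - 1) / r * y\<close>.\<close>

lemma radial_product_derivative:
  assumes "n \<ge> 1" "r > 0" "DERIV y r :> D - (real n - 1) / r * y r"
  shows "DERIV (\<lambda>r. r ^ (n - 1) * y r) r :> r ^ (n - 1) * D"
proof -
  obtain m where m: "n = Suc m" using assms(1) by (cases n) auto
  have "m = 0 \<or> (\<exists>l. m = Suc l)" by (cases m) auto
  then show ?thesis
    using assms m by (auto intro!: derivative_eq_intros simp: field_simps)
qed

lemma exp_ln_powr: "(r::real) > 0 \<Longrightarrow> exp (a * ln r) = r powr a"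
  by (simp add: powr_def)

section \<open>The initial value problem\<close>

text \<open>Banach's theorem in the sup norm weighted by \<open>w\<close>: the unknown is
  \<open>y = w * u\<close> with \<open>u\<close> bounded and continuous. \<open>lip\<close> gives
  the contraction constant 1/2, and \<open>bnd\<close> with \<open>lip\<close> keeps the image
  bounded.\<close>

lemma weighted_fixpoint:
  fixes T :: "(real \<Rightarrow> real) \<Rightarrow> real \<Rightarrow> real" and w :: "real \<Rightarrow> real"
  assumes w: "continuous_on {0..} w" "\<And>t. t \<ge> 0 \<Longrightarrow> w t > 0"
    and cont: "\<And>y. continuous_on {0..} y \<Longrightarrow> continuous_on {0..} (T y)"
    and lip: "\<And>y z D r. continuous_on {0..} y \<Longrightarrow> continuous_on {0..} z \<Longrightarrow> D \<ge> 0 \<Longrightarrow>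
        (\<And>t. t \<ge> 0 \<Longrightarrow> \<bar>y t - z t\<bar> \<le> D * w t) \<Longrightarrow> r \<ge> 0 \<Longrightarrow> \<bar>T y r - T z r\<bar> \<le> D / 2 * w r"
    and bnd: "\<And>r. r \<ge> 0 \<Longrightarrow> \<bar>T (\<lambda>_. 0) r\<bar> \<le> B * w r"
  obtains y where "continuous_on {0..} y" "\<And>r. r \<ge> 0 \<Longrightarrow> T y r = y r"
proof -
  define Y where "Y u = (\<lambda>t. w t * apply_bcontfun u t)" for u :: "real \<Rightarrow>\<^sub>C real"
  \<comment> \<open>\<open>max 0\<close> continues functions constantly to negative arguments,
    because the space of bounded continuous functions is taken over the whole line.\<close>
  define \<Phi> where "\<Phi> u = (\<lambda>r. T (Y u) (max 0 r) / w (max 0 r))" for u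
  have Yc: "continuous_on {0..} (Y u)" for u
    unfolding Y_def by (intro continuous_intros w) auto
  have \<Phi>b: "\<Phi> u \<in> bcontfun" for u
  proof -
    have "continuous_on UNIV (\<Phi> u)"
      unfolding \<Phi>_def
    proof (intro continuous_on_divide)
      show "continuous_on UNIV (\<lambda>x. T (Y u) (max 0 x))"
        by (rule continuous_on_compose2[OF cont[OF Yc]]) (auto intro!: continuous_intros)
      show "continuous_on UNIV (\<lambda>x. w (max 0 x))"
        by (rule continuous_on_compose2[OF w(1)]) (auto intro!: continuous_intros)
      show "\<forall>x\<in>UNIV. w (max 0 x) \<noteq> 0"
        using w(2) by (metis less_irrefl max.cobounded1)
    qed
    moreover have "bounded (range (\<Phi> u))"
    proof -
      obtain D where D: "\<And>t. \<bar>apply_bcontfun u t\<bar> \<le> D"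
        using bounded_apply_bcontfun[of u] by (auto simp: bounded_iff)
      have D0: "D \<ge> 0" using D[of 0] by linarith
      have "\<bar>\<Phi> u r\<bar> \<le> B + D / 2" for r
      proof -
        define s where "s = max 0 r"
        have s: "s \<ge> 0" "w s > 0" using w(2)[of s] by (auto simp: s_def)
        have "\<bar>T (Y u) s - T (\<lambda>_. 0) s\<bar> \<le> D / 2 * w s"
        proof (rule lip)
          show "\<bar>Y u t - 0\<bar> \<le> D * w t" if "t \<ge> 0" for t
            using D[of t] w(2)[OF that] by (simp add: Y_def abs_mult mult.commute mult_left_mono)
        qed (use Yc D0 s in auto)
        then have "\<bar>T (Y u) s\<bar> \<le> (B + D / 2) * w s"
          using bnd[OF s(1)] by (simp add: distrib_right) argo
        then show ?thesis
          using s by (simp add: \<Phi>_def s_def[symmetric] abs_mult field_simps)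
      qed
      then show ?thesis by (auto simp: bounded_iff)
    qed
    ultimately show ?thesis by (auto simp: bcontfun_def)
  qed
  have app: "apply_bcontfun (Bcontfun (\<Phi> u)) = \<Phi> u" for u
    using \<Phi>b by (simp add: Bcontfun_inverse)
  have "\<exists>!u. Bcontfun (\<Phi> u) = u"
  proof (rule banach_fix_type[of "1/2"])
    show "\<forall>u v. dist (Bcontfun (\<Phi> u)) (Bcontfun (\<Phi> v)) \<le> 1 / 2 * dist u v"
    proof (intro allI dist_bound)
      fix u v r
      define s where "s = max 0 (r::real)"
      have s: "s \<ge> 0" "w s > 0" using w(2)[of s] by (auto simp: s_def)
      have "\<bar>T (Y u) s - T (Y v) s\<bar> \<le> dist u v / 2 * w s"
      proof (rule lip)
        show "\<bar>Y u t - Y v t\<bar> \<le> dist u v * w t" if "t \<ge> 0" for t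
          using dist_bounded[of u t v] w(2)[OF that]
          by (simp add: Y_def abs_mult dist_real_def mult.commute mult_left_mono flip: right_diff_distrib)
      qed (use Yc s in auto)
      moreover have "\<Phi> u r - \<Phi> v r = (T (Y u) s - T (Y v) s) / w s"
        by (simp add: \<Phi>_def s_def[symmetric] diff_divide_distrib)
      ultimately have "\<bar>\<Phi> u r - \<Phi> v r\<bar> \<le> dist u v / 2"
        using s by (simp add: abs_divide pos_divide_le_eq)
      then show "dist (apply_bcontfun (Bcontfun (\<Phi> u)) r) (apply_bcontfun (Bcontfun (\<Phi> v)) r) \<le> 1 / 2 * dist u v"
        by (simp add: app dist_real_def)
    qed
  qed auto
  then obtain u where u: "Bcontfun (\<Phi> u) = u" by auto
  have "T (Y u) r = Y u r" if "r \<ge> 0" for r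
  proof -
    have "apply_bcontfun u r = \<Phi> u r" using app[of u] u by simp
    then show ?thesis using that w(2)[OF that] by (simp add: Y_def \<Phi>_def max_def)
  qed
  then show ?thesis using that[OF Yc[of u]] by blast
qed

text \<open>The solution operator of \<open>V' + (n - 1) / r * V = g\<close> with
  \<open>V 0 = 0\<close>. At \<open>r = 0\<close> the integral vanishes, so the value is 0 for every
  \<open>n\<close>.\<close>

definition radial_flux :: "nat \<Rightarrow> (real \<Rightarrow> real) \<Rightarrow> real \<Rightarrow> real" where
  "radial_flux n g r = integral {0..r} (\<lambda>t. t ^ (n - 1) * g t) / r ^ (n - 1)"

lemma integral_real_derivative:
  fixes g :: "real \<Rightarrow> real"
  assumes "continuous_on {0..} g" "r > 0"
  shows "DERIV (\<lambda>r. integral {0..r} g) r :> g r"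
proof -
  have "((\<lambda>r. integral {0..r} g) has_real_derivative g r) (at r within {0..r+1})"
    by (rule integral_has_real_derivative[OF continuous_on_subset[OF assms(1)]]) (use assms in auto)
  moreover have "at r within {0..r+1} = at r"
    by (rule at_within_interior) (use assms in auto)
  ultimately show ?thesis by simp
qed

lemma integral_continuous_on_halfline:
  fixes g :: "real \<Rightarrow> real"
  assumes "continuous_on {0..} g"
  shows "continuous_on {0..} (\<lambda>r. integral {0..r} g)"
  unfolding continuous_on_eq_continuous_within
proof
  fix x :: real assume x: "x \<in> {0..}"
  have "continuous_on {0..x+1} (\<lambda>r. integral {0..r} g)"
    by (rule indefinite_integral_continuous_1[OF integrable_continuous_real[OF continuous_on_subset[OF assms]]]) auto
  then have "continuous (at x within {0..x+1}) (\<lambda>r. integral {0..r} g)"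
    using x by (auto simp: continuous_on_eq_continuous_within)
  moreover have "at x within {0..} = at x within {0..x+1}"
    by (rule at_within_nhd[of x "{x-1<..<x+1}"]) auto
  ultimately show "continuous (at x within {0..}) (\<lambda>r. integral {0..r} g)"
    by simp
qed

lemma radial_flux_0 [simp]: "radial_flux n g 0 = 0"
  by (simp add: radial_flux_def)

lemma radial_flux_derivative:
  assumes "n \<ge> 1" "continuous_on {0..} g" "r > 0"
  shows "DERIV (radial_flux n g) r :> g r - (real n - 1) / r * radial_flux n g r"
proof -
  have "continuous_on {0..} (\<lambda>t. t ^ (n - 1) * g t)"
    by (intro continuous_intros assms)
  from integral_real_derivative[OF this assms(3)]
  have "DERIV (\<lambda>r. integral {0..r} (\<lambda>t. t ^ (n - 1) * g t)) r :> r ^ (n - 1) * g r" .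
  note d = this
  obtain m where m: "n = Suc m" using assms(1) by (cases n) auto
  have "m = 0 \<or> (\<exists>l. m = Suc l)" by (cases m) auto
  then show ?thesis
    unfolding radial_flux_def
    using d assms(3) m by (auto intro!: derivative_eq_intros simp: field_simps power2_eq_square)
qed

text \<open>Under the integral \<open>t ^ (n - 1) \<le> r ^ (n - 1)\<close> cancels the denominator,
  so the singularity at 0 costs nothing.\<close>

lemma radial_flux_le:
  assumes n: "n \<ge> 1" and g: "continuous_on {0..} g" and G: "continuous_on {0..} G" and r: "r \<ge> 0"
    and le: "\<And>t. 0 \<le> t \<Longrightarrow> t \<le> r \<Longrightarrow> \<bar>g t\<bar> \<le> G t"
  shows "\<bar>radial_flux n g r\<bar> \<le> integral {0..r} G"
proof (cases "r = 0")
  case False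
  then have r: "r > 0" using assms by simp
  have c: "continuous_on {0..r} g" "continuous_on {0..r} G"
    using g G by (auto intro: continuous_on_subset)
  have "norm (integral {0..r} (\<lambda>t. t ^ (n - 1) * g t)) \<le> integral {0..r} (\<lambda>t. r ^ (n - 1) * G t)"
  proof (rule integral_norm_bound_integral)
    show "norm (t ^ (n - 1) * g t) \<le> r ^ (n - 1) * G t" if "t \<in> {0..r}" for t
      using le[of t] that by (auto simp: abs_mult intro!: mult_mono power_mono)
  qed (auto intro!: integrable_continuous_real continuous_intros c)
  also have "\<dots> = r ^ (n - 1) * integral {0..r} G" by simp
  finally show ?thesis
    using r by (simp add: radial_flux_def field_simps)
qed auto

lemma radial_flux_continuous:
  assumes n: "n \<ge> 1" and g: "continuous_on {0..} g"
  shows "continuous_on {0..} (radial_flux n g)"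
  unfolding continuous_on_eq_continuous_within
proof
  fix r :: real assume "r \<in> {0..}"
  then consider "r > 0" | "r = 0" by fastforce
  then show "continuous (at r within {0..}) (radial_flux n g)"
  proof cases
    case 1
    then show ?thesis using radial_flux_derivative[OF n g] DERIV_isCont continuous_at_imp_continuous_at_within by blast
  next
    case 2
    have c: "continuous_on {0..} (\<lambda>t. \<bar>g t\<bar>)" by (intro continuous_intros g)
    have "((\<lambda>r. integral {0..r} (\<lambda>t. \<bar>g t\<bar>)) \<longlongrightarrow> 0) (at 0 within {0..})"
      using integral_continuous_on_halfline[OF c, unfolded continuous_on_def, rule_format, of 0] by simp
    then have "(radial_flux n g \<longlongrightarrow> 0) (at 0 within {0..})"
    proof (rule Lim_null_comparison[rotated])
      show "\<forall>\<^sub>F x in at 0 within {0..}. norm (radial_flux n g x) \<le> integral {0..x} (\<lambda>t. \<bar>g t\<bar>)"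
        unfolding eventually_at_filter
        by (intro always_eventually) (auto intro!: radial_flux_le n g c)
    qed
    then show ?thesis using 2 by (simp add: continuous_within)
  qed
qed

lemma radial_flux_diff:
  assumes "continuous_on {0..} f" "continuous_on {0..} g"
  shows "radial_flux n f r - radial_flux n g r = radial_flux n (\<lambda>t. f t - g t) r"
proof -
  have c: "continuous_on {0..r} f" "continuous_on {0..r} g"
    using assms by (auto intro: continuous_on_subset)
  have "integral {0..r} (\<lambda>t. t ^ (n - 1) * (f t - g t)) =
    integral {0..r} (\<lambda>t. t ^ (n - 1) * f t) - integral {0..r} (\<lambda>t. t ^ (n - 1) * g t)"
    by (subst integral_diff[symmetric])
       (auto intro!: integrable_continuous_real continuous_intros c simp: right_diff_distrib)
  then show ?thesis by (simp add: radial_flux_def diff_divide_distrib)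
qed

text \<open>
  The quadratic exponent compensates a Lipschitz constant that grows linearly in \<open>r\<close>, so that
  one contraction yields the solution on the whole half-line.
\<close>

lemma exp_weight_integral:
  fixes L r :: real
  assumes "L > 0" "r \<ge> 0"
  shows "integral {0..r} (\<lambda>t. (1 + 2 * t) * exp (L * (t + t\<^sup>2))) = (exp (L * (r + r\<^sup>2)) - 1) / L"
proof -
  have "((\<lambda>t. (1 + 2 * t) * exp (L * (t + t\<^sup>2))) has_integral
      (exp (L * (r + r\<^sup>2)) / L - exp (L * (0 + 0\<^sup>2)) / L)) {0..r}"
  proof (rule fundamental_theorem_of_calculus)
    show "((\<lambda>t. exp (L * (t + t\<^sup>2)) / L) has_vector_derivative (1 + 2 * x) * exp (L * (x + x\<^sup>2))) (at x within {0..r})" for x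
      unfolding has_real_derivative_iff_has_vector_derivative[symmetric]
      using assms by (auto intro!: derivative_eq_intros simp: field_simps)
  qed (use assms in auto)
  then show ?thesis by (simp add: diff_divide_distrib integral_unique)
qed

text \<open>For \<open>h = 1 / (p - 1)\<close> and \<open>k = q / (p - 1)\<close>: \<open>kh\<close>
  is \<open>q < p\<close>; \<open>\<alpha>\<beta>\<close> is \<open>q < p - N / (N + 1)\<close>;
  \<open>\<mu>n\<close> is the lower bound on \<open>p\<close>; \<open>\<mu>k\<close> is
  \<open>q > p / 2\<close>; \<open>\<mu>\<beta>\<close> holds as the difference is
  \<open>1 / (2 - p)\<close>. The equation \<open>\<mu>h\<close> makes all terms except the
  absorption invariant under the scaling with exponent \<mu>.\<close>

locale profile_params =
  fixes n :: nat and h k \<alpha> \<beta> \<mu> :: real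
  assumes n1: "n \<ge> 1" and h1: "h > 1" and k1: "k > 1" and kh: "k < h + 1"
    and \<alpha>0: "\<alpha> > 0" and \<beta>0: "\<beta> > 0" and \<alpha>\<beta>: "real n * \<beta> < \<alpha>" and \<mu>\<beta>: "\<alpha> < \<mu> * \<beta>"
    and \<mu>n: "real n < \<mu>" and \<mu>h: "(\<mu> - 1) * h = \<mu> + 1" and \<mu>k: "\<mu> < (\<mu> + 1) * k / h"
begin

text \<open>The scaling defect of the absorption term; it equals
  \<open>(2 * q - p) / (2 - p)\<close> for the exponents of the theorem.\<close>

definition \<kappa> where "\<kappa> = (\<mu> + 1) * k / h - \<mu>"

lemma \<kappa>0: "\<kappa> > 0" using \<mu>k by (simp add: \<kappa>_def)
lemma \<mu>1: "\<mu> > 1" using \<mu>n n1 by linarith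

lemma \<kappa>_flux: "- \<kappa> + (\<mu> - 1) * k = \<mu>"
proof -
  have "(\<mu> + 1) * k / h = (\<mu> - 1) * k" using h1 by (simp flip: \<mu>h)
  then show ?thesis by (simp add: \<kappa>_def)
qed

lemma exp_flux_powr: "(exp ((\<mu> - 1) * s) * x) powr h = exp (\<mu> * s) * exp s * x powr h"
proof -
  have "exp ((\<mu> - 1) * s) powr h = exp (((\<mu> - 1) * h) * s)" by (simp add: exp_powr_real mult_ac)
  also have "\<dots> = exp (\<mu> * s) * exp s" by (simp add: \<mu>h distrib_right exp_add)
  finally show ?thesis by (simp add: powr_mult)
qed

text \<open>\<open>max 0\<close> continues the powers by 0 to negative flux, so that the system
  makes sense before positivity of \<open>V\<close> is known. \<open>F 0\<close> is left free, which
  keeps the notion invariant under scaling.\<close>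

definition sol :: "real \<Rightarrow> (real \<Rightarrow> real) \<Rightarrow> (real \<Rightarrow> real) \<Rightarrow> bool" where
  "sol \<nu> F V \<longleftrightarrow> V 0 = 0 \<and> continuous_on {0..} F \<and> continuous_on {0..} V \<and>
     (\<forall>r>0. DERIV F r :> - (max 0 (V r) powr h)) \<and>
     (\<forall>r>0. DERIV V r :> \<alpha> * F r - \<beta> * r * max 0 (V r) powr h - \<nu> * max 0 (V r) powr k
        - (real n - 1) / r * V r)"

text \<open>
  The a priori bound \<open>V < Vmax\<close> below shows that the cut-off at \<open>Vmax\<close> is never active.
\<close>

definition cutoff :: "real \<Rightarrow> real \<Rightarrow> real" where
  "cutoff M v = max 0 (min v M)"

text \<open>Integrating the equation for \<open>F\<close> and inverting the radial operator leaves a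
  fixed point problem for \<open>V\<close> alone. The truncation makes the powers globally
  Lipschitz, so \<open>weighted_fixpoint\<close> applies.\<close>

lemma truncated_sol_exists:
  assumes M: "M > 0" and \<nu>: "\<nu> \<ge> 0"
  obtains F V where "F 0 = 1" "V 0 = 0" "continuous_on {0..} F" "continuous_on {0..} V"
    "\<And>r. r > 0 \<Longrightarrow> DERIV F r :> - (cutoff M (V r) powr h)"
    "\<And>r. r > 0 \<Longrightarrow> DERIV V r :> \<alpha> * F r - \<beta> * r * cutoff M (V r) powr h
        - \<nu> * cutoff M (V r) powr k - (real n - 1) / r * V r"
proof -
  \<comment> \<open>A common Lipschitz constant on \<open>{0..M}\<close> for the powers with
    exponents \<open>h\<close> and \<open>k\<close>.\<close>
  define A where "A = max (h * M powr (h - 1)) (k * M powr (k - 1))"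
  have A: "A > 0" using h1 M by (auto simp: A_def less_max_iff_disj)
  have cut: "cutoff M v \<in> {0..M}" "\<bar>cutoff M u - cutoff M v\<bar> \<le> \<bar>u - v\<bar>" for u v
    using M by (auto simp: cutoff_def)
  have lp: "\<bar>cutoff M u powr j - cutoff M v powr j\<bar> \<le> A * \<bar>u - v\<bar>" if "j = h \<or> j = k" for u v j
  proof -
    have "\<bar>cutoff M u powr j - cutoff M v powr j\<bar> \<le> j * M powr (j - 1) * \<bar>cutoff M u - cutoff M v\<bar>"
      using that h1 k1 cut by (intro powr_lipschitz) auto
    also have "\<dots> \<le> A * \<bar>u - v\<bar>"
      using that A cut(2)[of u v] by (intro mult_mono) (auto simp: A_def)
    finally show ?thesis .
  qed
  \<comment> \<open>The first summand yields the contraction factor 1/2; the added 1 gives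
    \<open>L \<ge> 1\<close>, whence the integral of \<open>w\<close> is at most
    \<open>w\<close>.\<close>
  define L where "L = 2 * A * (\<alpha> + \<beta> + \<nu>) + 1"
  have L: "L \<ge> 1" using A \<alpha>0 \<beta>0 \<nu> by (simp add: L_def)
  define w where "w t = exp (L * (t + t\<^sup>2))" for t :: real
  define FF where "FF y r = 1 - integral {0..r} (\<lambda>t. cutoff M (y t) powr h)" for y :: "real \<Rightarrow> real" and r
  define G where "G y r = \<alpha> * FF y r - \<beta> * r * cutoff M (y r) powr h - \<nu> * cutoff M (y r) powr k" for y :: "real \<Rightarrow> real" and r
  have cc: "continuous_on {0..} (\<lambda>t. cutoff M (y t) powr j)" if "continuous_on {0..} y" "j > 0" for y j
    unfolding cutoff_def using that by (intro continuous_on_powr' continuous_intros) auto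
  have h0: "h > 0" and k0: "k > 0" using h1 k1 by auto
  have FFc: "continuous_on {0..} (FF y)" if "continuous_on {0..} y" for y
    unfolding FF_def by (intro continuous_intros integral_continuous_on_halfline cc that h0)
  have Gc: "continuous_on {0..} (G y)" if "continuous_on {0..} y" for y
    unfolding G_def by (intro continuous_intros FFc cc that h0 k0)
  have wc: "continuous_on S w" for S unfolding w_def by (intro continuous_intros)
  have wc2: "continuous_on S (\<lambda>t. (1 + 2 * t) * w t)" for S unfolding w_def by (intro continuous_intros)
  have w0: "w t > 0" for t by (simp add: w_def)
  have int_w2: "integral {0..r} (\<lambda>t. (1 + 2 * t) * w t) \<le> w r / L" if "r \<ge> 0" for r
    using exp_weight_integral[of L r] L that by (simp add: w_def field_simps)
  have int_w: "integral {0..r} w \<le> w r" if "r \<ge> 0" for r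
  proof -
    have "integral {0..r} w \<le> integral {0..r} (\<lambda>t. (1 + 2 * t) * w t)"
      by (intro integral_le integrable_continuous_real wc wc2) (use w0 in auto)
    also have "\<dots> \<le> w r / L" by (rule int_w2[OF that])
    also have "\<dots> \<le> w r" using L w0[of r] by (simp add: field_simps)
    finally show ?thesis .
  qed
  obtain V where V: "continuous_on {0..} V" "\<And>r. r \<ge> 0 \<Longrightarrow> radial_flux n (G V) r = V r"
  proof (rule weighted_fixpoint[of w "\<lambda>y. radial_flux n (G y)" "\<alpha>"])
    show "continuous_on {0..} w" by (rule wc)
    show "w t > 0" for t by (rule w0)
    show "continuous_on {0..} (radial_flux n (G y))" if "continuous_on {0..} y" for y
      by (intro radial_flux_continuous n1 Gc that)
  next
    fix y z :: "real \<Rightarrow> real" and D r :: real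
    assume yz: "continuous_on {0..} y" "continuous_on {0..} z" and D: "D \<ge> 0"
      and le: "\<And>t. t \<ge> 0 \<Longrightarrow> \<bar>y t - z t\<bar> \<le> D * w t" and r: "r \<ge> 0"
    have FFle: "\<bar>FF y t - FF z t\<bar> \<le> A * D * w t" if t: "t \<ge> 0" for t
    proof -
      have c: "continuous_on {0..t} (\<lambda>t. cutoff M (y t) powr h)" "continuous_on {0..t} (\<lambda>t. cutoff M (z t) powr h)"
        using cc[OF yz(1) h0] cc[OF yz(2) h0] by (auto intro: continuous_on_subset)
      have "FF z t - FF y t = integral {0..t} (\<lambda>t. cutoff M (y t) powr h - cutoff M (z t) powr h)"
        unfolding FF_def by (subst integral_diff) (auto intro!: integrable_continuous_real c)
      moreover have "norm (integral {0..t} (\<lambda>t. cutoff M (y t) powr h - cutoff M (z t) powr h))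
          \<le> integral {0..t} (\<lambda>t. A * D * w t)"
      proof (rule integral_norm_bound_integral)
        fix s assume s: "s \<in> {0..t}"
        have "\<bar>cutoff M (y s) powr h - cutoff M (z s) powr h\<bar> \<le> A * \<bar>y s - z s\<bar>" by (rule lp) simp
        also have "\<dots> \<le> A * (D * w s)" using A le[of s] s by (intro mult_left_mono) auto
        finally show "norm (cutoff M (y s) powr h - cutoff M (z s) powr h) \<le> A * D * w s" by (simp add: mult_ac)
      qed (auto intro!: integrable_continuous_real continuous_intros c wc)
      moreover have "integral {0..t} (\<lambda>t. A * D * w t) \<le> A * D * w t"
        using int_w[OF t] A D by (simp add: mult_left_mono)
      ultimately show ?thesis by (simp add: abs_minus_commute)
    qed
    have Gle: "\<bar>G y t - G z t\<bar> \<le> D * A * (\<alpha> + \<beta> + \<nu>) * ((1 + 2 * t) * w t)" if t: "t \<ge> 0" for t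
    proof -
      have a1: "\<bar>cutoff M (y t) powr h - cutoff M (z t) powr h\<bar> \<le> A * D * w t"
        using order_trans[OF lp[of h "y t" "z t"] mult_left_mono[OF le[OF t], of A]] A
        by (simp add: mult_ac)
      have a2: "\<bar>cutoff M (y t) powr k - cutoff M (z t) powr k\<bar> \<le> A * D * w t"
        using order_trans[OF lp[of k "y t" "z t"] mult_left_mono[OF le[OF t], of A]] A
        by (simp add: mult_ac)
      have "G y t - G z t = \<alpha> * (FF y t - FF z t)
          - \<beta> * t * (cutoff M (y t) powr h - cutoff M (z t) powr h)
          - \<nu> * (cutoff M (y t) powr k - cutoff M (z t) powr k)"
        by (simp add: G_def algebra_simps)
      also have "\<bar>\<dots>\<bar> \<le> \<alpha> * (A * D * w t) + \<beta> * t * (A * D * w t) + \<nu> * (A * D * w t)"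
      proof -
        have "\<bar>\<alpha> * (FF y t - FF z t)\<bar> \<le> \<alpha> * (A * D * w t)"
          using FFle[OF t] \<alpha>0 by (simp add: abs_mult)
        moreover have "\<bar>\<beta> * t * (cutoff M (y t) powr h - cutoff M (z t) powr h)\<bar> \<le> \<beta> * t * (A * D * w t)"
          using a1 \<beta>0 t by (simp add: abs_mult mult_left_mono)
        moreover have "\<bar>\<nu> * (cutoff M (y t) powr k - cutoff M (z t) powr k)\<bar> \<le> \<nu> * (A * D * w t)"
          using a2 \<nu> by (simp add: abs_mult mult_left_mono)
        ultimately show ?thesis by linarith
      qed
      also have "\<dots> = (A * D * w t) * (\<alpha> + \<beta> * t + \<nu>)" by (simp add: algebra_simps)
      \<comment> \<open>The linear growth in \<open>t\<close> is traded for
        \<open>1 + 2 * t\<close>, the derivative of \<open>t + t^2\<close>, so that the product with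
        \<open>w\<close> integrates exactly.\<close>
      also have "\<dots> \<le> (A * D * w t) * ((\<alpha> + \<beta> + \<nu>) * (1 + 2 * t))"
        using A D w0[of t] \<alpha>0 \<beta>0 \<nu> t by (intro mult_left_mono) (auto simp: algebra_simps)
      finally show ?thesis by (simp add: mult_ac)
    qed
    have "\<bar>radial_flux n (G y) r - radial_flux n (G z) r\<bar>
        \<le> integral {0..r} (\<lambda>t. D * A * (\<alpha> + \<beta> + \<nu>) * ((1 + 2 * t) * w t))"
      unfolding radial_flux_diff[OF Gc[OF yz(1)] Gc[OF yz(2)]]
      using Gle by (intro radial_flux_le n1 r continuous_intros Gc yz wc) auto
    also have "\<dots> \<le> D * A * (\<alpha> + \<beta> + \<nu>) * (w r / L)"
      using mult_left_mono[OF int_w2[OF r], of "D * A * (\<alpha> + \<beta> + \<nu>)"] A D \<alpha>0 \<beta>0 \<nu> by simp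
    also have "\<dots> \<le> D / 2 * w r"
    proof -
      have "A * (\<alpha> + \<beta> + \<nu>) / L \<le> 1 / 2" using L by (simp add: L_def field_simps)
      from mult_left_mono[OF this, of "D * w r"] D w0[of r]
      show ?thesis by (simp add: field_simps)
    qed
    finally show "\<bar>radial_flux n (G y) r - radial_flux n (G z) r\<bar> \<le> D / 2 * w r" .
  next
    fix r :: real assume r: "r \<ge> 0"
    have "\<bar>radial_flux n (G (\<lambda>_. 0)) r\<bar> \<le> integral {0..r} (\<lambda>t. \<alpha> * w t)"
    proof (rule radial_flux_le[OF n1 _ _ r])
      show "\<bar>G (\<lambda>_. 0) t\<bar> \<le> \<alpha> * w t" if "0 \<le> t" "t \<le> r" for t
        using \<alpha>0 M that L by (auto simp: G_def FF_def cutoff_def w_def)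
    qed (auto intro!: Gc continuous_intros wc)
    also have "\<dots> \<le> \<alpha> * w r" using int_w[OF r] \<alpha>0 by simp
    finally show "\<bar>radial_flux n (G (\<lambda>_. 0)) r\<bar> \<le> \<alpha> * w r" .
  qed (rule that)
  show ?thesis
  proof (rule that[of "FF V" "V"])
    show "FF V 0 = 1" by (simp add: FF_def)
    show "V 0 = 0" using V(2)[of 0] by simp
    show "continuous_on {0..} (FF V)" "continuous_on {0..} V" by (intro FFc V)+
    fix r :: real assume r: "r > 0"
    show "DERIV (FF V) r :> - (cutoff M (V r) powr h)"
      unfolding FF_def
      by (rule derivative_eq_intros integral_real_derivative[OF cc[OF V(1) h0] r] refl)+ simp
    have "DERIV (radial_flux n (G V)) r :> G V r - (real n - 1) / r * V r"
      using radial_flux_derivative[OF n1 Gc[OF V(1)] r] V(2)[of r] r by simp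
    then have "DERIV V r :> G V r - (real n - 1) / r * V r"
    proof (rule DERIV_cong_ev[THEN iffD1, rotated 3, OF _ refl _ refl])
      show "\<forall>\<^sub>F x in nhds r. radial_flux n (G V) x = V x"
        using eventually_nhds_in_open[of "{0<..}" r] r V(2) by (auto elim!: eventually_mono)
    qed
    then show "DERIV V r :> \<alpha> * FF V r - \<beta> * r * cutoff M (V r) powr h
        - \<nu> * cutoff M (V r) powr k - (real n - 1) / r * V r"
      by (simp add: G_def)
  qed
qed

lemma h0: "h > 0" and k0: "k > 0" using h1 k1 by auto

text \<open>Any value with \<open>\<beta> * Vmax powr (h + 1) > \<alpha>^2\<close> would do; the
  added 1 ensures \<open>Vmax \<ge> 1\<close>, so that passing to the power \<open>h + 1\<close>
  does not decrease it.\<close>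

definition Vmax :: real where "Vmax = \<alpha>\<^sup>2 / \<beta> + 1"

lemma Vmax1: "Vmax \<ge> 1" using \<beta>0 by (simp add: Vmax_def)

lemma Vmax_powr: "\<alpha>\<^sup>2 < \<beta> * Vmax powr (h + 1)"
proof -
  have "\<alpha>\<^sup>2 < \<beta> * Vmax" using \<beta>0 by (simp add: Vmax_def field_simps)
  also have "Vmax powr 1 \<le> Vmax powr (h + 1)"
    using Vmax1 h0 by (intro powr_mono) auto
  then have "\<beta> * Vmax \<le> \<beta> * Vmax powr (h + 1)"
    using \<beta>0 Vmax1 by simp
  finally show ?thesis .
qed

text \<open>At the first \<open>c\<close> with \<open>V c = Vmax\<close>, the derivative is
  nonnegative, so \<open>\<beta> * c * Vmax powr h \<le> \<alpha>\<close>, while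
  \<open>V \<le> \<alpha> * r\<close> gives \<open>Vmax \<le> \<alpha> * c\<close>; together they
  contradict \<open>Vmax_powr\<close>. The abstract \<phi> and \<psi> serve both the truncated and
  the original system.\<close>

lemma a_priori_bound:
  fixes F V \<phi> \<psi> :: "real \<Rightarrow> real"
  assumes F0: "F 0 = 1" and V0: "V 0 = 0" and cF: "continuous_on {0..} F" and cV: "continuous_on {0..} V"
    and dF: "\<And>r. r > 0 \<Longrightarrow> DERIV F r :> - \<phi> r"
    and dV: "\<And>r. r > 0 \<Longrightarrow> DERIV V r :> \<alpha> * F r - \<beta> * r * \<phi> r - \<nu> * \<psi> r
        - (real n - 1) / r * V r"
    and nn: "\<And>r. \<phi> r \<ge> 0" "\<And>r. \<psi> r \<ge> 0" "\<nu> \<ge> 0"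
    and phi: "\<And>r. V r = Vmax \<Longrightarrow> \<phi> r = Vmax powr h"
    and r: "r \<ge> 0"
  shows "F r \<le> 1" "V r \<le> \<alpha> * r" "V r < Vmax"
proof -
  have Fle: "F r \<le> 1" if "r \<ge> 0" for r
  proof (cases "r = 0")
    case False
    have "F r \<le> F 0"
    proof (rule DERIV_nonpos_imp_decreasing_open[where f = F])
      show "\<exists>y. DERIV F x :> y \<and> y \<le> 0" if "0 < x" for x
        using dF[OF that] nn(1)[of x] by (intro exI[of _ "- \<phi> x"]) auto
    qed (use that False in \<open>auto intro: continuous_on_subset[OF cF]\<close>)
    then show ?thesis using F0 by simp
  qed (use F0 in auto)
  show "F r \<le> 1" using Fle r .
  have rhs: "\<alpha> * F r - \<beta> * r * \<phi> r - \<nu> * \<psi> r - (real n - 1) / r * V r \<le> \<alpha> - \<beta> * r * \<phi> r"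
    if "r > 0" "V r \<ge> 0" for r
  proof -
    have "\<alpha> * F r \<le> \<alpha> * 1" using Fle[of r] \<alpha>0 that by (intro mult_left_mono) auto
    moreover have "\<nu> * \<psi> r \<ge> 0" using nn by simp
    moreover have "(real n - 1) / r * V r \<ge> 0" using that n1 by simp
    ultimately show ?thesis by linarith
  qed
  have Vle: "V r \<le> \<alpha> * r" if r: "r \<ge> 0" for r
  proof (rule ccontr)
    assume "\<not> ?thesis"
    then have neg: "\<alpha> * r - V r < 0" by simp
    have cont: "continuous_on {0..r} (\<lambda>r. \<alpha> * r - V r)"
      by (intro continuous_intros continuous_on_subset[OF cV]) auto
    obtain c where c: "0 \<le> c" "c < r" "\<alpha> * c - V c = 0" "\<And>t. c < t \<Longrightarrow> t \<le> r \<Longrightarrow> \<alpha> * t - V t < 0"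
      using last_zero_to_neg[OF r cont _ neg] V0 by auto
    have "\<alpha> * c - V c \<le> \<alpha> * r - V r"
    proof (rule DERIV_nonneg_imp_increasing_open[where f = "\<lambda>r. \<alpha> * r - V r"])
      fix x assume x: "c < x" "x < r"
      have Vx: "V x \<ge> 0" using c(4)[of x] x c(1) \<alpha>0 mult_pos_pos[of \<alpha> x] by linarith
      have "DERIV (\<lambda>r. \<alpha> * r - V r) x :> \<alpha> - (\<alpha> * F x - \<beta> * x * \<phi> x - \<nu> * \<psi> x
        - (real n - 1) / x * V x)"
        using dV[of x] x c(1) by (auto intro!: derivative_eq_intros)
      moreover have "0 \<le> \<alpha> - (\<alpha> * F x - \<beta> * x * \<phi> x - \<nu> * \<psi> x - (real n - 1) / x * V x)"
      proof -
        have "0 \<le> \<beta> * x * \<phi> x" using x c(1) nn(1)[of x] \<beta>0 by simp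
        then show ?thesis using rhs[of x] x c(1) Vx by linarith
      qed
      ultimately show "\<exists>y. DERIV (\<lambda>r. \<alpha> * r - V r) x :> y \<and> 0 \<le> y" by blast
    next
      show "continuous_on {c..r} (\<lambda>r. \<alpha> * r - V r)"
        by (rule continuous_on_subset[OF cont]) (use c in auto)
    qed (use c in auto)
    then show False using c(3) neg by simp
  qed
  show "V r \<le> \<alpha> * r" using Vle r .
  show "V r < Vmax"
  proof (rule ccontr)
    assume "\<not> ?thesis"
    then have ge: "V r - Vmax \<ge> 0" by simp
    have cont: "continuous_on {0..r} (\<lambda>r. V r - Vmax)"
      by (intro continuous_intros continuous_on_subset[OF cV]) auto
    obtain c where c: "0 < c" "c \<le> r" "V c - Vmax = 0" "\<And>t. 0 \<le> t \<Longrightarrow> t < c \<Longrightarrow> V t - Vmax < 0"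
      using first_zero_from_neg[OF r cont _ ge] V0 Vmax1 by auto
    have Vc: "V c = Vmax" using c by simp
    have "0 \<le> \<alpha> * F c - \<beta> * c * \<phi> c - \<nu> * \<psi> c - (real n - 1) / c * V c"
      by (rule deriv_nonneg_if_max_from_left[OF c(1) _ dV[OF c(1)]]) (use c(3) c(4) in \<open>simp add: less_imp_le\<close>)
    also have "\<dots> \<le> \<alpha> - \<beta> * c * Vmax powr h"
      using rhs[OF c(1)] Vc phi[OF Vc] Vmax1 by simp
    finally have le: "\<beta> * c * Vmax powr h \<le> \<alpha>" by simp
    have "\<beta> * Vmax powr (h + 1) = (\<beta> * Vmax powr h) * Vmax"
      using Vmax1 by (simp add: powr_add)
    also have "\<dots> \<le> (\<beta> * Vmax powr h) * (\<alpha> * c)"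
      using Vle[of c] c Vc \<beta>0 by (intro mult_left_mono) auto
    also have "\<dots> = \<alpha> * (\<beta> * c * Vmax powr h)" by (simp add: mult_ac)
    also have "\<dots> \<le> \<alpha> * \<alpha>" using le \<alpha>0 by (intro mult_left_mono) auto
    finally show False using Vmax_powr by (simp add: power2_eq_square)
  qed
qed

lemma solD:
  assumes "sol \<nu> F V"
  shows "V 0 = 0" "continuous_on {0..} F" "continuous_on {0..} V"
    "\<And>r. r > 0 \<Longrightarrow> DERIV F r :> - (max 0 (V r) powr h)"
    "\<And>r. r > 0 \<Longrightarrow> DERIV V r :> \<alpha> * F r - \<beta> * r * max 0 (V r) powr h - \<nu> * max 0 (V r) powr k
        - (real n - 1) / r * V r"
  using assms unfolding sol_def by auto

lemma sol_exists:
  assumes "\<nu> \<ge> 0"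
  obtains F V where "sol \<nu> F V" "F 0 = 1"
proof -
  obtain F V where s: "F 0 = 1" "V 0 = 0" "continuous_on {0..} F" "continuous_on {0..} V"
    "\<And>r. r > 0 \<Longrightarrow> DERIV F r :> - (cutoff Vmax (V r) powr h)"
    "\<And>r. r > 0 \<Longrightarrow> DERIV V r :> \<alpha> * F r - \<beta> * r * cutoff Vmax (V r) powr h
        - \<nu> * cutoff Vmax (V r) powr k - (real n - 1) / r * V r"
    using truncated_sol_exists[of Vmax \<nu>] Vmax1 assms by auto
  have "V r < Vmax" if "r \<ge> 0" for r
    by (rule a_priori_bound(3)[OF s]) (use that assms Vmax1 in \<open>auto simp: cutoff_def\<close>)
  then have "cutoff Vmax (V r) = max 0 (V r)" if "r > 0" for r
    using that by (force simp: cutoff_def)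
  then have "sol \<nu> F V" unfolding sol_def using s by simp
  then show ?thesis using that s(1) by blast
qed

lemma sol_bounds:
  assumes s: "sol \<nu> F V" "F 0 = 1" and "\<nu> \<ge> 0" "r \<ge> 0"
  shows "F r \<le> 1" "V r \<le> \<alpha> * r" "V r < Vmax"
  using a_priori_bound[OF s(2) solD[OF s(1)] _ _ assms(3) _ assms(4)] Vmax1
  by auto

section \<open>Continuous dependence on the absorption coefficient\<close>

text \<open>
  Gronwall for the squared distance: the terms with \<open>\<beta>\<close>, with \<open>(n - 1) / r\<close> and with \<open>\<nu>1\<close> are monotone in \<open>V\<close> and have the
  good sign, so neither the singularity at 0 nor the growth in \<open>r\<close> matters.
\<close>

lemma sol_dependence:
  assumes s1: "sol \<nu>1 F1 V1" "F1 0 = 1" "\<nu>1 \<ge> 0" and s2: "sol \<nu>2 F2 V2" "F2 0 = 1" "\<nu>2 \<ge> 0"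
    and r: "r \<ge> 0"
  shows "(F1 r - F2 r)\<^sup>2 + (V1 r - V2 r)\<^sup>2
      \<le> (\<nu>1 - \<nu>2)\<^sup>2 * (Vmax powr k)\<^sup>2 * r * exp ((h * Vmax powr (h - 1) + \<alpha> + 1) * r)"
proof (cases "r = 0")
  case True
  then show ?thesis using s1(2) s2(2) solD(1)[OF s1(1)] solD(1)[OF s2(1)] by simp
next
  case False
  then have r: "r > 0" using assms by simp
  define L where "L = h * Vmax powr (h - 1)"
  define C where "C = L + \<alpha> + 1"
  define D where "D = (\<nu>1 - \<nu>2)\<^sup>2 * (Vmax powr k)\<^sup>2"
  have L0: "L \<ge> 0" using h0 by (simp add: L_def)
  define u where "u t = (F1 t - F2 t)\<^sup>2 + (V1 t - V2 t)\<^sup>2" for t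
  define g where "g t = exp (- C * t) * u t - D * t" for t
  have "g r \<le> g 0"
  proof (rule DERIV_nonpos_imp_decreasing_open[where f = g])
    show "continuous_on {0..r} g"
      unfolding g_def u_def using solD(2,3)[OF s1(1)] solD(2,3)[OF s2(1)]
      by (intro continuous_intros) (auto intro: continuous_on_subset)
    fix t assume t: "0 < t" "t < r"
    define x where "x = F1 t - F2 t"
    define y where "y = V1 t - V2 t"
    define \<phi> where "\<phi> = max 0 (V1 t) powr h - max 0 (V2 t) powr h"
    define \<psi> where "\<psi> = max 0 (V1 t) powr k - max 0 (V2 t) powr k"
    define \<psi>2 where "\<psi>2 = max 0 (V2 t) powr k"
    \<comment> \<open>The difference of the absorption terms is split as
      \<open>\<nu>1 * \<psi> + (\<nu>1 - \<nu>2) * \<psi>2\<close>: a monotone part with a good sign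
      and a perturbation proportional to the change of the coefficient.\<close>
    define u' where "u' = 2 * x * (- \<phi>) + 2 * y * (\<alpha> * x - \<beta> * t * \<phi> - (\<nu>1 * \<psi> + (\<nu>1 - \<nu>2) * \<psi>2)
        - (real n - 1) / t * y)"
    have du: "DERIV u t :> u'"
      unfolding u_def u'_def x_def y_def \<phi>_def \<psi>_def \<psi>2_def
      by (rule derivative_eq_intros solD(4,5)[OF s1(1) t(1)] solD(4,5)[OF s2(1) t(1)] refl)+
         (use t(1) in \<open>simp add: field_simps power2_eq_square\<close>)
    have dg: "DERIV g t :> exp (- C * t) * (u' - C * u t) - D"
      unfolding g_def
      by (rule derivative_eq_intros du refl)+ (simp add: algebra_simps)
    have b: "max 0 (V1 t) \<in> {0..Vmax}" "max 0 (V2 t) \<in> {0..Vmax}"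
      using sol_bounds(3)[OF s1, of t] sol_bounds(3)[OF s2, of t] t Vmax1 by auto
    have "\<bar>\<phi>\<bar> \<le> L * \<bar>max 0 (V1 t) - max 0 (V2 t)\<bar>"
      unfolding \<phi>_def L_def using h1 b by (intro powr_lipschitz) auto
    also have "\<dots> \<le> L * \<bar>y\<bar>" using L0 by (intro mult_left_mono) (auto simp: y_def)
    finally have \<phi>L: "\<bar>\<phi>\<bar> \<le> L * \<bar>y\<bar>" .
    have mono: "y * \<phi> \<ge> 0" "y * \<psi> \<ge> 0"
    proof -
      have *: "(a - b) * (max 0 a powr j - max 0 b powr j) \<ge> 0" if "j > 0" for a b j :: real
      proof (cases "a \<le> b")
        case True
        then have "max 0 a powr j \<le> max 0 b powr j" using that by (intro powr_mono2) auto
        then show ?thesis using True by (intro mult_nonpos_nonpos) auto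
      next
        case False
        then have "max 0 b powr j \<le> max 0 a powr j" using that by (intro powr_mono2) auto
        then show ?thesis using False by (intro mult_nonneg_nonneg) auto
      qed
      show "y * \<phi> \<ge> 0" "y * \<psi> \<ge> 0" unfolding y_def \<phi>_def \<psi>_def using * h0 k0 by auto
    qed
    have "- (2 * x * \<phi>) \<le> 2 * \<bar>x\<bar> * \<bar>\<phi>\<bar>" using abs_ge_minus_self[of "2 * x * \<phi>"] by (simp add: abs_mult)
    also have "\<dots> \<le> 2 * \<bar>x\<bar> * (L * \<bar>y\<bar>)" using \<phi>L by (intro mult_left_mono) auto
    also have "\<dots> = L * (2 * \<bar>x\<bar> * \<bar>y\<bar>)" by simp
    also have "\<dots> \<le> L * (x\<^sup>2 + y\<^sup>2)"
      using L0 sum_squares_bound[of "\<bar>x\<bar>" "\<bar>y\<bar>"] by (intro mult_left_mono) auto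
    finally have t1: "- (2 * x * \<phi>) \<le> L * (x\<^sup>2 + y\<^sup>2)" .
    have t2: "2 * y * (\<alpha> * x) \<le> \<alpha> * (x\<^sup>2 + y\<^sup>2)"
      using mult_left_mono[OF sum_squares_bound[of x y], of \<alpha>] \<alpha>0 by (simp add: mult_ac)
    have t3: "2 * y * (\<beta> * t * \<phi>) \<ge> 0" "2 * y * (\<nu>1 * \<psi>) \<ge> 0" "2 * y * ((real n - 1) / t * y) \<ge> 0"
    proof -
      have "0 \<le> (2 * \<beta> * t) * (y * \<phi>)" using mono \<beta>0 t by (intro mult_nonneg_nonneg[OF _ mono(1)]) auto
      then show "2 * y * (\<beta> * t * \<phi>) \<ge> 0" by (simp add: mult_ac)
      have "0 \<le> (2 * \<nu>1) * (y * \<psi>)" using s1(3) by (intro mult_nonneg_nonneg[OF _ mono(2)]) auto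
      then show "2 * y * (\<nu>1 * \<psi>) \<ge> 0" by (simp add: mult_ac)
      have "0 \<le> 2 * ((real n - 1) / t) * (y * y)" using n1 t by (intro mult_nonneg_nonneg[OF _ zero_le_square]) auto
      then show "2 * y * ((real n - 1) / t * y) \<ge> 0" by (simp add: mult_ac)
    qed
    have "\<psi>2\<^sup>2 \<le> (Vmax powr k)\<^sup>2"
      unfolding \<psi>2_def using b k0 by (intro power_mono powr_mono2) auto
    then have "((\<nu>1 - \<nu>2) * \<psi>2)\<^sup>2 \<le> D"
      unfolding D_def power_mult_distrib by (intro mult_left_mono) auto
    then have t4: "- (2 * y * ((\<nu>1 - \<nu>2) * \<psi>2)) \<le> y\<^sup>2 + D"
      using sum_squares_bound[of "-y" "(\<nu>1 - \<nu>2) * \<psi>2"] by simp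
    have "u' = - (2 * x * \<phi>) + 2 * y * (\<alpha> * x) - 2 * y * (\<beta> * t * \<phi>) - 2 * y * (\<nu>1 * \<psi>)
        - 2 * y * ((\<nu>1 - \<nu>2) * \<psi>2) - 2 * y * ((real n - 1) / t * y)"
      unfolding u'_def by (simp add: algebra_simps)
    also have "\<dots> \<le> L * (x\<^sup>2 + y\<^sup>2) + \<alpha> * (x\<^sup>2 + y\<^sup>2) + (y\<^sup>2 + D)"
      using t1 t2 t3 t4 by linarith
    also have "\<dots> \<le> C * u t + D" by (simp add: C_def u_def x_def y_def algebra_simps)
    finally have "u' - C * u t \<le> D" by simp
    then have "exp (- C * t) * (u' - C * u t) \<le> exp (- C * t) * D" by simp
    also have "\<dots> \<le> 1 * D"
    proof (intro mult_right_mono)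
      have "0 \<le> C * t" using t L0 \<alpha>0 by (simp add: C_def)
      then show "exp (- C * t) \<le> 1" by simp
    qed (simp add: D_def)
    finally show "\<exists>y. DERIV g t :> y \<and> y \<le> 0"
      using dg by (intro exI[of _ "exp (- C * t) * (u' - C * u t) - D"]) simp
  qed (use r in auto)
  moreover have "g 0 = 0" using s1(2) s2(2) solD(1)[OF s1(1)] solD(1)[OF s2(1)] by (simp add: g_def u_def)
  ultimately have "exp (- C * r) * u r \<le> D * r" by (simp add: g_def)
  then have "u r \<le> D * r * exp (C * r)"
    by (simp add: exp_minus field_simps)
  then show ?thesis unfolding u_def C_def D_def L_def by simp
qed

lemma sol_unique:
  assumes "sol \<nu> F1 V1" "F1 0 = 1" "\<nu> \<ge> 0" "sol \<nu> F2 V2" "F2 0 = 1" "r \<ge> 0"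
  shows "F1 r = F2 r"
  using sol_dependence[OF assms(1-5) assms(3,6)] by (simp add: sum_power2_le_zero_iff)

lemma sol_uniformly_close:
  assumes s: "sol \<nu> F V" "F 0 = 1" "\<nu> \<ge> 0" and \<eta>: "\<eta> > 0"
  shows "\<exists>\<delta>>0. \<forall>\<nu>' F' V' r. sol \<nu>' F' V' \<longrightarrow> F' 0 = 1 \<longrightarrow> \<nu>' \<ge> 0 \<longrightarrow> \<bar>\<nu>' - \<nu>\<bar> < \<delta> \<longrightarrow>
    0 \<le> r \<longrightarrow> r \<le> R \<longrightarrow> \<bar>F' r - F r\<bar> < \<eta> \<and> \<bar>V' r - V r\<bar> < \<eta>"
proof -
  define C where "C = h * Vmax powr (h - 1) + \<alpha> + 1"
  have C0: "C > 0" using h0 \<alpha>0 by (auto simp: C_def intro!: add_nonneg_pos mult_nonneg_nonneg)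
  \<comment> \<open>The Gronwall factor at the end of the interval; the added 1 keeps it positive
    for every \<open>R\<close>.\<close>
  define B where "B = (Vmax powr k)\<^sup>2 * \<bar>R\<bar> * exp (C * \<bar>R\<bar>) + 1"
  have B: "B > 0" unfolding B_def by (intro add_nonneg_pos) auto
  show ?thesis
  proof (intro exI conjI allI impI)
    show "\<eta> / sqrt B > 0" using \<eta> B by simp
    fix \<nu>' F' V' r
    assume a: "sol \<nu>' F' V'" "F' 0 = 1" "\<nu>' \<ge> 0" "\<bar>\<nu>' - \<nu>\<bar> < \<eta> / sqrt B" "0 \<le> r" "r \<le> R"
    have "(\<nu>' - \<nu>)\<^sup>2 * B < \<eta>\<^sup>2"
    proof -
      have "\<bar>\<nu>' - \<nu>\<bar>\<^sup>2 < (\<eta> / sqrt B)\<^sup>2" using a by (intro power_strict_mono) auto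
      then show ?thesis using B by (simp add: power_divide field_simps)
    qed
    moreover have "(F' r - F r)\<^sup>2 + (V' r - V r)\<^sup>2 \<le> (\<nu>' - \<nu>)\<^sup>2 * B"
    proof -
      have "(F' r - F r)\<^sup>2 + (V' r - V r)\<^sup>2 \<le> (\<nu>' - \<nu>)\<^sup>2 * ((Vmax powr k)\<^sup>2 * r * exp (C * r))"
        using sol_dependence[OF a(1-3) s a(5)] by (simp add: C_def mult_ac)
      also have "\<dots> \<le> (\<nu>' - \<nu>)\<^sup>2 * B"
      proof (intro mult_left_mono)
        have "(Vmax powr k)\<^sup>2 * r * exp (C * r) \<le> (Vmax powr k)\<^sup>2 * \<bar>R\<bar> * exp (C * \<bar>R\<bar>)"
          using a C0 by (intro mult_mono) auto
        then show "(Vmax powr k)\<^sup>2 * r * exp (C * r) \<le> B" by (simp add: B_def)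
      qed auto
      finally show ?thesis .
    qed
    ultimately have "(F' r - F r)\<^sup>2 + (V' r - V r)\<^sup>2 < \<eta>\<^sup>2" by linarith
    then have "(F' r - F r)\<^sup>2 < \<eta>\<^sup>2" "(V' r - V r)\<^sup>2 < \<eta>\<^sup>2"
      using zero_le_power2[of "F' r - F r"] zero_le_power2[of "V' r - V r"] by linarith+
    then show "\<bar>F' r - F r\<bar> < \<eta>" "\<bar>V' r - V r\<bar> < \<eta>"
      using \<eta> abs_le_square_iff[of \<eta> "F' r - F r"] abs_le_square_iff[of \<eta> "V' r - V r"] by auto
  qed
qed

section \<open>Positivity of the flux, and scaling\<close>

lemma sol_flux_positive:
  assumes s: "sol \<nu> F V" and \<nu>: "\<nu> \<ge> 0" and pos: "\<And>r. 0 \<le> r \<Longrightarrow> r < S \<Longrightarrow> F r > 0"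
    and r: "0 < r" "r \<le> S"
  shows "V r > 0"
proof -
  note V = solD[OF s]
  \<comment> \<open>Where \<open>V < 0\<close> the powers are cut off and
    \<open>V' = \<alpha> * F - (n - 1) / r * V\<close> is nonnegative, so \<open>V\<close> cannot
    have descended from its last zero.\<close>
  have nn: "V r \<ge> 0" if r1: "0 < r" "r < S" for r
  proof (rule ccontr)
    assume "\<not> V r \<ge> 0"
    then have neg: "V r < 0" by simp
    have c0: "continuous_on {0..r} V" by (rule continuous_on_subset[OF V(3)]) auto
    obtain c where c: "0 \<le> c" "c < r" "V c = 0" "\<And>t. c < t \<Longrightarrow> t \<le> r \<Longrightarrow> V t < 0"
      using last_zero_to_neg[OF _ c0 _ neg] V(1) r1 by auto
    have "V c \<le> V r"
    proof (rule DERIV_nonneg_imp_increasing_open[where f = V])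
      fix x assume x: "c < x" "x < r"
      have "V x < 0" using c(4) x by simp
      have "\<alpha> * F x > 0" using pos[of x] x c r1 \<alpha>0 by simp
      moreover have "(real n - 1) / x * V x \<le> 0"
        using x c(1) n1 by (intro mult_nonneg_nonpos less_imp_le[OF \<open>V x < 0\<close>]) auto
      ultimately have "\<alpha> * F x - (real n - 1) / x * V x \<ge> 0" by linarith
      moreover have "DERIV V x :> \<alpha> * F x - (real n - 1) / x * V x"
        using V(5)[of x] x c \<open>V x < 0\<close> by (simp add: max_absorb1)
      ultimately show "\<exists>y. DERIV V x :> y \<and> 0 \<le> y" by blast
    qed (use c in \<open>auto intro: continuous_on_subset[OF c0]\<close>)
    then show False using c neg by simp
  qed
  have "compact (V ` {0..S})"
    by (intro compact_continuous_image continuous_on_subset[OF V(3)]) auto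
  then obtain B0 where B0: "\<And>t. 0 \<le> t \<Longrightarrow> t \<le> S \<Longrightarrow> \<bar>V t\<bar> \<le> B0"
    by (force dest!: compact_imp_bounded simp: bounded_iff)
  \<comment> \<open>On the interval from \<open>r / 2\<close> to \<open>r\<close> the negative terms
    of \<open>V'\<close> add up to at most \<open>K * V\<close>, as all exponents are at least 1.
    Hence \<open>exp (K * t) * V t\<close> increases strictly, driven by
    \<open>\<alpha> * F > 0\<close>. Only interior points enter, so \<open>r = S\<close> is allowed;
    this matters at the first zero of \<open>F\<close>.\<close>
  define K where "K = \<beta> * S * B0 powr (h - 1) + \<nu> * B0 powr (k - 1) + (real n - 1) / (r / 2)"
  have "exp (K * (r / 2)) * V (r / 2) < exp (K * r) * V r"
  proof (rule DERIV_pos_imp_increasing_open[where f = "\<lambda>t. exp (K * t) * V t"])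
    show "continuous_on {r / 2..r} (\<lambda>t. exp (K * t) * V t)"
      using r by (intro continuous_intros continuous_on_subset[OF V(3)]) auto
    fix x assume x: "r / 2 < x" "x < r"
    have x0: "0 < x" "x < S" using x r by auto
    have Vx: "V x \<ge> 0" "V x \<le> B0" using nn[OF x0] B0[of x] x0 by auto
    define V' where "V' = \<alpha> * F x - \<beta> * x * V x powr h - \<nu> * V x powr k - (real n - 1) / x * V x"
    have d: "DERIV V x :> V'"
      using V(5)[OF x0(1)] Vx by (simp add: V'_def max_absorb2)
    have pw: "V x powr j \<le> B0 powr (j - 1) * V x" if "j > 1" for j
    proof (cases "V x = 0")
      case False
      then have "V x powr j = V x powr (j - 1) * V x" using Vx by (simp add: powr_diff)
      also have "\<dots> \<le> B0 powr (j - 1) * V x"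
        using Vx that by (auto intro!: mult_right_mono powr_mono2)
      finally show ?thesis .
    qed auto
    have "\<beta> * x * V x powr h \<le> \<beta> * S * (B0 powr (h - 1) * V x)"
      using pw[OF h1] \<beta>0 x0 Vx by (intro mult_mono) auto
    moreover have "\<nu> * V x powr k \<le> \<nu> * (B0 powr (k - 1) * V x)"
      using pw[OF k1] \<nu> by (intro mult_left_mono) auto
    moreover have "(real n - 1) / x * V x \<le> (real n - 1) / (r / 2) * V x"
      using Vx x r n1 by (intro mult_right_mono divide_left_mono) auto
    moreover have "\<alpha> * F x > 0" using pos[of x] x0 \<alpha>0 by simp
    ultimately have "V' + K * V x > 0" by (simp add: V'_def K_def algebra_simps)
    moreover have "DERIV (\<lambda>t. exp (K * t) * V t) x :> exp (K * x) * (V' + K * V x)"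
      by (rule derivative_eq_intros d refl)+ (simp add: algebra_simps)
    ultimately show "\<exists>y. DERIV (\<lambda>t. exp (K * t) * V t) x :> y \<and> 0 < y"
      by (metis exp_gt_zero mult_pos_pos)
  qed (use r in auto)
  moreover have "exp (K * (r / 2)) * V (r / 2) \<ge> 0" using nn[of "r / 2"] r by simp
  ultimately have "0 < exp (K * r) * V r" by linarith
  then show ?thesis by (simp add: zero_less_mult_iff)
qed

text \<open>By \<open>\<mu>h\<close> the powers of \<open>b\<close> agree in every term except the
  absorption, where \<open>b powr - \<kappa>\<close> is left over. A suitable \<open>b\<close>
  therefore turns any positive coefficient into 1, or any positive \<open>F 0\<close> into
  1.\<close>

lemma sol_scale:
  assumes s: "sol \<nu> F V" and b: "b > 0"
  shows "sol (\<nu> * b powr - \<kappa>) (\<lambda>r. b powr \<mu> * F (b * r)) (\<lambda>r. b powr (\<mu> - 1) * V (b * r))"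
proof -
  note V = solD[OF s]
  have mx: "max 0 (b powr (\<mu> - 1) * v) powr j = b powr ((\<mu> - 1) * j) * max 0 v powr j" for v j
  proof -
    have "max 0 (b powr (\<mu> - 1) * v) = b powr (\<mu> - 1) * max 0 v"
      using b by (simp add: max_def zero_le_mult_iff)
    then show ?thesis by (simp add: powr_mult powr_powr)
  qed
  have e1: "b powr ((\<mu> - 1) * h) = b * b powr \<mu>" using b by (simp add: \<mu>h powr_add)
  have e2: "b powr - \<kappa> * b powr ((\<mu> - 1) * k) = b powr \<mu>"
    using \<kappa>_flux by (simp flip: powr_add)
  have e3: "b * b powr (\<mu> - 1) = b powr \<mu>" using b by (simp add: powr_diff)
  show ?thesis
    unfolding sol_def
  proof (intro conjI allI impI)
    show "b powr (\<mu> - 1) * V (b * 0) = 0" using V by simp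
    show "continuous_on {0..} (\<lambda>r. b powr \<mu> * F (b * r))"
      using b by (intro continuous_intros continuous_on_compose2[OF V(2)]) auto
    show "continuous_on {0..} (\<lambda>r. b powr (\<mu> - 1) * V (b * r))"
      using b by (intro continuous_intros continuous_on_compose2[OF V(3)]) auto
    fix r :: real assume r: "r > 0"
    have br: "b * r > 0" using b r by simp
    have lin: "DERIV (\<lambda>r. b * r) r :> b"
      by (rule derivative_eq_intros refl)+ simp
    have dF: "DERIV (\<lambda>r. F (b * r)) r :> - (max 0 (V (b * r)) powr h) * b"
      using DERIV_chain2[OF V(4)[OF br] lin] .
    show "DERIV (\<lambda>r. b powr \<mu> * F (b * r)) r :> - (max 0 (b powr (\<mu> - 1) * V (b * r)) powr h)"
      using DERIV_cmult[OF dF, of "b powr \<mu>"] unfolding mx e1 by (simp add: mult_ac)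
    let ?S = "\<alpha> * F (b * r) - \<beta> * (b * r) * max 0 (V (b * r)) powr h
       - \<nu> * max 0 (V (b * r)) powr k"
    let ?D = "?S - (real n - 1) / (b * r) * V (b * r)"
    let ?T = "\<alpha> * (b powr \<mu> * F (b * r)) - \<beta> * r * max 0 (b powr (\<mu> - 1) * V (b * r)) powr h -
       \<nu> * b powr - \<kappa> * max 0 (b powr (\<mu> - 1) * V (b * r)) powr k -
       (real n - 1) / r * (b powr (\<mu> - 1) * V (b * r))"
    have dV: "DERIV (\<lambda>r. V (b * r)) r :> (?D) * b"
      using DERIV_chain2[OF V(5)[OF br] lin] .
    have "b powr (\<mu> - 1) * ((?D) * b) =
       ?T"
    proof -
      have "b powr (\<mu> - 1) * (?D * b) = (b * b powr (\<mu> - 1)) * (?S) - b powr (\<mu> - 1) * ((real n - 1) / r * V (b * r))"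
        using b r by (simp add: field_simps)
      also have "\<dots> = \<alpha> * (b powr \<mu> * F (b * r)) - \<beta> * r * ((b * b powr \<mu>) * max 0 (V (b * r)) powr h) -
         \<nu> * (b powr \<mu> * max 0 (V (b * r)) powr k) - (real n - 1) / r * (b powr (\<mu> - 1) * V (b * r))"
        unfolding e3 by (simp add: algebra_simps)
      also have "\<dots> = ?T" unfolding mx e1 e2[symmetric] by (simp add: mult_ac)
      finally show ?thesis .
    qed
    then show "DERIV (\<lambda>r. b powr (\<mu> - 1) * V (b * r)) r :> ?T"
      using DERIV_cmult[OF dV, of "b powr (\<mu> - 1)"] by simp
  qed
qed

section \<open>Logarithmic variables\<close>

definition drift :: "real \<Rightarrow> real \<Rightarrow> real \<Rightarrow> real \<Rightarrow> real" where
  "drift \<nu> s w z = (\<mu> - real n) * z + \<alpha> * w - \<beta> * z powr h - \<nu> * exp (- \<kappa> * s) * z powr k"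

abbreviation slope :: "(real \<Rightarrow> real) \<Rightarrow> (real \<Rightarrow> real) \<Rightarrow> real \<Rightarrow> real" where
  "slope W Z s \<equiv> \<mu> * W s - Z s powr h"

text \<open>Orbits start at minus infinity, which is the origin \<open>r = 0\<close>, but can be
  followed only while \<open>F\<close> is positive; hence an open, downward closed \<open>I\<close>
  instead of the whole line.\<close>

definition logsys :: "real \<Rightarrow> real set \<Rightarrow> (real \<Rightarrow> real) \<Rightarrow> (real \<Rightarrow> real) \<Rightarrow> bool" where
  "logsys \<nu> I W Z \<longleftrightarrow> open I \<and> (\<forall>s\<in>I. \<forall>t\<le>s. t \<in> I) \<and>
    (\<forall>s\<in>I. W s > 0 \<and> Z s > 0 \<and> DERIV W s :> slope W Z s \<and>
       DERIV Z s :> drift \<nu> s (W s) (Z s))"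

lemma logsysD:
  assumes "logsys \<nu> I W Z" "s \<in> I"
  shows "W s > 0" "Z s > 0" "DERIV W s :> slope W Z s"
    "DERIV Z s :> drift \<nu> s (W s) (Z s)"
  using assms unfolding logsys_def by auto

lemma logsys_down:
  assumes "logsys \<nu> I W Z" "s \<in> I" "t \<le> s"
  shows "t \<in> I"
  using assms unfolding logsys_def by auto

lemma logsys_of_sol:
  assumes s: "sol \<nu> F V" and \<nu>: "\<nu> \<ge> 0" and F0: "F 0 > 0"
    and I: "open I" "\<And>s t. s \<in> I \<Longrightarrow> t \<le> s \<Longrightarrow> t \<in> I" and pos: "\<And>s. s \<in> I \<Longrightarrow> F (exp s) > 0"
  shows "logsys \<nu> I (\<lambda>s. exp (\<mu> * s) * F (exp s)) (\<lambda>s. exp ((\<mu> - 1) * s) * V (exp s))"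
  unfolding logsys_def
proof (intro conjI ballI)
  show "open I" by (rule I)
  show "\<forall>t\<le>s. t \<in> I" if "s \<in> I" for s using I that by auto
  fix s assume sI: "s \<in> I"
  show "0 < exp (\<mu> * s) * F (exp s)" using pos[OF sI] by simp
  have "F r > 0" if r: "0 \<le> r" "r < exp s" for r
  proof (cases "r = 0")
    case False
    then have "ln r \<le> s" using r by (simp add: ln_le_cancel_iff[of r "exp s", simplified])
    then show ?thesis using pos[OF I(2)[OF sI]] r False by fastforce
  qed (use F0 in simp)
  then have V0: "V (exp s) > 0" by (rule sol_flux_positive[OF s \<nu>, of "exp s"]) auto
  then show "0 < exp ((\<mu> - 1) * s) * V (exp s)" by simp
  let ?W = "exp (\<mu> * s) * F (exp s)" and ?Z = "exp ((\<mu> - 1) * s) * V (exp s)"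
  let ?S = "\<alpha> * F (exp s) - \<beta> * exp s * V (exp s) powr h - \<nu> * V (exp s) powr k"
  let ?D = "?S - (real n - 1) / exp s * V (exp s)"
  have e0: "exp s > 0" by simp
  have dF: "DERIV F (exp s) :> - (V (exp s) powr h)"
    using solD(4)[OF s e0] V0 by (simp add: max_absorb2)
  have dV: "DERIV V (exp s) :> ?D"
    using solD(5)[OF s e0] V0 by (simp add: max_absorb2)
  note ph = exp_flux_powr[of s "V (exp s)"]
  have pk: "exp (- \<kappa> * s) * ?Z powr k = exp (\<mu> * s) * V (exp s) powr k"
  proof -
    have "exp (- \<kappa> * s) * exp (((\<mu> - 1) * k) * s) = exp ((- \<kappa> + (\<mu> - 1) * k) * s)"
      by (simp only: distrib_right exp_add)
    then have "exp (- \<kappa> * s) * exp (((\<mu> - 1) * k) * s) = exp (\<mu> * s)" using \<kappa>_flux by simp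
    then show ?thesis by (simp add: powr_mult exp_powr_real mult_ac)
  qed
  have em: "exp ((\<mu> - 1) * s) * exp s = exp (\<mu> * s)"
    by (simp add: algebra_simps flip: exp_add)
  have dFe: "DERIV (\<lambda>s. F (exp s)) s :> - (V (exp s) powr h) * exp s"
    by (rule DERIV_chain2[where f = F and g = exp, OF dF DERIV_exp])
  show "DERIV (\<lambda>s. exp (\<mu> * s) * F (exp s)) s :> \<mu> * ?W - ?Z powr h"
    unfolding ph by (rule derivative_eq_intros dFe refl)+ (simp add: algebra_simps)
  have dVe: "DERIV (\<lambda>s. V (exp s)) s :> (?D) * exp s"
    by (rule DERIV_chain2[where f = V and g = exp, OF dV DERIV_exp])
  have "exp ((\<mu> - 1) * s) * ((?D) * exp s) =
      (exp ((\<mu> - 1) * s) * exp s) * (?S)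
        - (real n - 1) * ?Z"
    by (simp add: field_simps)
  also have "\<dots> = \<alpha> * ?W - \<beta> * (exp (\<mu> * s) * exp s * V (exp s) powr h)
      - \<nu> * (exp (\<mu> * s) * V (exp s) powr k) - (real n - 1) * ?Z"
    unfolding em by (simp add: algebra_simps)
  finally have e: "exp ((\<mu> - 1) * s) * ((?D) * exp s) = \<dots>" .
  have "DERIV (\<lambda>s. exp ((\<mu> - 1) * s) * V (exp s)) s :> (\<mu> - 1) * ?Z + exp ((\<mu> - 1) * s) * ((?D) * exp s)"
    by (rule derivative_eq_intros dVe refl)+ (simp add: algebra_simps)
  then show "DERIV (\<lambda>s. exp ((\<mu> - 1) * s) * V (exp s)) s :> drift \<nu> s ?W ?Z"
    unfolding e drift_def ph[symmetric] pk[symmetric]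
    by (rule back_subst[of "\<lambda>d. DERIV _ s :> d"]) (simp add: algebra_simps)
qed

text \<open>The first coordinate of the positive equilibrium of the system without absorption:
  \<open>Z^h = \<mu> W\<close> and \<open>Z' = 0\<close> give
  \<open>(\<mu> - n) (\<mu> W)^(1/h) = (\<mu> \<beta> - \<alpha>) W\<close>.\<close>

definition wst :: real where
  "wst = (\<mu> powr (1 / h) * (\<mu> - real n) / (\<mu> * \<beta> - \<alpha>)) powr (1 / (1 - 1 / h))"

lemma wst_pos: "wst > 0"
  using \<mu>n \<mu>1 \<mu>\<beta> by (simp add: wst_def)

lemma h_inv: "0 < 1 / h" "1 / h < 1" using h1 by auto

text \<open>A sublinear power is compared with a linear term: after division by
  \<open>w powr (1 / h)\<close> the left side is constant and the right side increases in
  \<open>w\<close>.\<close>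

lemma balance_sign:
  assumes w: "w > 0"
  shows "(\<mu> - real n) * (\<mu> * w) powr (1 / h) > (\<mu> * \<beta> - \<alpha>) * w \<longleftrightarrow> w < wst"
    and "(\<mu> - real n) * (\<mu> * w) powr (1 / h) < (\<mu> * \<beta> - \<alpha>) * w \<longleftrightarrow> w > wst"
proof -
  define c where "c = \<mu> powr (1 / h) * (\<mu> - real n) / (\<mu> * \<beta> - \<alpha>)"
  define m where "m = 1 - 1 / h"
  have m: "m > 0" using h_inv by (simp add: m_def)
  have c: "c > 0" using \<mu>n \<mu>1 \<mu>\<beta> by (simp add: c_def)
  have wst: "wst powr m = c" using m c by (simp add: wst_def c_def[symmetric] m_def[symmetric] powr_powr)
  have d: "\<mu> * \<beta> - \<alpha> > 0" using \<mu>\<beta> by simp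
  have w1: "w = w powr (1 / h) * w powr m" using w by (simp add: m_def flip: powr_add)
  have l: "(\<mu> - real n) * (\<mu> * w) powr (1 / h) = (\<mu> * \<beta> - \<alpha>) * w powr (1 / h) * c"
    using d w \<mu>1 by (simp add: c_def powr_mult)
  have r: "(\<mu> * \<beta> - \<alpha>) * w = (\<mu> * \<beta> - \<alpha>) * w powr (1 / h) * w powr m"
    using w1 by simp
  have p: "(\<mu> * \<beta> - \<alpha>) * w powr (1 / h) > 0" using d w by simp
  have "w < wst \<longleftrightarrow> w powr m < wst powr m" "w > wst \<longleftrightarrow> w powr m > wst powr m"
    using w wst_pos m powr_less_cancel2[of m] powr_less_mono2[of m] by (metis less_imp_le)+
  then show "(\<mu> - real n) * (\<mu> * w) powr (1 / h) > (\<mu> * \<beta> - \<alpha>) * w \<longleftrightarrow> w < wst"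
    "(\<mu> - real n) * (\<mu> * w) powr (1 / h) < (\<mu> * \<beta> - \<alpha>) * w \<longleftrightarrow> w > wst"
    unfolding l r wst using p by (metis mult_less_cancel_left_pos)+
qed

section \<open>Sign changes of the slope\<close>

lemma logsys_slope_derivative:
  assumes L: "logsys \<nu> I W Z" and s: "s \<in> I"
  shows "DERIV (\<lambda>s. slope W Z s) s :> \<mu> * (slope W Z s) - h * Z s powr (h - 1) * drift \<nu> s (W s) (Z s)"
proof -
  note d = logsysD[OF L s]
  have "DERIV (\<lambda>s. Z s powr h) s :> h * Z s powr (h - 1) * drift \<nu> s (W s) (Z s)"
    using DERIV_chain2[OF has_real_derivative_powr d(4)] d(2) by simp
  from DERIV_diff[OF DERIV_cmult[OF d(3), of \<mu>] this] show ?thesis .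
qed

text \<open>At a common zero both \<open>W\<close> and \<open>Z\<close> are stationary, so only the
  explicit dependence on \<open>s\<close> through the absorption contributes.\<close>

lemma logsys_drift_derivative:
  assumes L: "logsys \<nu> I W Z" and s: "s \<in> I" and 0: "slope W Z s = 0" "drift \<nu> s (W s) (Z s) = 0"
  shows "DERIV (\<lambda>s. drift \<nu> s (W s) (Z s)) s :> \<nu> * \<kappa> * exp (- \<kappa> * s) * Z s powr k"
proof -
  note d = logsysD[OF L s]
  have p: "DERIV (\<lambda>s. Z s powr j) s :> 0" for j
    using DERIV_chain2[OF has_real_derivative_powr d(4)] d(2) 0 by simp
  have dW: "DERIV W s :> 0" and dZ: "DERIV Z s :> 0"
    using d 0 by auto
  show ?thesis
    unfolding drift_def
    by (rule derivative_eq_intros p dW dZ refl)+ (simp add: algebra_simps)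
qed

lemma slope_zero_flux:
  assumes "w > 0" "z > 0" "\<mu> * w - z powr h = 0"
  shows "z = (\<mu> * w) powr (1 / h)"
  using assms h0 by (simp add: powr_powr)

lemma logsys_continuous:
  assumes "logsys \<nu> I W Z" "S \<subseteq> I"
  shows "continuous_on S W" "continuous_on S Z" "continuous_on S (\<lambda>s. slope W Z s)"
  using assms
  by (auto intro!: continuous_at_imp_continuous_on DERIV_isCont logsysD(3,4) logsys_slope_derivative)

text \<open>
  If the drift vanished together with the slope, the decay of \<open>exp (- \<kappa> s)\<close> would make it negative
  just before \<open>s\<close>, and the slope would increase towards its zero.
\<close>

lemma logsys_first_zero:
  assumes L: "logsys \<nu> I W Z" and \<nu>: "\<nu> > 0" and s: "s \<in> I" and 0: "slope W Z s = 0"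
    and pos: "\<And>t. t < s \<Longrightarrow> slope W Z t > 0"
  shows "drift \<nu> s (W s) (Z s) > 0" "W s < wst"
proof -
  note d = logsysD[OF L s]
  define P where "P t = slope W Z t" for t
  define G where "G t = drift \<nu> t (W t) (Z t)" for t
  have hz: "h * Z s powr (h - 1) > 0" using h0 d by simp
  have dP: "DERIV P s :> - (h * Z s powr (h - 1) * G s)"
    using logsys_slope_derivative[OF L s] 0 unfolding P_def G_def by simp
  have "0 \<le> - (- (h * Z s powr (h - 1) * G s))"
  proof (rule deriv_nonneg_if_max_from_left[where g = "\<lambda>t. - P t"])
    show "s - 1 < s" by simp
    show "- P t \<le> - P s" if "t < s" for t using pos[OF that] 0 by (simp add: P_def)
    show "DERIV (\<lambda>t. - P t) s :> - (- (h * Z s powr (h - 1) * G s))"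
      by (rule DERIV_minus[OF dP])
  qed
  then have "G s \<ge> 0" using hz by (simp add: zero_le_mult_iff)
  moreover have "G s \<noteq> 0"
  proof
    assume G0: "G s = 0"
    have "DERIV G s :> \<nu> * \<kappa> * exp (- \<kappa> * s) * Z s powr k"
      unfolding G_def by (rule logsys_drift_derivative[OF L s 0]) (use G0 in \<open>simp add: G_def\<close>)
    moreover have "\<nu> * \<kappa> * exp (- \<kappa> * s) * Z s powr k > 0" using \<nu> \<kappa>0 d by simp
    ultimately obtain e where e: "e > 0" "\<And>x. 0 < x \<Longrightarrow> x < e \<Longrightarrow> G (s - x) < G s"
      using DERIV_pos_inc_left by blast
    have "P (s - e / 2) < P s"
    proof (rule DERIV_pos_imp_increasing_open[where f = P])
      show "s - e / 2 < s" using e by simp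
      fix x assume x: "s - e / 2 < x" "x < s"
      have xI: "x \<in> I" by (rule logsys_down[OF L s]) (use x in simp)
      have "G x < 0" using e(2)[of "s - x"] x G0 by simp
      then have "h * Z x powr (h - 1) * G x < 0"
        using h0 logsysD(2)[OF L xI] by (simp add: mult_less_0_iff)
      moreover have "\<mu> * P x > 0" using pos[OF x(2)] \<mu>1 by (simp add: P_def)
      moreover have "DERIV P x :> \<mu> * P x - h * Z x powr (h - 1) * G x"
        using logsys_slope_derivative[OF L xI] unfolding P_def G_def .
      ultimately show "\<exists>y. DERIV P x :> y \<and> 0 < y"
        by (intro exI[of _ "\<mu> * P x - h * Z x powr (h - 1) * G x"]) auto
    next
      show "continuous_on {s - e / 2..s} P"
        unfolding P_def using logsys_down[OF L s] by (intro logsys_continuous(3)[OF L]) auto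
    qed
    then show False using pos[of "s - e / 2"] 0 e by (simp add: P_def)
  qed
  ultimately show G: "drift \<nu> s (W s) (Z s) > 0" by (simp add: G_def)
  \<comment> \<open>Without the absorption the drift is even larger; with
    \<open>Z^h = \<mu> W\<close> its positivity is the inequality of
    \<open>balance_sign\<close>.\<close>
  have "\<nu> * exp (- \<kappa> * s) * Z s powr k \<ge> 0" using \<nu> by simp
  then have "(\<mu> - real n) * Z s > (\<mu> * \<beta> - \<alpha>) * W s"
    using G 0 unfolding drift_def by (simp add: algebra_simps)
  then show "W s < wst"
    using balance_sign(1)[OF d(1)] slope_zero_flux[OF d(1,2) 0] by simp
qed

text \<open>At a next zero \<open>c\<close> of the slope the drift would be nonpositive. On the
  curve \<open>Z^h = \<mu> W\<close>, however, \<open>drift / Z\<close> decreases in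
  \<open>Z\<close> and increases with time; since \<open>W\<close>, hence \<open>Z\<close>, is
  smaller at \<open>c\<close> than at \<open>s\<close>, it would still be positive there.\<close>

lemma logsys_after_zero:
  assumes L: "logsys \<nu> I W Z" and \<nu>: "\<nu> \<ge> 0" and s: "s \<in> I" and 0: "slope W Z s = 0"
    and G: "drift \<nu> s (W s) (Z s) > 0" and t: "t \<in> I" "t > s"
  shows "slope W Z t < 0"
proof (rule ccontr)
  define P where "P t = slope W Z t" for t
  assume "\<not> ?thesis"
  then have Pt: "P t \<ge> 0" by (simp add: P_def)
  note d = logsysD[OF L s]
  have "DERIV P s :> - (h * Z s powr (h - 1) * drift \<nu> s (W s) (Z s))"
    using logsys_slope_derivative[OF L s] 0 unfolding P_def by simp
  moreover have "- (h * Z s powr (h - 1) * drift \<nu> s (W s) (Z s)) < 0" using h0 d G by simp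
  ultimately obtain e where e: "e > 0" "\<And>x. 0 < x \<Longrightarrow> x < e \<Longrightarrow> P (s + x) < P s"
    using DERIV_neg_dec_right by blast
  \<comment> \<open>A starting point just after \<open>s\<close> where the slope is already
    negative, since the slope vanishes at \<open>s\<close> itself.\<close>
  define a where "a = s + min e (t - s) / 2"
  have a: "s < a" "a < t" "a - s < e" using e t by (auto simp: a_def min_def field_simps)
  have sub: "{s..t} \<subseteq> I" using logsys_down[OF L t(1)] by auto
  have cont: "continuous_on {x..t} P" if "s \<le> x" for x
    unfolding P_def using that by (intro logsys_continuous(3)[OF L] subset_trans[OF _ sub]) auto
  have Pneg: "P x < 0" if "s < x" "x \<le> a" for x
    using e(2)[of "x - s"] that a 0 by (simp add: P_def)
  have "a \<le> t" "P a < 0" "s \<le> a" using a Pneg[of a] by auto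
  then obtain c where c: "a < c" "c \<le> t" "P c = 0" "\<And>x. a \<le> x \<Longrightarrow> x < c \<Longrightarrow> P x < 0"
    using first_zero_from_neg[OF \<open>a \<le> t\<close> cont _ Pt] by metis
  have neg: "P x < 0" if "s < x" "x < c" for x
    using Pneg[of x] c(4)[of x] that by force
  have cI: "c \<in> I" using c a sub by auto
  note dc = logsysD[OF L cI]
  have dP: "DERIV P c :> - (h * Z c powr (h - 1) * drift \<nu> c (W c) (Z c))"
    using logsys_slope_derivative[OF L cI] c(3) unfolding P_def by simp
  have "0 \<le> - (h * Z c powr (h - 1) * drift \<nu> c (W c) (Z c))"
    by (rule deriv_nonneg_if_max_from_left[OF c(1) _ dP]) (use c in \<open>simp add: less_imp_le\<close>)
  then have Gc: "drift \<nu> c (W c) (Z c) \<le> 0"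
    using h0 dc by (simp add: mult_le_0_iff)
  have "W c < W s"
  proof (rule DERIV_neg_imp_decreasing_open[where f = W])
    show "s < c" using a c by simp
    show "\<exists>y. DERIV W x :> y \<and> y < 0" if "s < x" "x < c" for x
      using logsysD(3)[OF L subsetD[OF sub], of x] neg[OF that] that c(2)
      by (intro exI[of _ "P x"]) (auto simp: P_def)
    show "continuous_on {s..c} W" using sub c by (intro logsys_continuous(1)[OF L]) auto
  qed
  then have WL: "0 < W c" "W c < W s" using dc by auto
  define z where "z x = (\<mu> * x) powr (1 / h)" for x
  have zs: "Z s = z (W s)" "Z c = z (W c)"
    unfolding z_def using slope_zero_flux[OF d(1,2)] slope_zero_flux[OF dc(1,2)] 0 c(3) by (auto simp: P_def)
  have zlt: "z (W c) < z (W s)"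
    unfolding z_def using WL \<mu>1 h_inv by (intro powr_less_mono2) auto
  have zp: "0 < z (W c)" using WL \<mu>1 by (simp add: z_def)
  have zh: "z x powr h = \<mu> * x" if "x > 0" for x
    using that h0 \<mu>1 by (simp add: z_def powr_powr)
  have quot: "drift \<nu> x w (z w) / z w = (\<mu> - real n) - (\<mu> * \<beta> - \<alpha>) * (z w powr (h - 1) / \<mu>) - \<nu> * exp (- \<kappa> * x) * z w powr (k - 1)"
    if "w > 0" for x w
  proof -
    have zw: "z w > 0" using that \<mu>1 by (simp add: z_def)
    have 1: "z w powr h = z w * z w powr (h - 1)" "z w powr k = z w * z w powr (k - 1)"
      using zw by (simp_all add: powr_diff)
    have 2: "w = z w powr h / \<mu>" using zh[OF that] \<mu>1 by simp
    have "drift \<nu> x w (z w) = (\<mu> - real n) * z w - (\<mu> * \<beta> - \<alpha>) * (z w powr h / \<mu>) - \<nu> * exp (- \<kappa> * x) * z w powr k"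
      unfolding drift_def using zh[OF that] \<mu>1 by (simp add: algebra_simps)
    then show ?thesis unfolding 1 using zw by (simp add: field_simps)
  qed
  have "drift \<nu> s (W s) (Z s) / Z s \<le> drift \<nu> c (W c) (Z c) / Z c"
    unfolding zs quot[OF d(1)] quot[OF dc(1)]
  proof (intro diff_mono order_refl)
    show "(\<mu> * \<beta> - \<alpha>) * (z (W c) powr (h - 1) / \<mu>) \<le> (\<mu> * \<beta> - \<alpha>) * (z (W s) powr (h - 1) / \<mu>)"
      using \<mu>\<beta> \<mu>1 zlt zp h1 by (intro mult_left_mono divide_right_mono powr_mono2) auto
    have "exp (- \<kappa> * c) \<le> exp (- \<kappa> * s)" using \<kappa>0 a c by simp
    then show "\<nu> * exp (- \<kappa> * c) * z (W c) powr (k - 1) \<le> \<nu> * exp (- \<kappa> * s) * z (W s) powr (k - 1)"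
      using \<nu> zlt zp k1 by (intro mult_mono mult_left_mono powr_mono2) auto
  qed
  moreover have "drift \<nu> s (W s) (Z s) / Z s > 0" using G d by simp
  moreover have "drift \<nu> c (W c) (Z c) / Z c \<le> 0" using Gc dc by (simp add: divide_le_0_iff)
  ultimately show False by linarith
qed

text \<open>\<open>b\<close> makes the slope positive near minus infinity. At its first zero
  \<open>logsys_first_zero\<close> applies, and \<open>logsys_after_zero\<close> excludes a second
  one: \<open>W\<close> has a single maximum, below \<open>wst\<close>.\<close>

lemma logsys_no_return:
  assumes L: "logsys \<nu> I W Z" and \<nu>: "\<nu> > 0" and b: "\<And>t. t < b \<Longrightarrow> slope W Z t > 0"
    and s1: "s1 \<in> I" "slope W Z s1 \<le> 0"
  obtains s0 where "s0 \<in> I" "W s0 < wst" "\<And>t. t < s0 \<Longrightarrow> slope W Z t > 0"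
     "\<And>t. t \<in> I \<Longrightarrow> t > s0 \<Longrightarrow> slope W Z t < 0"
proof -
  define a where "a = min (b - 1) (s1 - 1)"
  have a: "a < b" "a \<le> s1" by (auto simp: a_def)
  have sub: "{a..s1} \<subseteq> I" using logsys_down[OF L s1(1)] by auto
  have "continuous_on {a..s1} (\<lambda>t. - (slope W Z t))"
    by (intro continuous_on_minus logsys_continuous(3)[OF L sub])
  then obtain c where c: "a < c" "c \<le> s1" "- (slope W Z c) = 0"
     "\<And>t. a \<le> t \<Longrightarrow> t < c \<Longrightarrow> - (slope W Z t) < 0"
    using first_zero_from_neg[of a s1 "\<lambda>t. - (slope W Z t)"] a b[of a] s1(2) by auto
  have pos: "slope W Z t > 0" if "t < c" for t
    using c(4)[of t] b[of t] a that by (cases "a \<le> t") auto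
  have cI: "c \<in> I" using c sub by auto
  have c0: "slope W Z c = 0" using c(3) by linarith
  note fz = logsys_first_zero[OF L \<nu> cI c0 pos]
  show ?thesis
    using that[OF cI fz(2) pos] logsys_after_zero[OF L less_imp_le[OF \<nu>] cI c0 fz(1)] by blast
qed

text \<open>The single maximum bounds the whole orbit. This is what separates the two shooting
  alternatives.\<close>

lemma logsys_no_return_bound:
  assumes L: "logsys \<nu> I W Z" and \<nu>: "\<nu> > 0" and b: "\<And>t. t < b \<Longrightarrow> slope W Z t > 0"
    and s1: "s1 \<in> I" "slope W Z s1 \<le> 0" and s: "s \<in> I"
  shows "W s < wst"
proof -
  obtain s0 where s0: "s0 \<in> I" "W s0 < wst" "\<And>t. t < s0 \<Longrightarrow> slope W Z t > 0"
     "\<And>t. t \<in> I \<Longrightarrow> t > s0 \<Longrightarrow> slope W Z t < 0"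
    using logsys_no_return[OF L \<nu> b s1] by blast
  have dW: "DERIV W x :> slope W Z x" if "x \<in> I" for x
    by (rule logsysD(3)[OF L that])
  have "W s \<le> W s0"
  proof (cases "s \<le> s0")
    case True
    show ?thesis
    proof (rule DERIV_nonneg_imp_increasing_open[where f = W, OF True])
      show "\<exists>y. DERIV W x :> y \<and> 0 \<le> y" if "s < x" "x < s0" for x
        using dW[OF logsys_down[OF L s0(1)], of x] s0(3)[of x] that
        by (intro exI[of _ "slope W Z x"]) auto
      show "continuous_on {s..s0} W"
        using logsys_down[OF L s0(1)] by (intro logsys_continuous(1)[OF L]) auto
    qed
  next
    case False
    then have le: "s0 \<le> s" by simp
    show ?thesis
    proof (rule DERIV_nonpos_imp_decreasing_open[where f = W, OF le])
      show "\<exists>y. DERIV W x :> y \<and> y \<le> 0" if x: "s0 < x" "x < s" for x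
      proof -
        have xI: "x \<in> I" using logsys_down[OF L s] x by simp
        show ?thesis using dW[OF xI] s0(4)[OF xI] x
          by (intro exI[of _ "slope W Z x"]) auto
      qed
      show "continuous_on {s0..s} W"
        using logsys_down[OF L s] by (intro logsys_continuous(1)[OF L]) auto
    qed
  qed
  then show ?thesis using s0 by simp
qed

section \<open>Behaviour at infinity\<close>

definition autonomous_drift :: "real \<Rightarrow> real \<Rightarrow> real" where
  "autonomous_drift w z = (\<mu> - real n) * z + \<alpha> * w - \<beta> * z powr h"

lemma drift_le_autonomous: "\<nu> \<ge> 0 \<Longrightarrow> drift \<nu> s w z \<le> autonomous_drift w z"
  by (simp add: drift_def autonomous_drift_def)

lemma forcing_tendsto_0: "((\<lambda>s. \<nu> * exp (- \<kappa> * s) * c) \<longlongrightarrow> 0) at_top"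
proof -
  have "filterlim (\<lambda>s. - \<kappa> * s) at_bot at_top"
    using \<kappa>0 by (intro filterlim_tendsto_neg_mult_at_bot[OF tendsto_const _ filterlim_ident]) auto
  then have "((\<lambda>s. exp (- \<kappa> * s)) \<longlongrightarrow> 0) at_top"
    by (rule filterlim_compose[OF exp_at_bot])
  from tendsto_mult[OF tendsto_mult[OF tendsto_const[of \<nu>] this] tendsto_const[of c]]
  show ?thesis by simp
qed

lemma log_flux_derivative:
  assumes "logsys \<nu> UNIV W Z"
  shows "DERIV (\<lambda>s. ln (Z s)) s :> drift \<nu> s (W s) (Z s) / Z s"
  using DERIV_chain2[OF DERIV_ln_divide logsysD(4)[OF assms UNIV_I]] logsysD(2)[OF assms UNIV_I] by simp

lemma drift_quotient:
  assumes "z > 0"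
  shows "drift \<nu> s w z / z = (\<mu> - real n) + \<alpha> * w / z - \<beta> * z powr (h - 1) - \<nu> * exp (- \<kappa> * s) * z powr (k - 1)"
proof -
  have "z powr h = z * z powr (h - 1)" "z powr k = z * z powr (k - 1)"
    using assms by (simp_all add: powr_diff)
  then show ?thesis unfolding drift_def using assms by (simp add: field_simps)
qed

text \<open>The only term of the quotient with a positive \<open>z\<close>-dependence is
  \<open>\<alpha> * w / z\<close>, which decreases; the others carry minus signs in front of
  increasing powers. Barriers are therefore formulated for \<open>ln Z\<close>.\<close>

lemma drift_quotient_antimono:
  assumes "0 < y" "y \<le> z" "w \<ge> 0" "\<nu> \<ge> 0"
  shows "drift \<nu> s w z / z \<le> drift \<nu> s w y / y"
proof -
  have z: "z > 0" using assms by simp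
  show ?thesis
    unfolding drift_quotient[OF z] drift_quotient[OF assms(1)]
    using assms \<alpha>0 \<beta>0 h1 k1
    by (intro diff_mono add_left_mono mult_left_mono divide_left_mono powr_mono2) auto
qed

text \<open>For large \<open>s\<close> the absorption is negligible and the drift at level
  \<open>z\<close> exceeds half its limiting value; below that level the rate of \<open>ln Z\<close>
  is at least as large, so \<open>eventually_ge_barrier\<close> applies.\<close>

lemma eventually_flux_ge:
  assumes L: "logsys \<nu> UNIV W Z" and \<nu>: "\<nu> \<ge> 0" and lim: "(W \<longlongrightarrow> l) at_top"
    and z: "z > 0" and pos: "autonomous_drift l z > 0"
  shows "eventually (\<lambda>s. Z s \<ge> z) at_top"
proof -
  define e where "e = autonomous_drift l z"
  have "((\<lambda>s. (\<mu> - real n) * z + \<alpha> * W s - \<beta> * z powr h - \<nu> * exp (- \<kappa> * s) * z powr k) \<longlongrightarrow>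
      (\<mu> - real n) * z + \<alpha> * l - \<beta> * z powr h - 0) at_top"
    by (intro tendsto_intros lim forcing_tendsto_0)
  then have "((\<lambda>s. drift \<nu> s (W s) z) \<longlongrightarrow> e) at_top"
    by (simp add: drift_def e_def autonomous_drift_def)
  moreover have "e / 2 < e" using pos by (simp add: e_def)
  ultimately have "eventually (\<lambda>s. drift \<nu> s (W s) z > e / 2) at_top"
    by (rule order_tendstoD(1))
  then obtain s1 where s1: "\<And>s. s \<ge> s1 \<Longrightarrow> drift \<nu> s (W s) z > e / 2"
    by (auto simp: eventually_at_top_linorder)
  have "\<exists>s2\<ge>s1. \<forall>s\<ge>s2. ln (Z s) \<ge> ln z"
  proof (rule eventually_ge_barrier[OF log_flux_derivative[OF L]])
    show "e / 2 / z > 0" using pos z by (simp add: e_def)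
    fix s assume s: "s \<ge> s1" "ln (Z s) \<le> ln z"
    note d = logsysD[OF L UNIV_I, of s]
    have "Z s \<le> z" using s(2) d z by simp
    have "e / 2 / z \<le> drift \<nu> s (W s) z / z"
      using s1[OF s(1)] z by (intro divide_right_mono) auto
    also have "\<dots> \<le> drift \<nu> s (W s) (Z s) / Z s"
      using d \<nu> \<open>Z s \<le> z\<close> by (intro drift_quotient_antimono) auto
    finally show "e / 2 / z \<le> drift \<nu> s (W s) (Z s) / Z s" .
  qed
  then obtain s2 where "\<And>s. s \<ge> s2 \<Longrightarrow> ln (Z s) \<ge> ln z" by auto
  then show ?thesis
    unfolding eventually_at_top_linorder using logsysD(2)[OF L UNIV_I] z
    by (metis ln_le_cancel_iff)
qed

lemma eventually_flux_le:
  assumes L: "logsys \<nu> UNIV W Z" and \<nu>: "\<nu> \<ge> 0" and lim: "(W \<longlongrightarrow> l) at_top"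
    and z: "z > 0" and neg: "autonomous_drift l z < 0"
  shows "eventually (\<lambda>s. Z s \<le> z) at_top"
proof -
  define e where "e = - autonomous_drift l z"
  have "((\<lambda>s. (\<mu> - real n) * z + \<alpha> * W s - \<beta> * z powr h) \<longlongrightarrow>
      (\<mu> - real n) * z + \<alpha> * l - \<beta> * z powr h) at_top"
    by (intro tendsto_intros lim)
  then have "((\<lambda>s. autonomous_drift (W s) z) \<longlongrightarrow> - e) at_top"
    by (simp add: e_def autonomous_drift_def)
  moreover have "- e < - e / 2" using neg by (simp add: e_def)
  ultimately have "eventually (\<lambda>s. autonomous_drift (W s) z < - e / 2) at_top"
    by (rule order_tendstoD(2))
  then obtain s1 where s1: "\<And>s. s \<ge> s1 \<Longrightarrow> autonomous_drift (W s) z < - e / 2"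
    by (auto simp: eventually_at_top_linorder)
  have "\<exists>s2\<ge>s1. \<forall>s\<ge>s2. ln (Z s) \<le> ln z"
  proof (rule eventually_le_barrier[OF log_flux_derivative[OF L]])
    show "e / 2 / z > 0" using neg z unfolding e_def by (intro divide_pos_pos) auto
    fix s assume s: "s \<ge> s1" "ln (Z s) \<ge> ln z"
    note d = logsysD[OF L UNIV_I, of s]
    have "Z s \<ge> z" using s(2) d z by simp
    then have "drift \<nu> s (W s) (Z s) / Z s \<le> drift \<nu> s (W s) z / z"
      using d \<nu> z by (intro drift_quotient_antimono) auto
    also have "\<dots> \<le> - e / 2 / z"
      using s1[OF s(1)] z drift_le_autonomous[OF \<nu>, of s "W s" z] by (intro divide_right_mono) auto
    finally show "drift \<nu> s (W s) (Z s) / Z s \<le> - (e / 2 / z)" by simp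
  qed
  then obtain s2 where "\<And>s. s \<ge> s2 \<Longrightarrow> ln (Z s) \<le> ln z" by auto
  then show ?thesis
    unfolding eventually_at_top_linorder using logsysD(2)[OF L UNIV_I] z
    by (metis ln_le_cancel_iff)
qed

lemma autonomous_drift_at_balance:
  assumes "w > 0"
  shows "autonomous_drift w ((\<mu> * w) powr (1 / h)) = (\<mu> - real n) * (\<mu> * w) powr (1 / h) - (\<mu> * \<beta> - \<alpha>) * w"
  using assms \<mu>1 h0 by (simp add: autonomous_drift_def powr_powr algebra_simps)

lemma autonomous_drift_continuous: "z > 0 \<Longrightarrow> isCont (autonomous_drift w) z"
  unfolding autonomous_drift_def by (intro continuous_intros) auto

text \<open>At \<open>z = (\<mu> * l) powr (1 / h)\<close> the drift is positive by
  \<open>balance_sign\<close>, and by continuity it stays positive for slightly larger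
  \<open>z\<close>.\<close>

lemma choose_flux_above:
  assumes l: "0 \<le> l" "l < wst"
  obtains z where "z > 0" "z powr h > \<mu> * l" "autonomous_drift l z > 0"
proof (cases "l = 0")
  case True
  \<comment> \<open>For \<open>l = 0\<close> the drift \<open>(\<mu> - n) z - \<beta> z^h\<close>
    changes sign at \<open>z^(h-1) = (\<mu> - n) / \<beta>\<close>; half of that value is
    taken.\<close>
  define z where "z = ((\<mu> - real n) / (2 * \<beta>)) powr (1 / (h - 1))"
  have z: "z > 0" using \<mu>n \<beta>0 by (simp add: z_def)
  have "z powr (h - 1) = (\<mu> - real n) / (2 * \<beta>)"
    using h1 \<mu>n \<beta>0 by (simp add: z_def powr_powr)
  then have "z powr h = z * ((\<mu> - real n) / (2 * \<beta>))"
    using z by (simp add: powr_diff field_simps)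
  then have "autonomous_drift 0 z > 0"
    using z \<mu>n \<beta>0 by (simp add: autonomous_drift_def)
  then show ?thesis using that[of z] z True by simp
next
  case False
  then have l0: "l > 0" using l by simp
  define z where "z = (\<mu> * l) powr (1 / h)"
  have z: "z > 0" "z powr h = \<mu> * l" using l0 \<mu>1 h0 by (auto simp: z_def powr_powr)
  have "autonomous_drift l z > 0"
    unfolding z_def autonomous_drift_at_balance[OF l0] using balance_sign(1)[OF l0] l by simp
  then have "eventually (\<lambda>x. autonomous_drift l x > 0) (at z)"
    using autonomous_drift_continuous[OF z(1)] by (auto simp: isCont_def intro: order_tendstoD(1))
  then have "eventually (\<lambda>x. autonomous_drift l x > 0) (at_right z)"
    by (rule filter_leD[OF at_le, rotated]) simp
  moreover have "eventually (\<lambda>x. x > z) (at_right z)" by (simp add: eventually_at_right_less)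
  ultimately have "eventually (\<lambda>x. autonomous_drift l x > 0 \<and> x > z) (at_right z)"
    by (rule eventually_conj)
  then obtain x where x: "autonomous_drift l x > 0" "x > z"
    using eventually_happens'[OF trivial_limit_at_right_real] by blast
  then have "x powr h > \<mu> * l" using powr_less_mono2[OF h0, of z x] z by simp
  then show ?thesis using that[of x] x z by simp
qed

lemma choose_flux_below:
  assumes l: "l > wst"
  obtains z where "z > 0" "z powr h < \<mu> * l" "autonomous_drift l z < 0"
proof -
  have l0: "l > 0" using l wst_pos by simp
  define z where "z = (\<mu> * l) powr (1 / h)"
  have z: "z > 0" "z powr h = \<mu> * l" using l0 \<mu>1 h0 by (auto simp: z_def powr_powr)
  have "autonomous_drift l z < 0"
    unfolding z_def autonomous_drift_at_balance[OF l0] using balance_sign(2)[OF l0] l by simp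
  then have "eventually (\<lambda>x. autonomous_drift l x < 0) (at z)"
    using autonomous_drift_continuous[OF z(1)] by (auto simp: isCont_def intro: order_tendstoD(2))
  then have "eventually (\<lambda>x. autonomous_drift l x < 0) (at_left z)"
    by (rule filter_leD[OF at_le, rotated]) simp
  moreover have "eventually (\<lambda>x. x \<in> {0<..<z}) (at_left z)"
    by (rule eventually_at_left_real) (rule z)
  ultimately have "eventually (\<lambda>x. autonomous_drift l x < 0 \<and> x \<in> {0<..<z}) (at_left z)"
    by (rule eventually_conj)
  then obtain x where x: "autonomous_drift l x < 0" "0 < x" "x < z"
    using eventually_happens'[OF trivial_limit_at_left_real] by fastforce
  then have "x powr h < \<mu> * l" using powr_less_mono2[OF h0, of x z] z by simp
  then show ?thesis using that[of x] x by simp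
qed

text \<open>Eventually \<open>Z \<ge> z\<close> with \<open>z^h > \<mu> * l\<close>, so the slope
  stays below a negative constant and \<open>W\<close> would become negative. The case
  \<open>l = 0\<close> is included.\<close>

lemma logsys_limit_not_below:
  assumes L: "logsys \<nu> UNIV W Z" and \<nu>: "\<nu> \<ge> 0" and lim: "(W \<longlongrightarrow> l) at_top" and l: "0 \<le> l" "l < wst"
  shows False
proof -
  obtain z where z: "z > 0" "z powr h > \<mu> * l" "autonomous_drift l z > 0"
    using choose_flux_above[OF l] .
  define e where "e = z powr h - \<mu> * l"
  have e: "e > 0" using z by (simp add: e_def)
  have "((\<lambda>s. \<mu> * W s) \<longlongrightarrow> \<mu> * l) at_top" by (intro tendsto_intros lim)
  then have "eventually (\<lambda>s. \<mu> * W s < \<mu> * l + e / 2) at_top"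
    using e by (intro order_tendstoD(2)) auto
  with eventually_flux_ge[OF L \<nu> lim z(1,3)]
  have "eventually (\<lambda>s. slope W Z s \<le> - (e / 2)) at_top"
  proof eventually_elim
    case (elim s)
    have "z powr h \<le> Z s powr h" using elim z h0 by (intro powr_mono2) auto
    then show ?case using elim by (simp add: e_def field_simps)
  qed
  then obtain s1 where s1: "\<And>s. s \<ge> s1 \<Longrightarrow> slope W Z s \<le> - (e / 2)"
    by (auto simp: eventually_at_top_linorder)
  have "\<exists>s\<ge>s1. W s < 0"
    by (rule deriv_unbounded_below[OF logsysD(3)[OF L UNIV_I] _ s1]) (use e in auto)
  then show False using logsysD(1)[OF L UNIV_I] by (meson less_asym)
qed

lemma logsys_limit_not_above:
  assumes L: "logsys \<nu> UNIV W Z" and \<nu>: "\<nu> \<ge> 0" and lim: "(W \<longlongrightarrow> l) at_top" and l: "l > wst"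
  shows False
proof -
  obtain z where z: "z > 0" "z powr h < \<mu> * l" "autonomous_drift l z < 0"
    using choose_flux_below[OF l] .
  define e where "e = \<mu> * l - z powr h"
  have e: "e > 0" using z by (simp add: e_def)
  have "((\<lambda>s. \<mu> * W s) \<longlongrightarrow> \<mu> * l) at_top" by (intro tendsto_intros lim)
  then have "eventually (\<lambda>s. \<mu> * W s > \<mu> * l - e / 2) at_top"
    using e by (intro order_tendstoD(1)) auto
  with eventually_flux_le[OF L \<nu> lim z(1,3)]
  have "eventually (\<lambda>s. slope W Z s \<ge> e / 2) at_top"
  proof eventually_elim
    case (elim s)
    have "Z s powr h \<le> z powr h" using elim z h0 logsysD(2)[OF L UNIV_I, of s] by (intro powr_mono2) auto
    then show ?case using elim by (simp add: e_def field_simps)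
  qed
  then obtain s1 where s1: "\<And>s. s \<ge> s1 \<Longrightarrow> slope W Z s \<ge> e / 2"
    by (auto simp: eventually_at_top_linorder)
  have "eventually (\<lambda>s. W s < l + 1) at_top" by (rule order_tendstoD(2)[OF lim]) simp
  then obtain s2 where s2: "\<And>s. s \<ge> s2 \<Longrightarrow> W s < l + 1" by (auto simp: eventually_at_top_linorder)
  have "\<exists>s\<ge>max s1 s2. W s > l + 1"
    by (rule deriv_unbounded_above[OF logsysD(3)[OF L UNIV_I], where \<delta> = "e / 2"]) (use s1 e in auto)
  then show False using s2 by (meson less_asym max.boundedE)
qed

text \<open>At the equilibrium \<open>Z^h = \<mu> W\<close>, and
  \<open>\<alpha> < \<mu> * \<beta>\<close> leaves a margin. A lower barrier for \<open>Z^h\<close>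
  strictly between \<open>\<alpha> / \<beta> * wst\<close> and \<open>\<mu> * wst\<close>
  suffices.\<close>

lemma logsys_eventually_decreasing_profile:
  assumes L: "logsys \<nu> UNIV W Z" and \<nu>: "\<nu> \<ge> 0" and lim: "(W \<longlongrightarrow> wst) at_top"
  shows "eventually (\<lambda>s. \<alpha> * W s < \<beta> * Z s powr h) at_top"
proof -
  \<comment> \<open>The midpoint between \<open>\<alpha> / (\<mu> * \<beta>)\<close> and 1.\<close>
  define c where "c = (\<alpha> / (\<mu> * \<beta>) + 1) / 2"
  have c: "\<alpha> / (\<mu> * \<beta>) < c" "c < 1" "c > 0"
  proof -
    have "\<alpha> / (\<mu> * \<beta>) < 1" "\<alpha> / (\<mu> * \<beta>) > 0" using \<mu>\<beta> \<alpha>0 \<beta>0 \<mu>1 by auto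
    then show "\<alpha> / (\<mu> * \<beta>) < c" and "c < 1" and "c > 0" unfolding c_def by argo+
  qed
  define \<omega> where "\<omega> = c * wst"
  have \<omega>: "\<omega> > 0" "\<omega> < wst" using c wst_pos by (auto simp: \<omega>_def)
  have cw: "\<alpha> * wst < \<beta> * (\<mu> * \<omega>)"
    using c(1) \<mu>1 \<beta>0 wst_pos mult_strict_right_mono[OF c(1), of "\<mu> * \<beta> * wst"]
    by (simp add: \<omega>_def mult_ac)
  define z where "z = (\<mu> * \<omega>) powr (1 / h)"
  have z: "z > 0" "z powr h = \<mu> * \<omega>" using \<omega> \<mu>1 h0 by (auto simp: z_def powr_powr)
  have "autonomous_drift \<omega> z > 0"
    unfolding z_def autonomous_drift_at_balance[OF \<omega>(1)] using balance_sign(1)[OF \<omega>(1)] \<omega> by simp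
  moreover have "\<alpha> * \<omega> < \<alpha> * wst" using \<omega> \<alpha>0 by simp
  ultimately have "autonomous_drift wst z > 0" by (simp add: autonomous_drift_def)
  from eventually_flux_ge[OF L \<nu> lim z(1) this]
  have 1: "eventually (\<lambda>s. Z s \<ge> z) at_top" .
  have "((\<lambda>s. \<alpha> * W s) \<longlongrightarrow> \<alpha> * wst) at_top" by (intro tendsto_intros lim)
  then have "eventually (\<lambda>s. \<alpha> * W s < \<beta> * (\<mu> * \<omega>)) at_top"
    using cw by (rule order_tendstoD(2))
  with 1 show ?thesis
  proof eventually_elim
    case (elim s)
    have "\<mu> * \<omega> \<le> Z s powr h" unfolding z(2)[symmetric] using elim z h0 by (intro powr_mono2) auto
    then have "\<beta> * (\<mu> * \<omega>) \<le> \<beta> * Z s powr h" using \<beta>0 by simp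
    then show ?case using elim by simp
  qed
qed

text \<open>
  In \<open>X = \<beta> W - Z\<close> the terms \<open>\<beta> Z^h\<close> cancel, leaving \<open>X' \<ge> \<theta> X - C X^(1/h)\<close>, a linear inequality for \<open>X^(1-1/h)\<close>.
\<close>

lemma logsys_slow_decay:
  assumes L: "logsys \<nu> UNIV W Z" and \<nu>: "\<nu> \<ge> 0" and lim: "filterlim W at_top at_top"
    and P: "\<And>s. s \<ge> s0 \<Longrightarrow> slope W Z s \<ge> 0"
  shows "\<exists>c>0. eventually (\<lambda>s. exp (- (\<mu> - \<alpha> / \<beta>) * s) * W s \<ge> c) at_top"
proof -
  \<comment> \<open>With this rate, \<open>exp (- \<theta> * s) * W s\<close> is
    \<open>r^(\<alpha>/\<beta>) f\<close>, the quantity in the fast decay condition.\<close>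
  define \<theta> where "\<theta> = \<mu> - \<alpha> / \<beta>"
  have \<theta>: "\<theta> > 0" using \<mu>\<beta> \<beta>0 by (simp add: \<theta>_def field_simps)
  have \<theta>\<beta>: "\<mu> * \<beta> - \<alpha> = \<beta> * \<theta>" using \<beta>0 by (simp add: \<theta>_def field_simps)
  define m where "m = 1 - 1 / h"
  have m: "m > 0" using h_inv by (simp add: m_def)
  define X where "X s = \<beta> * W s - Z s" for s
  let ?X' = "\<lambda>s. \<beta> * (slope W Z s) - drift \<nu> s (W s) (Z s)"
  define C where "C = (\<mu> - real n) * (2 * \<mu> / \<beta>) powr (1 / h)"
  have C: "C > 0" using \<mu>n \<mu>1 \<beta>0 by (simp add: C_def)
  have Zle: "Z s \<le> (\<mu> * W s) powr (1 / h)" if "s \<ge> s0" for s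
  proof -
    note d = logsysD[OF L UNIV_I, of s]
    have "(Z s powr h) powr (1 / h) \<le> (\<mu> * W s) powr (1 / h)"
      using P[OF that] h0 by (intro powr_mono2) auto
    then show ?thesis using d h0 by (simp add: powr_powr)
  qed
  \<comment> \<open>From \<open>W \<ge> K\<close> on, the bound
    \<open>(\<mu> * W) powr (1 / h)\<close> for \<open>Z\<close> is at most
    \<open>\<beta> / 2 * W\<close>, so \<open>X\<close> is comparable to \<open>W\<close>.\<close>
  define K where "K = (2 * \<mu> powr (1 / h) / \<beta>) powr (1 / m)"
  have Xge: "X s \<ge> \<beta> / 2 * W s" if "s \<ge> s0" "W s \<ge> K" for s
  proof -
    note d = logsysD[OF L UNIV_I, of s]
    have K0: "K > 0" using \<mu>1 \<beta>0 by (simp add: K_def)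
    have "K powr m \<le> W s powr m" using that K0 m by (intro powr_mono2) auto
    then have "2 * \<mu> powr (1 / h) / \<beta> \<le> W s powr m"
      using m \<mu>1 \<beta>0 by (simp add: K_def powr_powr)
    then have "\<mu> powr (1 / h) \<le> \<beta> / 2 * W s powr m" using \<beta>0 by (simp add: field_simps)
    then have "\<mu> powr (1 / h) * W s powr (1 / h) \<le> (\<beta> / 2 * W s powr m) * W s powr (1 / h)"
      by (intro mult_right_mono) auto
    also have "\<dots> = \<beta> / 2 * W s" using d by (simp add: m_def mult.assoc flip: powr_add)
    finally have "Z s \<le> \<beta> / 2 * W s" using Zle[OF that(1)] d \<mu>1 by (simp add: powr_mult)
    then show ?thesis by (simp add: X_def)
  qed
  \<comment> \<open>The last condition makes \<open>u s1 \<ge> 1 + C / \<theta>\<close>, so that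
    \<open>g\<close> starts above a positive number.\<close>
  obtain s1 where s1: "s1 \<ge> s0" "\<And>s. s \<ge> s1 \<Longrightarrow> W s \<ge> K"
      "W s1 \<ge> 2 / \<beta> * (1 + C / \<theta>) powr (1 / m)"
  proof -
    have "eventually (\<lambda>s. W s \<ge> max K (2 / \<beta> * (1 + C / \<theta>) powr (1 / m))) at_top"
      using lim unfolding filterlim_at_top by blast
    then obtain s2 where s2: "\<And>s. s \<ge> s2 \<Longrightarrow> W s \<ge> max K (2 / \<beta> * (1 + C / \<theta>) powr (1 / m))"
      by (auto simp: eventually_at_top_linorder)
    show ?thesis
      by (rule that[of "max s0 s2"]) (use s2 in auto)
  qed
  have X0: "X s > 0" if "s \<ge> s1" for s
    using Xge[of s] s1 that logsysD(1)[OF L UNIV_I, of s] \<beta>0 by (smt (verit) half_gt_zero mult_pos_pos)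
  define u where "u s = X s powr m" for s
  have dX: "DERIV X s :> ?X' s" for s
    unfolding X_def
    by (rule derivative_eq_intros logsysD[OF L UNIV_I] refl)+ simp
  have X'ge: "?X' s \<ge> \<theta> * X s - C * X s powr (1 / h)"
    if s: "s \<ge> s1" for s
  proof -
    note d = logsysD[OF L UNIV_I, of s]
    have "?X' s =
        (\<mu> * \<beta> - \<alpha>) * W s - (\<mu> - real n) * Z s + \<nu> * exp (- \<kappa> * s) * Z s powr k"
      by (simp add: drift_def algebra_simps)
    also have "\<dots> = \<theta> * X s + \<theta> * Z s - (\<mu> - real n) * Z s + \<nu> * exp (- \<kappa> * s) * Z s powr k"
      unfolding \<theta>\<beta> by (simp add: X_def algebra_simps)
    finally have e: "?X' s = \<dots>" .
    have "Z s \<le> (\<mu> * W s) powr (1 / h)" using Zle s s1 by simp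
    also have "\<dots> \<le> (2 * \<mu> / \<beta> * X s) powr (1 / h)"
    proof (rule powr_mono2)
      have "\<mu> * W s = 2 * \<mu> / \<beta> * (\<beta> / 2 * W s)" using \<beta>0 by simp
      also have "\<dots> \<le> 2 * \<mu> / \<beta> * X s"
        using Xge[of s] s s1 \<mu>1 \<beta>0 by (intro mult_left_mono) auto
      finally show "\<mu> * W s \<le> 2 * \<mu> / \<beta> * X s" .
    qed (use h_inv d \<mu>1 in auto)
    also have "\<dots> = (2 * \<mu> / \<beta>) powr (1 / h) * X s powr (1 / h)"
      by (rule powr_mult)
    finally have "(\<mu> - real n) * Z s \<le> C * X s powr (1 / h)"
      using \<mu>n by (simp add: C_def mult.assoc mult_left_mono)
    moreover have "\<theta> * Z s \<ge> 0" "\<nu> * exp (- \<kappa> * s) * Z s powr k \<ge> 0" using \<theta> d \<nu> by auto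
    ultimately show ?thesis unfolding e by linarith
  qed
  \<comment> \<open>For \<open>u = X^m\<close> the inequality for \<open>X\<close> becomes
    \<open>u' \<ge> m \<theta> (u - C / \<theta>)\<close>, so \<open>g\<close> is
    nondecreasing.\<close>
  define g where "g s = exp (- (m * \<theta>) * s) * (u s - C / \<theta>)" for s
  have du: "DERIV u s :> m * X s powr (m - 1) * (?X' s)"
    if "s \<ge> s1" for s
    unfolding u_def using DERIV_chain2[OF has_real_derivative_powr dX] X0[OF that] by simp
  have g_mono: "g s1 \<le> g s" if s: "s \<ge> s1" for s
  proof (rule DERIV_nonneg_imp_nondecreasing[OF s])
    fix x assume x: "s1 \<le> x" "x \<le> s"
    define u' where "u' = m * X x powr (m - 1) * (?X' x)"
    have "m * X x powr (m - 1) * (\<theta> * X x - C * X x powr (1 / h)) \<le> u'"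
      unfolding u'_def using X'ge[OF x(1)] m by (intro mult_left_mono) auto
    moreover have "m * X x powr (m - 1) * (\<theta> * X x - C * X x powr (1 / h)) = m * (\<theta> * u x - C)"
    proof -
      have "X x powr (m - 1) * X x = u x" using X0[OF x(1)] by (simp add: u_def powr_diff)
      moreover have "X x powr (m - 1) * X x powr (1 / h) = 1"
        using X0[OF x(1)] by (simp add: m_def flip: powr_add)
      ultimately show ?thesis by (simp add: right_diff_distrib mult.assoc mult.left_commute)
    qed
    ultimately have "m * (\<theta> * u x - C) \<le> u'" by linarith
    moreover have "m * \<theta> * (u x - C / \<theta>) = m * (\<theta> * u x - C)" using \<theta> by (simp add: field_simps)
    ultimately have "u' - m * \<theta> * (u x - C / \<theta>) \<ge> 0" by linarith
    then have "exp (- (m * \<theta>) * x) * (u' - m * \<theta> * (u x - C / \<theta>)) \<ge> 0" by simp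
    moreover have "DERIV g x :> exp (- (m * \<theta>) * x) * (u' - m * \<theta> * (u x - C / \<theta>))"
      unfolding g_def
      by (rule derivative_eq_intros du[OF x(1)] refl)+ (simp add: u'_def algebra_simps)
    ultimately show "\<exists>y. DERIV g x :> y \<and> 0 \<le> y" by blast
  qed
  have u1: "u s1 \<ge> 1 + C / \<theta>"
  proof -
    have "(1 + C / \<theta>) powr (1 / m) = \<beta> / 2 * (2 / \<beta> * (1 + C / \<theta>) powr (1 / m))" using \<beta>0 by simp
    also have "\<dots> \<le> \<beta> / 2 * W s1" using s1(3) \<beta>0 by (intro mult_left_mono) auto
    also have "\<dots> \<le> X s1" using Xge[of s1] s1 by simp
    finally have "((1 + C / \<theta>) powr (1 / m)) powr m \<le> u s1"
      unfolding u_def using m by (intro powr_mono2) auto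
    moreover have "1 + C / \<theta> > 0" using C \<theta> by (simp add: add_pos_pos)
    ultimately show ?thesis using m by (simp add: powr_powr)
  qed
  define c where "c = exp (- \<theta> * s1) / \<beta>"
  have "exp (- \<theta> * s) * W s \<ge> c" if s: "s \<ge> s1" for s
  proof -
    have "exp (- (m * \<theta>) * s1) \<le> g s1" using u1 by (simp add: g_def)
    also have "\<dots> \<le> g s" by (rule g_mono[OF s])
    also have "\<dots> \<le> exp (- (m * \<theta>) * s) * u s" using C \<theta> by (simp add: g_def)
    also have "\<dots> = (exp (- \<theta> * s) * X s) powr m"
      using X0[OF s] by (simp add: u_def powr_mult exp_powr_real mult_ac)
    finally have "exp (- (m * \<theta>) * s1) powr (1 / m) \<le> ((exp (- \<theta> * s) * X s) powr m) powr (1 / m)"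
      using m by (intro powr_mono2) auto
    then have "exp (- \<theta> * s1) \<le> exp (- \<theta> * s) * X s"
      using m X0[OF s] by (simp add: powr_powr exp_powr_real)
    also have "\<dots> \<le> exp (- \<theta> * s) * (\<beta> * W s)"
      using logsysD(2)[OF L UNIV_I, of s] by (simp add: X_def)
    finally show ?thesis using \<beta>0 by (simp add: c_def field_simps)
  qed
  moreover have "c > 0" using \<beta>0 by (simp add: c_def)
  ultimately show ?thesis
    unfolding \<theta>_def[symmetric] eventually_at_top_linorder by blast
qed

section \<open>Uniqueness by sliding\<close>

text \<open>The only non-autonomous term is exponential in \<open>s\<close>, so a translation is
  absorbed into the coefficient.\<close>

lemma logsys_translate:
  assumes L: "logsys \<nu> UNIV W Z"
  shows "logsys (\<nu> * exp (- \<kappa> * \<tau>)) UNIV (\<lambda>s. W (s + \<tau>)) (\<lambda>s. Z (s + \<tau>))"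
proof -
  have "exp (- \<kappa> * (s + \<tau>)) = exp (- \<kappa> * \<tau>) * exp (- \<kappa> * s)" for s
    by (subst exp_add[symmetric]) (simp add: algebra_simps)
  then have "drift (\<nu> * exp (- \<kappa> * \<tau>)) s w z = drift \<nu> (s + \<tau>) w z" for s w z
    by (simp add: drift_def)
  then show ?thesis
    unfolding logsys_def
    using logsysD(1,2)[OF L UNIV_I] logsysD(3,4)[OF L UNIV_I, THEN DERIV_shift[THEN iffD1]]
    by simp
qed

text \<open>\<open>K * W1 - W2\<close> has a local minimum 0 at \<open>c\<close>. The first
  derivative gives \<open>Z2 = j * Z1\<close> with \<open>j = K powr (1 / h)\<close>, the second
  \<open>D2 \<ge> j * D1\<close>. But \<open>D2 - j * D1\<close> is
  \<open>(K - j) (\<alpha> W1 - \<beta> Z1^h)\<close>, which is nonpositive by assumption, minus a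
  positive absorption difference.\<close>

lemma logsys_no_touching:
  assumes L1: "logsys \<nu>1 UNIV W1 Z1" and L2: "logsys \<nu>2 UNIV W2 Z2" and \<nu>: "0 \<le> \<nu>1" "\<nu>1 < \<nu>2"
    and K: "K \<ge> 1" "K = 1 \<or> \<alpha> * W1 c \<le> \<beta> * Z1 c powr h"
    and \<delta>: "\<delta> > 0" and le: "\<And>s. \<bar>s - c\<bar> < \<delta> \<Longrightarrow> W2 s \<le> K * W1 s" and eq: "W2 c = K * W1 c"
  shows False
proof -
  note d1 = logsysD[OF L1 UNIV_I] and d2 = logsysD[OF L2 UNIV_I]
  define P1 where "P1 s = slope W1 Z1 s" for s
  define P2 where "P2 s = slope W2 Z2 s" for s
  define D1 where "D1 = drift \<nu>1 c (W1 c) (Z1 c)"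
  define D2 where "D2 = drift \<nu>2 c (W2 c) (Z2 c)"
  define x where "x s = K * W1 s - W2 s" for s
  define g where "g s = K * P1 s - P2 s" for s
  define l where "l = K * (\<mu> * P1 c - h * Z1 c powr (h - 1) * D1) - (\<mu> * P2 c - h * Z2 c powr (h - 1) * D2)"
  have dx: "DERIV x s :> g s" for s
    unfolding x_def g_def P1_def P2_def by (rule derivative_eq_intros d1 d2 refl)+ simp
  have dg: "DERIV g c :> l"
    unfolding g_def l_def P1_def P2_def D1_def D2_def
    by (rule DERIV_diff[OF DERIV_cmult[OF logsys_slope_derivative[OF L1 UNIV_I]]
          logsys_slope_derivative[OF L2 UNIV_I]])
  have g0: "g c = 0" and l0: "l \<ge> 0"
    using touching_second_derivative[OF \<delta> dx _ _ dg] le eq by (auto simp: x_def)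
  define j where "j = K powr (1 / h)"
  have j: "j \<ge> 1" "j \<le> K" "j powr h = K" "j powr k \<ge> j"
  proof -
    show j1: "j \<ge> 1" using K h_inv by (simp add: j_def ge_one_powr_ge_zero)
    have "K powr (1 / h) \<le> K powr 1" using K h_inv by (intro powr_mono) auto
    then show "j \<le> K" using K by (simp add: j_def)
    show "j powr h = K" using K h0 by (simp add: j_def powr_powr)
    have "j powr 1 \<le> j powr k" using j1 k1 by (intro powr_mono) auto
    then show "j powr k \<ge> j" using j1 by simp
  qed
  have "Z2 c powr h = K * Z1 c powr h"
    using g0 by (simp add: g_def P1_def P2_def eq right_diff_distrib mult.left_commute)
  also have "\<dots> = (j * Z1 c) powr h" using j by (simp add: powr_mult)
  finally have Z2: "Z2 c = j * Z1 c"
    using powr_inj[of h "Z2 c" "j * Z1 c"] d1(2)[of c] d2(2)[of c] j h0 powr_less_mono2[of h "Z2 c" "j * Z1 c"]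
      powr_less_mono2[of h "j * Z1 c" "Z2 c"]
    by (cases "Z2 c" "j * Z1 c" rule: linorder_cases) auto
  have "l = \<mu> * g c + h * (Z2 c powr (h - 1) * D2 - K * Z1 c powr (h - 1) * D1)"
    by (simp add: l_def g_def algebra_simps)
  then have "Z2 c powr (h - 1) * D2 - K * Z1 c powr (h - 1) * D1 \<ge> 0"
    using g0 l0 h0 by (simp add: zero_le_mult_iff)
  moreover have "Z2 c powr (h - 1) = (K / j) * Z1 c powr (h - 1)"
    unfolding Z2 powr_mult using j by (simp add: powr_diff)
  ultimately have "0 \<le> (K / j) * Z1 c powr (h - 1) * (D2 - j * D1)"
    using j by (simp add: field_simps)
  moreover have "(K / j) * Z1 c powr (h - 1) > 0" using j K d1(2)[of c] by simp
  ultimately have ge: "D2 - j * D1 \<ge> 0" using zero_le_mult_iff less_le_not_le by blast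
  define E where "E = exp (- \<kappa> * c) * Z1 c powr k"
  have E: "E > 0" using d1(2)[of c] by (simp add: E_def)
  have z2h: "Z2 c powr h = K * Z1 c powr h" "Z2 c powr k = j powr k * Z1 c powr k"
    unfolding Z2 powr_mult j(3) by simp_all
  have "D2 - j * D1 = (K - j) * (\<alpha> * W1 c - \<beta> * Z1 c powr h) - E * (\<nu>2 * j powr k - \<nu>1 * j)"
    unfolding D1_def D2_def drift_def z2h by (simp add: Z2 eq E_def algebra_simps)
  moreover have "(K - j) * (\<alpha> * W1 c - \<beta> * Z1 c powr h) \<le> 0"
    using K(2)
  proof
    assume "K = 1"
    then show ?thesis using j by simp
  next
    assume "\<alpha> * W1 c \<le> \<beta> * Z1 c powr h"
    then show ?thesis using j by (intro mult_nonneg_nonpos) auto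
  qed
  moreover have "E * (\<nu>2 * j powr k - \<nu>1 * j) > 0"
  proof -
    have "\<nu>1 * j < \<nu>2 * j" using \<nu> j by simp
    also have "\<dots> \<le> \<nu>2 * j powr k" using \<nu> j by simp
    finally show ?thesis using E by simp
  qed
  ultimately show False using ge by linarith
qed

lemma logsys_increasing:
  assumes L: "logsys \<nu> UNIV W Z" and P: "\<And>s. slope W Z s > 0" and "s < t"
  shows "W s < W t"
  by (rule DERIV_pos_imp_increasing[OF assms(3)]) (use logsysD(3)[OF L UNIV_I] P in blast)

lemma logsys_less_limit:
  assumes L: "logsys \<nu> UNIV W Z" and P: "\<And>s. slope W Z s > 0" and lim: "(W \<longlongrightarrow> l) at_top"
  shows "W s < l"
proof -
  have "eventually (\<lambda>t. W (s + 1) \<le> W t) at_top"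
    using logsys_increasing[OF L P, of "s + 1"]
    by (auto simp: eventually_at_top_linorder less_le intro!: exI[of _ "s + 1"])
  then have "W (s + 1) \<le> l" using lim by (intro tendsto_lowerbound[OF lim]) auto
  moreover have "W s < W (s + 1)" by (rule logsys_increasing[OF L P]) simp
  ultimately show ?thesis by simp
qed

text \<open>If the translate were above \<open>W2\<close> at some \<open>s > a\<close>, it would be
  above at both ends of an interval around \<open>a\<close> but not inside. Increasing the shift
  until it is only just above produces an interior contact from above, which
  \<open>logsys_no_touching\<close> forbids with \<open>K = 1\<close>.\<close>

lemma logsys_sliding:
  assumes L1: "logsys \<nu>1 UNIV W1 Z1" and L2: "logsys \<nu>2 UNIV W2 Z2" and \<nu>: "0 < \<nu>1" "\<nu>1 < \<nu>2"
    and P1: "\<And>s. slope W1 Z1 s > 0" and P2: "\<And>s. slope W2 Z2 s > 0"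
    and lim: "(W1 \<longlongrightarrow> l) at_top" "(W2 \<longlongrightarrow> l) at_top"
    and left: "eventually (\<lambda>s. W1 (s + \<tau>) > W2 s) at_bot"
    and \<tau>: "\<tau> > 0" and a: "W1 (a + \<tau>) = W2 a" and s: "s \<ge> a"
  shows "W1 (s + \<tau>) \<le> W2 s"
proof (rule ccontr)
  assume "\<not> ?thesis"
  then have gt: "W1 (s + \<tau>) > W2 s" by simp
  then have as: "a < s" using a s by (cases "a = s") auto
  note m1 = logsys_increasing[OF L1 P1] and m2 = logsys_increasing[OF L2 P2]
  obtain b where b: "b < a" "W1 (b + \<tau>) > W2 b"
  proof -
    obtain N where "\<And>t. t \<le> N \<Longrightarrow> W1 (t + \<tau>) > W2 t" using left by (auto simp: eventually_at_bot_linorder)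
    then show ?thesis using that[of "min N (a - 1)"] by simp
  qed
  have "eventually (\<lambda>t. W1 t > W2 s) at_top"
    by (rule order_tendstoD(1)[OF lim(1)]) (rule logsys_less_limit[OF L2 P2 lim(2)])
  then obtain N where N: "\<And>t. t \<ge> N \<Longrightarrow> W1 t > W2 s" by (auto simp: eventually_at_top_linorder)
  \<comment> \<open>A shift so large that even the left end of the translate exceeds the maximum of
    \<open>W2\<close> on the interval.\<close>
  define T where "T = max \<tau> (N - b)"
  have T: "T \<ge> \<tau>" "W1 (b + T) > W2 s" using N[of "b + T"] by (auto simp: T_def)
  have c1: "continuous_on UNIV W1" and c2: "continuous_on UNIV W2"
    using logsys_continuous(1)[OF L1] logsys_continuous(1)[OF L2] by auto
  \<comment> \<open>All pairs of a position and a shift at which the translate fails to be strictly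
    above; a pair with the largest shift is the contact point.\<close>
  define A where "A = ({b..s} \<times> {\<tau>..T}) \<inter> {x. W1 (fst x + snd x) \<le> W2 (fst x)}"
  have "closed {x. W1 (fst x + snd x) \<le> W2 (fst x)}"
    by (intro closed_Collect_le continuous_on_compose2[OF c1] continuous_on_compose2[OF c2] continuous_intros) auto
  then have "compact A"
    unfolding A_def by (intro compact_Int_closed compact_Times compact_Icc)
  moreover have "(a, \<tau>) \<in> A" using a b as T by (auto simp: A_def)
  then have "A \<noteq> {}" by blast
  ultimately obtain x where x: "x \<in> A" "\<And>y. y \<in> A \<Longrightarrow> snd y \<le> snd x"
    using continuous_attains_sup[of A snd] continuous_on_snd[OF continuous_on_id] by blast
  define c where "c = fst x"
  define \<sigma> where "\<sigma> = snd x"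
  have c: "b \<le> c" "c \<le> s" "\<tau> \<le> \<sigma>" "W1 (c + \<sigma>) \<le> W2 c"
    using x(1) by (auto simp: A_def c_def \<sigma>_def)
  have above: "W1 (t + \<sigma>') > W2 t" if t: "b \<le> t" "t \<le> s" "\<sigma>' > \<sigma>" for t \<sigma>'
  proof (cases "\<sigma>' \<le> T")
    case True
    show ?thesis
    proof (rule ccontr)
      assume "\<not> ?thesis"
      then have "(t, \<sigma>') \<in> A" using t True c(3) by (auto simp: A_def)
      from x(2)[OF this] show False using t(3) by (simp add: \<sigma>_def)
    qed
  next
    case False
    have "W2 t \<le> W2 s" using m2[of t s] t by (cases "t = s") auto
    also have "\<dots> < W1 (b + T)" by (rule T)
    also have "\<dots> < W1 (t + \<sigma>')" by (rule m1) (use t False in simp)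
    finally show ?thesis .
  qed
  have ge: "W1 (t + \<sigma>) \<ge> W2 t" if t: "b \<le> t" "t \<le> s" for t
  proof (rule tendsto_lowerbound[where F = "at_right \<sigma>"])
    show "((\<lambda>y. W1 (t + y)) \<longlongrightarrow> W1 (t + \<sigma>)) (at_right \<sigma>)"
    proof (rule tendsto_compose[where g = W1])
      show "W1 \<midarrow>t + \<sigma>\<rightarrow> W1 (t + \<sigma>)" using DERIV_isCont[OF logsysD(3)[OF L1 UNIV_I]] by (simp add: isCont_def)
    qed (intro tendsto_intros)
    show "\<forall>\<^sub>F y in at_right \<sigma>. W2 t \<le> W1 (t + y)"
      by (rule eventually_mono[OF eventually_at_right_less[of \<sigma>]]) (use above[OF t] less_imp_le in blast)
  qed simp
  have eq: "W2 c = W1 (c + \<sigma>)" using ge[of c] c by simp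
  have up: "W1 (t + \<tau>) \<le> W1 (t + \<sigma>)" for t
    using c(3) m1[of "t + \<tau>" "t + \<sigma>"] by (cases "\<tau> = \<sigma>") auto
  \<comment> \<open>At both ends the translate by \<tau> is already strictly above, and a larger
    shift only raises it.\<close>
  have "c \<noteq> b" using eq up[of b] b by auto
  moreover have "c \<noteq> s" using eq up[of s] gt by auto
  ultimately have bc: "b < c" "c < s" using c by auto
  have e: "exp (- \<kappa> * \<sigma>) < 1" using c(3) \<tau> \<kappa>0 by simp
  have ee: "\<nu>1 * exp (- \<kappa> * \<sigma>) < \<nu>2"
    using \<nu> mult_strict_left_mono[OF e \<nu>(1)] by linarith
  show False
  proof (rule logsys_no_touching[OF logsys_translate[OF L1, of \<sigma>] L2 _ ee, of 1 c "min (c - b) (s - c)"])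
    show "0 \<le> \<nu>1 * exp (- \<kappa> * \<sigma>)" using \<nu> by simp
    show "W2 t \<le> 1 * W1 (t + \<sigma>)" if "\<bar>t - c\<bar> < min (c - b) (s - c)" for t
      using ge[of t] that by auto
  qed (use bc eq in auto)
qed

lemma logsys_connection_unique:
  assumes L1: "logsys \<nu>1 UNIV W1 Z1" and L2: "logsys \<nu>2 UNIV W2 Z2" and \<nu>: "0 < \<nu>1" "\<nu>1 < \<nu>2"
    and P1: "\<And>s. slope W1 Z1 s > 0" and P2: "\<And>s. slope W2 Z2 s > 0"
    and lim: "(W1 \<longlongrightarrow> wst) at_top" "(W2 \<longlongrightarrow> wst) at_top"
    and left: "\<And>\<tau>. \<tau> > 0 \<Longrightarrow> eventually (\<lambda>s. W1 (s + \<tau>) > W2 s) at_bot"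
    and start: "eventually (\<lambda>s. W1 s < W2 s) at_bot"
  shows False
proof -
  note m1 = logsys_increasing[OF L1 P1]
  have c1: "continuous_on S W1" and c2: "continuous_on S W2" for S
    using logsys_continuous(1)[OF L1] logsys_continuous(1)[OF L2] by auto
  have shift: "\<exists>\<tau>>0. W1 (a + \<tau>) = W2 a \<and> (\<forall>s\<ge>a. W1 (s + \<tau>) \<le> W2 s)" if a: "W1 a < W2 a" for a
  proof -
    have "eventually (\<lambda>t. W1 t > W2 a) at_top"
      by (rule order_tendstoD(1)[OF lim(1)]) (rule logsys_less_limit[OF L2 P2 lim(2)])
    then obtain N where N: "\<And>t. t \<ge> N \<Longrightarrow> W1 t > W2 a" by (auto simp: eventually_at_top_linorder)
    have "\<exists>x\<ge>a. x \<le> max a N \<and> W1 x = W2 a"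
      by (rule IVT') (use a N[of "max a N"] c1 in auto)
    then obtain x where x: "x \<ge> a" "W1 x = W2 a" by blast
    then have "x \<noteq> a" using a by auto
    then have \<tau>: "x - a > 0" using x by simp
    have eq: "W1 (a + (x - a)) = W2 a" using x by simp
    show ?thesis
      using logsys_sliding[OF L1 L2 \<nu> P1 P2 lim left[OF \<tau>] \<tau> eq] \<tau> eq by blast
  qed
  obtain s0 where s0: "\<And>s. s \<le> s0 \<Longrightarrow> W1 s < W2 s" using start by (auto simp: eventually_at_bot_linorder)
  have less: "W1 s < W2 s" for s
  proof (cases "s \<le> s0")
    case False
    obtain \<tau> where \<tau>: "\<tau> > 0" "\<forall>s\<ge>s0. W1 (s + \<tau>) \<le> W2 s" using shift[OF s0[OF order_refl]] by blast
    then have "W1 (s + \<tau>) \<le> W2 s" using False by simp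
    moreover have "W1 s < W1 (s + \<tau>)" using \<tau> by (intro m1) simp
    ultimately show ?thesis by simp
  qed (use s0 in simp)
  \<comment> \<open>Only from here on is multiplication of \<open>W1\<close> by a factor above 1
    admissible in \<open>logsys_no_touching\<close>.\<close>
  obtain a where a: "\<And>s. s \<ge> a \<Longrightarrow> \<alpha> * W1 s < \<beta> * Z1 s powr h"
    using logsys_eventually_decreasing_profile[OF L1 less_imp_le[OF \<nu>(1)] lim(1)]
    by (auto simp: eventually_at_top_linorder)
  obtain \<tau> where \<tau>: "\<tau> > 0" "W1 (a + \<tau>) = W2 a" "\<And>s. s \<ge> a \<Longrightarrow> W1 (s + \<tau>) \<le> W2 s"
    using shift[OF less[of a]] by blast
  have W1p: "W1 s > 0" for s using logsysD(1)[OF L1 UNIV_I] .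
  define R where "R s = W2 s / W1 (s + \<tau>)" for s
  have R1: "R a = 1" "\<And>s. s \<ge> a \<Longrightarrow> R s \<ge> 1"
    using \<tau> W1p[of "a + \<tau>"] W1p by (auto simp: R_def)
  have Rc: "continuous_on S R" for S
    unfolding R_def
    by (intro continuous_on_divide c2 continuous_on_compose2[OF c1[of UNIV]] continuous_intros)
       (use W1p in \<open>auto simp: less_imp_neq[symmetric]\<close>)
  have "filterlim (\<lambda>s. s + \<tau>) at_top at_top"
    by (rule filterlim_at_top_mono[OF filterlim_ident]) (use \<tau> in auto)
  from filterlim_compose[OF lim(1) this]
  have "((\<lambda>s. W1 (s + \<tau>)) \<longlongrightarrow> wst) at_top" .
  then have Rlim: "(R \<longlongrightarrow> 1) at_top"
    unfolding R_def using tendsto_divide[OF lim(2)] wst_pos by fastforce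
  \<comment> \<open>\<open>R\<close> starts at 1, never falls below 1 and tends to 1, so a supremum
    above 1 is attained at an interior point; if \<open>R\<close> is constant, any
    \<open>c > a\<close> serves. Then \<open>R c\<close> is the required multiple.\<close>
  have "\<exists>c>a. \<forall>s\<ge>a. R s \<le> R c"
  proof (cases "\<exists>s\<ge>a. R s > 1")
    case True
    then obtain t where t: "t \<ge> a" "R t > 1" by blast
    have "eventually (\<lambda>s. R s < R t) at_top" by (rule order_tendstoD(2)[OF Rlim t(2)])
    then obtain M where M: "\<And>s. s \<ge> M \<Longrightarrow> R s < R t" by (auto simp: eventually_at_top_linorder)
    obtain c where c: "c \<in> {a..max M t}" "\<And>s. s \<in> {a..max M t} \<Longrightarrow> R s \<le> R c"
    proof -
      have "{a..max M t} \<noteq> {}" using t by auto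
      from continuous_attains_sup[OF compact_Icc this Rc] show ?thesis using that by blast
    qed
    have ct: "R t \<le> R c" using c(2)[of t] t by simp
    then have "c \<noteq> a" using t R1 by auto
    then have "c > a" using c by auto
    moreover have "R s \<le> R c" if "s \<ge> a" for s
    proof (cases "s \<le> max M t")
      case False
      then have "R s < R t" by (intro M) simp
      then show ?thesis using ct by simp
    qed (use c(2) that in auto)
    ultimately show ?thesis by blast
  next
    case False
    then have "R s = 1" if "s \<ge> a" for s using R1(2)[OF that] that by force
    then show ?thesis by (intro exI[of _ "a + 1"]) auto
  qed
  then obtain c where c: "c > a" "\<And>s. s \<ge> a \<Longrightarrow> R s \<le> R c" by blast
  have e: "exp (- \<kappa> * \<tau>) < 1" using \<tau> \<kappa>0 by simp
  have ee: "\<nu>1 * exp (- \<kappa> * \<tau>) < \<nu>2"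
    using \<nu> mult_strict_left_mono[OF e \<nu>(1)] by linarith
  show False
  proof (rule logsys_no_touching[OF logsys_translate[OF L1, of \<tau>] L2 _ ee, of "R c" c "c - a"])
    show "0 \<le> \<nu>1 * exp (- \<kappa> * \<tau>)" using \<nu> by simp
    show "R c \<ge> 1" using R1(2) c by simp
    show "R c = 1 \<or> \<alpha> * W1 (c + \<tau>) \<le> \<beta> * Z1 (c + \<tau>) powr h"
      using a[of "c + \<tau>"] c \<tau> by simp
    show "W2 s \<le> R c * W1 (s + \<tau>)" if "\<bar>s - c\<bar> < c - a" for s
      using c(2)[of s] that W1p[of "s + \<tau>"] by (simp add: R_def[of s] field_simps abs_if split: if_splits)
    show "W2 c = R c * W1 (c + \<tau>)" using W1p[of "c + \<tau>"] by (simp add: R_def)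
  qed (use c in auto)
qed

section \<open>Shooting\<close>

text \<open>While the flux is nonnegative this is \<open>\<mu> F + r F'\<close>, that is
  \<open>r^(- \<mu>)\<close> times the slope, in a form that remains continuous at the origin and
  past a zero of \<open>F\<close>.\<close>

definition excess :: "(real \<Rightarrow> real) \<Rightarrow> (real \<Rightarrow> real) \<Rightarrow> real \<Rightarrow> real" where
  "excess F V r = \<mu> * F r - r * max 0 (V r) powr h"

lemma slope_excess:
  assumes "V (exp s) > 0"
  shows "\<mu> * (exp (\<mu> * s) * F (exp s)) - (exp ((\<mu> - 1) * s) * V (exp s)) powr h = exp (\<mu> * s) * excess F V (exp s)"
  using assms unfolding exp_flux_powr by (simp add: excess_def max_absorb2 algebra_simps)

lemma excess_continuous:
  assumes "sol \<nu> F V"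
  shows "continuous_on {0..} (excess F V)"
  unfolding excess_def using solD(2,3)[OF assms] h0
  by (intro continuous_intros continuous_on_powr') auto

lemma excess_positive_near_0:
  assumes "sol \<nu> F V" "F 0 = 1"
  shows "\<exists>b. \<forall>t<b. excess F V (exp t) > 0"
proof -
  have "excess F V 0 > 0" using assms \<mu>1 by (simp add: excess_def)
  then have "eventually (\<lambda>r. excess F V r > 0) (at_right 0)"
    by (rule order_tendstoD(1)[OF halfline_tendsto_at_right[OF excess_continuous[OF assms(1)]]])
  then obtain d where d: "d > 0" "\<And>r. 0 < r \<Longrightarrow> r < d \<Longrightarrow> excess F V r > 0"
    by (auto simp: eventually_at_right[of 0 1, simplified] eventually_at_right_field)
  have "excess F V (exp t) > 0" if "t < ln d" for t
    using that d by (intro d(2)) (auto simp: ln_less_cancel_iff[of "exp t" d, simplified])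
  then show ?thesis by blast
qed

text \<open>At a first zero \<open>c\<close> of \<open>F\<close> the flux is positive, so the excess
  is negative; by continuity it is negative slightly before \<open>c\<close>, where \<open>F\<close>
  is still positive.\<close>

lemma sol_zero_crossing:
  assumes s: "sol \<nu> F V" "F 0 = 1" and \<nu>: "\<nu> \<ge> 0"
    and no: "\<And>r. r > 0 \<Longrightarrow> (\<And>t. 0 \<le> t \<Longrightarrow> t \<le> r \<Longrightarrow> F t > 0) \<Longrightarrow> excess F V r \<ge> 0"
    and r: "r \<ge> 0"
  shows "F r > 0"
proof (rule ccontr)
  assume "\<not> ?thesis"
  then have ge: "- F r \<ge> 0" by simp
  have "continuous_on {0..r} (\<lambda>t. - F t)"
    by (intro continuous_intros continuous_on_subset[OF solD(2)[OF s(1)]]) auto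
  then obtain c where c: "0 < c" "c \<le> r" "- F c = 0" "\<And>t. 0 \<le> t \<Longrightarrow> t < c \<Longrightarrow> - F t < 0"
    using first_zero_from_neg[of 0 r "\<lambda>t. - F t"] r ge s(2) by auto
  have "V c > 0"
    by (rule sol_flux_positive[OF s(1) \<nu>, of c]) (use c in auto)
  then have neg: "excess F V c < 0" using c by (simp add: excess_def)
  have "isCont (excess F V) c"
    using excess_continuous[OF s(1)] c(1) by (auto intro: continuous_on_interior)
  then have "(excess F V \<longlongrightarrow> excess F V c) (at_left c)"
    unfolding isCont_def by (rule tendsto_mono[rotated]) (auto intro: at_le)
  then have "eventually (\<lambda>t. excess F V t < 0) (at_left c)"
    using neg by (rule order_tendstoD(2))
  moreover have "eventually (\<lambda>t. t \<in> {0<..<c}) (at_left c)"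
    by (rule eventually_at_left_real) (rule c)
  ultimately have "eventually (\<lambda>t. excess F V t < 0 \<and> t \<in> {0<..<c}) (at_left c)"
    by (rule eventually_conj)
  then obtain t where t: "excess F V t < 0" "0 < t" "t < c"
    using eventually_happens'[OF trivial_limit_at_left_real] by fastforce
  have "excess F V t \<ge> 0" using c(4) t by (intro no) force+
  then show False using t by simp
qed

lemma sol_positive_log:
  assumes s: "sol \<nu> F V" "F 0 = 1" and \<nu>: "\<nu> \<ge> 0" and pos: "\<And>r. r \<ge> 0 \<Longrightarrow> F r > 0"
  shows "logsys \<nu> UNIV (\<lambda>s. exp (\<mu> * s) * F (exp s)) (\<lambda>s. exp ((\<mu> - 1) * s) * V (exp s))"
    and "\<And>r. r > 0 \<Longrightarrow> V r > 0"
proof -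
  show "logsys \<nu> UNIV (\<lambda>s. exp (\<mu> * s) * F (exp s)) (\<lambda>s. exp ((\<mu> - 1) * s) * V (exp s))"
    by (rule logsys_of_sol[OF s(1) \<nu>]) (use pos s(2) in auto)
  show "V r > 0" if "r > 0" for r
    by (rule sol_flux_positive[OF s(1) \<nu>, of r]) (use that pos in auto)
qed

lemma shooting_disjoint:
  assumes s: "sol \<nu> F V" "F 0 = 1" and \<nu>: "\<nu> > 0"
    and r1: "r1 > 0" "\<And>t. 0 \<le> t \<Longrightarrow> t \<le> r1 \<Longrightarrow> F t > 0" "excess F V r1 < 0"
    and r2: "r2 > 0" "\<And>t. 0 \<le> t \<Longrightarrow> t \<le> r2 \<Longrightarrow> F t > 0" "r2 powr \<mu> * F r2 > wst"
  shows False
proof -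
  define R where "R = max r1 r2"
  have R: "R > 0" "r1 \<le> R" "r2 \<le> R" using r1 r2 by (auto simp: R_def)
  have pos: "F t > 0" if "0 \<le> t" "t \<le> R" for t
    using r1(2)[of t] r2(2)[of t] that by (auto simp: R_def max_def split: if_splits)
  have "isCont F R"
    using solD(2)[OF s(1)] R by (auto intro: continuous_on_interior)
  then have "eventually (\<lambda>t. F t > 0) (at R)"
    unfolding isCont_def using pos[of R] R by (intro order_tendstoD(1)) auto
  then obtain d where d: "d > 0" "\<And>t. t \<noteq> R \<Longrightarrow> dist t R < d \<Longrightarrow> F t > 0"
    by (auto simp: eventually_at)
  have pos': "F t > 0" if "0 \<le> t" "t < R + d" for t
    using pos[of t] d(2)[of t] that by (cases "t \<le> R") (auto simp: dist_real_def)
  \<comment> \<open>\<open>logsys\<close> needs an open interval containing both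
    \<open>ln r1\<close> and \<open>ln r2\<close>, hence the margin \<open>d\<close> beyond the
    larger radius.\<close>
  define I where "I = {..< ln (R + d)}"
  have inI: "ln t \<in> I \<longleftrightarrow> t < R + d" if "t > 0" for t
    using that R d by (simp add: I_def)
  have posI: "F (exp t) > 0" if "t \<in> I" for t
    using inI[of "exp t"] that by (intro pos') auto
  have L: "logsys \<nu> I (\<lambda>s. exp (\<mu> * s) * F (exp s)) (\<lambda>s. exp ((\<mu> - 1) * s) * V (exp s))"
    by (rule logsys_of_sol[OF s(1)]) (use \<nu> s(2) posI in \<open>auto simp: I_def\<close>)
  have Vpos: "V (exp t) > 0" if "t \<in> I" for t
    using logsysD(2)[OF L that] by (simp add: zero_less_mult_iff)
  obtain b where b: "\<And>t. t < b \<Longrightarrow> excess F V (exp t) > 0"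
    using excess_positive_near_0[OF s] by blast
  have R1I: "ln r1 \<in> I" and R2I: "ln r2 \<in> I" using inI r1 r2 R d by auto
  have b': "\<mu> * (exp (\<mu> * t) * F (exp t)) - (exp ((\<mu> - 1) * t) * V (exp t)) powr h > 0"
    if "t < min b (ln r1)" for t
  proof -
    have "t \<in> I" by (rule logsys_down[OF L R1I]) (use that in simp)
    then show ?thesis using b[of t] that Vpos by (subst slope_excess) auto
  qed
  have "\<mu> * (exp (\<mu> * ln r1) * F (exp (ln r1))) - (exp ((\<mu> - 1) * ln r1) * V (exp (ln r1))) powr h \<le> 0"
    using slope_excess[of V "ln r1" F] Vpos[OF R1I] r1 by (simp add: mult_le_0_iff)
  then have "exp (\<mu> * ln r2) * F (exp (ln r2)) < wst"
    by (intro logsys_no_return_bound[OF L \<nu> _ R1I _ R2I]) (rule b')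
  then show False using r2 by (simp add: exp_ln_powr)
qed

text \<open>Positivity on a compact interval has a positive margin, the minimum of \<open>F\<close>,
  and the condition at the end is open; \<open>sol_uniformly_close\<close> preserves both.\<close>

lemma shooting_open:
  assumes s: "sol \<nu> F V" "F 0 = 1" "\<nu> \<ge> 0" and r: "r \<ge> 0"
    and pos: "\<And>t. 0 \<le> t \<Longrightarrow> t \<le> r \<Longrightarrow> F t > 0" and U: "open U" "(F r, V r) \<in> U"
  shows "\<exists>\<delta>>0. \<forall>\<nu>' F' V'. sol \<nu>' F' V' \<longrightarrow> F' 0 = 1 \<longrightarrow> \<nu>' \<ge> 0 \<longrightarrow> \<bar>\<nu>' - \<nu>\<bar> < \<delta> \<longrightarrow>
    (\<forall>t. 0 \<le> t \<longrightarrow> t \<le> r \<longrightarrow> F' t > 0) \<and> (F' r, V' r) \<in> U"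
proof -
  have "continuous_on {0..r} F" by (rule continuous_on_subset[OF solD(2)[OF s(1)]]) auto
  then obtain c where c: "c \<in> {0..r}" "\<And>t. t \<in> {0..r} \<Longrightarrow> F c \<le> F t"
    using continuous_attains_inf[of "{0..r}" F] r by auto
  obtain e where e: "e > 0" "ball (F r, V r) e \<subseteq> U" using U openE by blast
  define \<eta> where "\<eta> = min (F c) (e / 2)"
  have \<eta>: "\<eta> > 0" "\<eta> \<le> F c" "\<eta> \<le> e / 2" using pos[of c] c e by (auto simp: \<eta>_def)
  obtain \<delta> where \<delta>: "\<delta> > 0" "\<And>\<nu>' F' V' t. sol \<nu>' F' V' \<Longrightarrow> F' 0 = 1 \<Longrightarrow> \<nu>' \<ge> 0 \<Longrightarrow> \<bar>\<nu>' - \<nu>\<bar> < \<delta> \<Longrightarrow>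
    0 \<le> t \<Longrightarrow> t \<le> r \<Longrightarrow> \<bar>F' t - F t\<bar> < \<eta> \<and> \<bar>V' t - V t\<bar> < \<eta>"
    using sol_uniformly_close[OF s \<eta>(1), of r] by blast
  show ?thesis
  proof (intro exI[of _ \<delta>] conjI allI impI \<delta>(1))
    fix \<nu>' F' V' assume a: "sol \<nu>' F' V'" "F' 0 = 1" "\<nu>' \<ge> 0" "\<bar>\<nu>' - \<nu>\<bar> < \<delta>"
    show "F' t > 0" if "0 \<le> t" "t \<le> r" for t
      using \<delta>(2)[OF a that] c(2)[of t] that \<eta> by (auto simp: abs_less_iff)
    have "\<bar>F' r - F r\<bar> < e / 2" "\<bar>V' r - V r\<bar> < e / 2"
      using \<delta>(2)[OF a r order_refl] \<eta> by auto
    moreover have "dist (F' r, V' r) (F r, V r) \<le> \<bar>F' r - F r\<bar> + \<bar>V' r - V r\<bar>"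
      by (simp add: dist_prod_def dist_real_def sqrt_sum_squares_le_sum_abs)
    ultimately have "dist (F r, V r) (F' r, V' r) < e" by (simp add: dist_commute)
    then show "(F' r, V' r) \<in> U" using e(2) by auto
  qed
qed

section \<open>The two ends of the range of absorption coefficients\<close>

text \<open>
  Without absorption \<open>r^(n-1) (V - \<beta> r F)\<close> increases since \<open>\<alpha> > n \<beta>\<close>; this forces \<open>Z \<rightarrow> \<infinity>\<close>, while \<open>W' \<ge> 0\<close>
  together with \<open>Z \<ge> \<beta> W\<close> bounds \<open>Z\<close>.
\<close>

lemma no_absorption_crosses:
  assumes s: "sol 0 F V" "F 0 = 1"
  shows "\<exists>r>0. (\<forall>t. 0 \<le> t \<longrightarrow> t \<le> r \<longrightarrow> F t > 0) \<and> excess F V r < 0"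
proof (rule ccontr)
  assume "\<not> ?thesis"
  then have no: "excess F V r \<ge> 0" if "r > 0" "\<And>t. 0 \<le> t \<Longrightarrow> t \<le> r \<Longrightarrow> F t > 0" for r
    using that by force
  have pos: "F r > 0" if "r \<ge> 0" for r
    by (rule sol_zero_crossing[OF s order_refl no that])
  have exc: "excess F V r \<ge> 0" if "r > 0" for r by (rule no[OF that pos])
  have Vpos: "V r > 0" if "r > 0" for r by (rule sol_positive_log(2)[OF s order_refl pos that])
  \<comment> \<open>Since \<open>F' = - V^h\<close>, the \<beta>-terms cancel and the derivative is
    \<open>r^(n-1) (\<alpha> - n \<beta>) F\<close>.\<close>
  define G where "G r = r ^ (n - 1) * (V r - \<beta> * r * F r)" for r
  have dG: "DERIV G r :> r ^ (n - 1) * ((\<alpha> - real n * \<beta>) * F r)" if r: "r > 0" for r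
    unfolding G_def
  proof (rule radial_product_derivative[OF n1 r])
    show "DERIV (\<lambda>r. V r - \<beta> * r * F r) r :> (\<alpha> - real n * \<beta>) * F r - (real n - 1) / r * (V r - \<beta> * r * F r)"
      by (rule derivative_eq_intros solD(4,5)[OF s(1) r] refl)+ (use r in \<open>simp add: field_simps\<close>)
  qed
  have G_mono: "G r < G t" if "0 \<le> r" "r < t" for r t
  proof (rule DERIV_pos_imp_increasing_open[where f = G, OF that(2)])
    show "\<exists>y. DERIV G x :> y \<and> 0 < y" if "r < x" for x
    proof -
      have "x > 0" using that \<open>0 \<le> r\<close> by simp
      moreover have "x ^ (n - 1) * ((\<alpha> - real n * \<beta>) * F x) > 0"
        using \<open>x > 0\<close> pos[of x] \<alpha>\<beta> by simp
      ultimately show ?thesis using dG by blast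
    qed
    show "continuous_on {r..t} G"
      unfolding G_def using that solD(2,3)[OF s(1)]
      by (intro continuous_intros) (auto intro: continuous_on_subset)
  qed
  have G0: "G 0 = 0" using solD(1)[OF s(1)] by (simp add: G_def)
  have Gpos: "G r > 0" if "r > 0" for r using G_mono[of 0 r] G0 that by simp
  have VF: "V r \<ge> \<beta> * r * F r" if "r > 0" for r
    using Gpos[OF that] that by (simp add: G_def zero_less_mult_iff)
  have Vh: "r powr \<mu> * F r * \<mu> \<ge> (r powr (\<mu> - 1) * V r) powr h" if r: "r > 0" for r
  proof -
    have "(r powr (\<mu> - 1) * V r) powr h = r powr \<mu> * (r * V r powr h)"
      using r by (simp add: powr_mult powr_powr \<mu>h powr_add)
    also have "\<dots> \<le> r powr \<mu> * (\<mu> * F r)"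
      using exc[OF r] Vpos[OF r] by (intro mult_left_mono) (auto simp: excess_def max_absorb2)
    finally show ?thesis by (simp add: mult_ac)
  qed
  define z where "z r = r powr (\<mu> - 1) * V r" for r
  have zpos: "z r > 0" if "r > 0" for r using Vpos[OF that] that by (simp add: z_def)
  \<comment> \<open>The two bounds \<open>z^h \<le> \<mu> W\<close> and
    \<open>\<beta> W \<le> z\<close> combine to
    \<open>z^h \<le> \<mu> / \<beta> * z\<close>.\<close>
  have zb: "z r powr (h - 1) \<le> \<mu> / \<beta>" if r: "r > 0" for r
  proof -
    have "z r powr h \<le> \<mu> * (r powr \<mu> * F r)" using Vh[OF r] by (simp add: z_def mult_ac)
    also have "r powr \<mu> * F r \<le> z r / \<beta>"
    proof -
      have "\<beta> * (r powr \<mu> * F r) = r powr (\<mu> - 1) * (\<beta> * r * F r)"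
        using r by (simp add: powr_diff)
      also have "\<dots> \<le> z r" unfolding z_def using VF[OF r] by (intro mult_left_mono) auto
      finally show ?thesis using \<beta>0 by (simp add: field_simps)
    qed
    then have "\<mu> * (r powr \<mu> * F r) \<le> \<mu> * (z r / \<beta>)" using \<mu>1 by (intro mult_left_mono) auto
    finally have "z r * z r powr (h - 1) \<le> z r * (\<mu> / \<beta>)"
      using zpos[OF r] by (simp add: powr_diff mult_ac)
    then show ?thesis using mult_left_le_imp_le[OF _ zpos[OF r]] by blast
  qed
  have zlow: "z r \<ge> r powr (\<mu> - real n) * G 1" if r: "r \<ge> 1" for r
  proof -
    have r0: "r > 0" using r by simp
    have "G 1 \<le> G r" using G_mono[of 1 r] r by (cases "r = 1") auto
    also have "\<dots> \<le> r ^ (n - 1) * V r"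
      unfolding G_def using r0 pos[of r] \<beta>0 by (intro mult_left_mono) auto
    finally have "r powr (\<mu> - real n) * G 1 \<le> r powr (\<mu> - real n) * (r ^ (n - 1) * V r)"
      by (intro mult_left_mono) auto
    also have "r ^ (n - 1) = r powr (real n - 1)"
      using r0 n1 by (simp add: powr_realpow[symmetric] of_nat_diff)
    also have "r powr (\<mu> - real n) * (r powr (real n - 1) * V r) = z r"
      by (simp add: z_def mult.assoc[symmetric] powr_add[symmetric])
    finally show ?thesis .
  qed
  define B where "B = (\<mu> / \<beta>) powr (1 / (h - 1))"
  have zB: "z r \<le> B" if "r > 0" for r
  proof -
    have "(z r powr (h - 1)) powr (1 / (h - 1)) \<le> B"
      unfolding B_def using zb[OF that] h1 by (intro powr_mono2) auto
    then show ?thesis using zpos[OF that] h1 by (simp add: powr_powr)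
  qed
  have B0: "B \<ge> 0" by (simp add: B_def)
  \<comment> \<open>A radius at which the lower bound \<open>r powr (\<mu> - n) * G 1\<close> equals
    \<open>B + 1 + G 1\<close>, above the upper bound \<open>B\<close>.\<close>
  define r where "r = ((B + 1) / G 1 + 1) powr (1 / (\<mu> - real n))"
  have q: "(B + 1) / G 1 + 1 \<ge> 1" using B0 Gpos[of 1] by simp
  have r1: "r \<ge> 1" unfolding r_def using q \<mu>n by (intro ge_one_powr_ge_zero) auto
  have "r powr (\<mu> - real n) = (B + 1) / G 1 + 1" unfolding r_def using q \<mu>n by (simp add: powr_powr)
  then have "r powr (\<mu> - real n) * G 1 = B + 1 + G 1" using Gpos[of 1] by (simp add: field_simps)
  then show False using zlow[OF r1] zB[of r] r1 Gpos[of 1] by simp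
qed

text \<open>Above this level the absorption alone outweighs the source
  \<open>\<alpha> * F \<le> \<alpha>\<close>, so \<open>V\<close> decreases.\<close>

lemma sol_flux_bound_absorption:
  assumes s: "sol \<nu> F V" "F 0 = 1" and \<nu>: "\<nu> > 0" and r: "r \<ge> 0"
  shows "V r \<le> (\<alpha> / \<nu>) powr (1 / k)"
proof (rule ccontr)
  define v where "v = (\<alpha> / \<nu>) powr (1 / k)"
  have v: "v > 0" "\<nu> * v powr k = \<alpha>" using \<alpha>0 \<nu> k0 by (auto simp: v_def powr_powr)
  assume "\<not> ?thesis"
  then have neg: "v - V r < 0" by (simp add: v_def)
  have cont: "continuous_on {0..r} (\<lambda>r. v - V r)"
    by (intro continuous_intros continuous_on_subset[OF solD(3)[OF s(1)]]) auto
  obtain c where c: "0 \<le> c" "c < r" "v - V c = 0" "\<And>t. c < t \<Longrightarrow> t \<le> r \<Longrightarrow> v - V t < 0"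
    using last_zero_to_neg[OF r cont _ neg] solD(1)[OF s(1)] v by auto
  have "V r \<le> V c"
  proof (rule DERIV_nonpos_imp_decreasing_open[where f = V])
    fix x assume x: "c < x" "x < r"
    have x0: "x > 0" using x c by simp
    have Vx: "V x > v" using c(4)[of x] x by simp
    have "\<alpha> * F x \<le> \<alpha> * 1"
      using sol_bounds(1)[OF s, of x] \<nu> x0 \<alpha>0 by (intro mult_left_mono) auto
    moreover have "\<alpha> \<le> \<nu> * V x powr k"
      unfolding v(2)[symmetric] using \<nu> v Vx k0 by (intro mult_left_mono powr_mono2) auto
    moreover have "\<beta> * x * V x powr h \<ge> 0" "(real n - 1) / x * V x \<ge> 0"
      using \<beta>0 x0 n1 Vx v by auto
    ultimately have "\<alpha> * F x - \<beta> * x * V x powr h - \<nu> * V x powr k - (real n - 1) / x * V x \<le> 0"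
      by linarith
    then show "\<exists>y. DERIV V x :> y \<and> y \<le> 0"
      using solD(5)[OF s(1) x0] Vx v by (auto simp: max_absorb2)
  next
    show "continuous_on {c..r} V" by (rule continuous_on_subset[OF solD(3)[OF s(1)]]) (use c in auto)
  qed (use c in simp)
  then show False using c neg by simp
qed

lemma large_absorption_exceeds:
  "\<exists>\<nu>>0. \<forall>F V. sol \<nu> F V \<longrightarrow> F 0 = 1 \<longrightarrow>
     (\<exists>r>0. (\<forall>t. 0 \<le> t \<longrightarrow> t \<le> r \<longrightarrow> F t > 0) \<and> r powr \<mu> * F r > wst)"
proof -
  \<comment> \<open>Half of \<open>R powr \<mu>\<close> exceeds \<open>wst\<close>.\<close>
  define R where "R = (2 * wst + 1) powr (1 / \<mu>)"
  have R: "R > 0" "R powr \<mu> = 2 * wst + 1" using wst_pos \<mu>1 by (auto simp: R_def powr_powr)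
  \<comment> \<open>Chosen so that the flux bound \<open>v\<close> satisfies
    \<open>v powr h = 1 / (2 * R)\<close>; then \<open>F\<close> loses at most 1/2 on
    \<open>{0..R}\<close>.\<close>
  define \<nu> where "\<nu> = \<alpha> * (2 * R) powr (k / h)"
  have \<nu>: "\<nu> > 0" using \<alpha>0 R by (simp add: \<nu>_def)
  define v where "v = (\<alpha> / \<nu>) powr (1 / k)"
  have vh: "v powr h = 1 / (2 * R)"
  proof -
    have "\<alpha> / \<nu> = (2 * R) powr - (k / h)" using \<alpha>0 by (simp add: \<nu>_def powr_minus field_simps)
    then have "v powr h = (2 * R) powr (- (k / h) * (1 / k) * h)" by (simp add: v_def powr_powr)
    also have "- (k / h) * (1 / k) * h = - 1" using h0 k0 by simp
    finally show ?thesis using R by (simp add: powr_minus_divide)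
  qed
  have "\<exists>r>0. (\<forall>t. 0 \<le> t \<longrightarrow> t \<le> r \<longrightarrow> F t > 0) \<and> r powr \<mu> * F r > wst"
    if s: "sol \<nu> F V" "F 0 = 1" for F V
  proof -
    have ge: "F t \<ge> 1 / 2" if t: "0 \<le> t" "t \<le> R" for t
    proof (cases "t = 0")
      case False
      have "F 0 + v powr h * 0 \<le> F t + v powr h * t"
      proof (rule DERIV_nonneg_imp_increasing_open[where f = "\<lambda>t. F t + v powr h * t"])
        fix x assume x: "0 < x" "x < t"
        have "V x \<le> v" unfolding v_def using x by (intro sol_flux_bound_absorption[OF s \<nu>]) auto
        then have "max 0 (V x) powr h \<le> v powr h"
          using h0 by (intro powr_mono2) (auto simp: v_def)
        moreover have "DERIV (\<lambda>t. F t + v powr h * t) x :> - (max 0 (V x) powr h) + v powr h"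
          by (rule derivative_eq_intros solD(4)[OF s(1) x(1)] refl)+ simp
        ultimately show "\<exists>y. DERIV (\<lambda>t. F t + v powr h * t) x :> y \<and> 0 \<le> y"
          by (intro exI[of _ "- (max 0 (V x) powr h) + v powr h"]) auto
      next
        show "continuous_on {0..t} (\<lambda>t. F t + v powr h * t)"
          by (intro continuous_intros continuous_on_subset[OF solD(2)[OF s(1)]]) auto
      qed (use t in simp)
      moreover have "v powr h * t \<le> 1 / 2" unfolding vh using t R by (simp add: field_simps)
      ultimately show ?thesis using s(2) by simp
    qed (use s in simp)
    have "R powr \<mu> * F R \<ge> R powr \<mu> * (1 / 2)" using ge[of R] R(1) by (intro mult_left_mono) auto
    then have "R powr \<mu> * F R > wst" using R(2) by simp
    moreover have "F t > 0" if "0 \<le> t" "t \<le> R" for t using ge[OF that] by simp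
    ultimately show ?thesis using R by blast
  qed
  then show ?thesis using \<nu> by blast
qed

lemma connection_exists:
  obtains \<nu> F V where "\<nu> > 0" "sol \<nu> F V" "F 0 = 1" "\<And>r. r \<ge> 0 \<Longrightarrow> F r > 0"
    "((\<lambda>r. r powr \<mu> * F r) \<longlongrightarrow> wst) at_top"
proof -
  have "\<forall>\<nu>. \<exists>F V. \<nu> \<ge> 0 \<longrightarrow> sol \<nu> F V \<and> F 0 = 1" using sol_exists by metis
  then obtain F V where s: "\<And>\<nu>. \<nu> \<ge> 0 \<Longrightarrow> sol \<nu> (F \<nu>) (V \<nu>)" "\<And>\<nu>. \<nu> \<ge> 0 \<Longrightarrow> F \<nu> 0 = (1::real)" by metis
  define hits where "hits U \<nu> \<longleftrightarrow> (\<exists>r>0. (\<forall>t. 0 \<le> t \<longrightarrow> t \<le> r \<longrightarrow> F \<nu> t > 0) \<and> (F \<nu> r, V \<nu> r) \<in> U r)" for U \<nu>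
  define U1 where "U1 r = {x. \<mu> * fst x - r * max 0 (snd x) powr h < 0}" for r
  define U2 where "U2 r = {x :: real \<times> real. r powr \<mu> * fst x > wst}" for r
  have U: "open (U1 r)" "open (U2 r)" for r
  proof -
    have "continuous_on UNIV (\<lambda>x :: real \<times> real. max 0 (snd x) powr h)"
      using h0 by (intro continuous_on_powr' continuous_intros) auto
    then show "open (U1 r)" unfolding U1_def
      by (intro open_Collect_less continuous_on_diff continuous_on_mult_left continuous_on_fst
          continuous_on_id continuous_on_const)
    show "open (U2 r)" unfolding U2_def by (intro open_Collect_less continuous_intros)
  qed
  have hit_nbhd: "\<exists>\<delta>>0. \<forall>\<nu>'\<ge>0. \<bar>\<nu>' - \<nu>\<bar> < \<delta> \<longrightarrow> hits U \<nu>'" if hyp: "\<nu> \<ge> 0" "hits U \<nu>" "\<And>r. open (U r)" for U \<nu>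
  proof -
    obtain r where r: "r > 0" "\<And>t. 0 \<le> t \<Longrightarrow> t \<le> r \<Longrightarrow> F \<nu> t > 0" "(F \<nu> r, V \<nu> r) \<in> U r"
      using hyp(2) unfolding hits_def by blast
    obtain \<delta> where \<delta>: "\<delta> > 0" "\<And>\<nu>' F' V'. sol \<nu>' F' V' \<Longrightarrow> F' 0 = 1 \<Longrightarrow> \<nu>' \<ge> 0 \<Longrightarrow> \<bar>\<nu>' - \<nu>\<bar> < \<delta> \<Longrightarrow>
      (\<forall>t. 0 \<le> t \<longrightarrow> t \<le> r \<longrightarrow> F' t > 0) \<and> (F' r, V' r) \<in> U r"
      using shooting_open[OF s[OF hyp(1)] hyp(1) less_imp_le[OF r(1)] r(2) hyp(3) r(3)] by blast
    have "hits U \<nu>'" if "\<nu>' \<ge> 0" "\<bar>\<nu>' - \<nu>\<bar> < \<delta>" for \<nu>'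
      unfolding hits_def using \<delta>(2)[OF s[OF that(1)] that] r(1) by blast
    then show ?thesis using \<delta>(1) by blast
  qed
  define A where "A U = {\<nu>. \<nu> > 0 \<and> hits U \<nu>}" for U
  have A_open: "open (A U)" if opn: "\<And>r. open (U r)" for U
    unfolding open_dist
  proof
    fix \<nu> assume "\<nu> \<in> A U"
    then have \<nu>: "\<nu> > 0" "hits U \<nu>" by (auto simp: A_def)
    obtain \<delta> where \<delta>: "\<delta> > 0" "\<And>\<nu>'. \<nu>' \<ge> 0 \<Longrightarrow> \<bar>\<nu>' - \<nu>\<bar> < \<delta> \<Longrightarrow> hits U \<nu>'"
      using hit_nbhd[OF less_imp_le[OF \<nu>(1)] \<nu>(2) opn] by blast
    show "\<exists>e>0. \<forall>y. dist y \<nu> < e \<longrightarrow> y \<in> A U"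
    proof (intro exI[of _ "min \<delta> \<nu>"] conjI allI impI)
      fix y assume y: "dist y \<nu> < min \<delta> \<nu>"
      then have "y > 0" "\<bar>y - \<nu>\<bar> < \<delta>" by (auto simp: dist_real_def abs_less_iff)
      then show "y \<in> A U" using \<delta>(2)[of y] by (simp add: A_def)
    qed (use \<delta> \<nu> in auto)
  qed
  have U1_iff: "(F \<nu> r, V \<nu> r) \<in> U1 r \<longleftrightarrow> excess (F \<nu>) (V \<nu>) r < 0" for \<nu> r
    by (simp add: U1_def excess_def)
  have U2_iff: "(F \<nu> r, V \<nu> r) \<in> U2 r \<longleftrightarrow> r powr \<mu> * F \<nu> r > wst" for \<nu> r
    by (simp add: U2_def)
  have "A U1 \<inter> A U2 = {}"
  proof (rule ccontr)
    assume "A U1 \<inter> A U2 \<noteq> {}"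
    then obtain \<nu> where \<nu>: "\<nu> > 0" "hits U1 \<nu>" "hits U2 \<nu>" by (auto simp: A_def)
    obtain r1 r2 where "r1 > 0" "\<And>t. 0 \<le> t \<Longrightarrow> t \<le> r1 \<Longrightarrow> F \<nu> t > 0" "excess (F \<nu>) (V \<nu>) r1 < 0"
       "r2 > 0" "\<And>t. 0 \<le> t \<Longrightarrow> t \<le> r2 \<Longrightarrow> F \<nu> t > 0" "r2 powr \<mu> * F \<nu> r2 > wst"
      using \<nu>(2,3) unfolding hits_def U1_iff U2_iff by blast
    then show False using shooting_disjoint[OF s[OF less_imp_le[OF \<nu>(1)]] \<nu>(1)] by blast
  qed
  moreover have "A U1 \<inter> {0<..} \<noteq> {}"
  proof -
    \<comment> \<open>The coefficient 0 lies outside the connected set \<open>{0<..}\<close>;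
      openness relative to nonnegative coefficients carries the crossing over to small positive
      ones.\<close>
    have "hits U1 0" unfolding hits_def U1_iff using no_absorption_crosses[OF s[OF order_refl]] by blast
    then obtain \<delta> where \<delta>: "\<delta> > 0" "\<And>\<nu>'. \<nu>' \<ge> 0 \<Longrightarrow> \<bar>\<nu>' - 0\<bar> < \<delta> \<Longrightarrow> hits U1 \<nu>'"
      using hit_nbhd[where U = U1, OF order_refl _ U(1)] by blast
    then have "\<delta> / 2 \<in> A U1" by (simp add: A_def)
    then show ?thesis using \<delta>(1) by auto
  qed
  moreover have "A U2 \<inter> {0<..} \<noteq> {}"
  proof -
    obtain \<nu> where "\<nu> > 0" "hits U2 \<nu>"
      unfolding hits_def U2_iff using large_absorption_exceeds s less_imp_le by metis
    then show ?thesis by (auto simp: A_def)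
  qed
  ultimately have "\<not> {0<..} \<subseteq> A U1 \<union> A U2"
    using connectedD[OF connected_Ioi[of "0::real"] A_open[where U = U1, OF U(1)] A_open[where U = U2, OF U(2)]] by blast
  then obtain \<nu> where \<nu>: "\<nu> > 0" "\<not> hits U1 \<nu>" "\<not> hits U2 \<nu>" by (auto simp: A_def)
  note e0 = less_imp_le[OF \<nu>(1)]
  have no: "excess (F \<nu>) (V \<nu>) r \<ge> 0" if "r > 0" "\<And>t. 0 \<le> t \<Longrightarrow> t \<le> r \<Longrightarrow> F \<nu> t > 0" for r
    using \<nu>(2) that unfolding hits_def U1_iff by force
  have pos: "F \<nu> r > 0" if "r \<ge> 0" for r
    by (rule sol_zero_crossing[OF s[OF e0] e0 no that])
  have le: "r powr \<mu> * F \<nu> r \<le> wst" if "r > 0" for r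
    using \<nu>(3) that pos unfolding hits_def U2_iff by force
  define W where "W t = exp (\<mu> * t) * F \<nu> (exp t)" for t
  note log = sol_positive_log[OF s[OF e0] e0 pos]
  have L: "logsys \<nu> UNIV W (\<lambda>t. exp ((\<mu> - 1) * t) * V \<nu> (exp t))"
    unfolding W_def by (rule log(1))
  have "W t \<le> W t'" if "t \<le> t'" for t t'
  proof (rule DERIV_nonneg_imp_nondecreasing[OF that])
    fix x
    have "\<mu> * W x - (exp ((\<mu> - 1) * x) * V \<nu> (exp x)) powr h = exp (\<mu> * x) * excess (F \<nu>) (V \<nu>) (exp x)"
      unfolding W_def by (rule slope_excess) (simp add: log(2))
    also have "\<dots> \<ge> 0" using no[of "exp x"] pos by simp
    finally show "\<exists>y. DERIV W x :> y \<and> 0 \<le> y"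
      using logsysD(3)[OF L UNIV_I] by blast
  qed
  then have "(\<exists>l. (W \<longlongrightarrow> l) at_top \<and> (\<forall>s\<ge>0. W s \<le> l)) \<or> filterlim W at_top at_top"
    by (intro mono_at_top_cases)
  moreover have Wle: "W t \<le> wst" for t
    using le[of "exp t"] by (simp add: W_def exp_powr_real mult.commute)
  have "\<not> filterlim W at_top at_top"
  proof
    assume "filterlim W at_top at_top"
    then have "eventually (\<lambda>t. W t \<ge> wst + 1) at_top" unfolding filterlim_at_top by blast
    then obtain t where "W t \<ge> wst + 1" by (auto simp: eventually_at_top_linorder)
    then show False using Wle[of t] by simp
  qed
  ultimately obtain l where l: "(W \<longlongrightarrow> l) at_top" "W 0 \<le> l" by blast
  have "l \<le> wst" by (rule tendsto_upperbound[OF l(1)]) (use Wle in auto)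
  moreover have "\<not> l < wst"
    using logsys_limit_not_below[OF L e0 l(1)] l(2) logsysD(1)[OF L UNIV_I, of 0] by force
  ultimately have "(W \<longlongrightarrow> wst) at_top" using l(1) by simp
  from filterlim_compose[OF this ln_at_top]
  have "((\<lambda>r. W (ln r)) \<longlongrightarrow> wst) at_top" .
  then have "((\<lambda>r. r powr \<mu> * F \<nu> r) \<longlongrightarrow> wst) at_top"
    by (rule filterlim_cong[THEN iffD1, OF refl refl, rotated])
       (auto simp: W_def exp_ln_powr intro!: eventually_mono[OF eventually_gt_at_top[of 0]])
  then show ?thesis using that[OF \<nu>(1) s[OF e0] pos] by blast
qed

section \<open>Expansion at the origin\<close>

lemma flux_ratio_tendsto:
  assumes s: "sol \<nu> F V"
  shows "((\<lambda>r. V r / r) \<longlongrightarrow> \<alpha> * F 0 / real n) (at_right 0)"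
proof -
  define B where "B r = \<alpha> * F r - \<beta> * r * max 0 (V r) powr h - \<nu> * max 0 (V r) powr k" for r
  have Bc: "continuous_on {0..} B"
    unfolding B_def using solD(2,3)[OF s] h0 k0
    by (intro continuous_intros continuous_on_powr') auto
  have V0: "V 0 = 0" by (rule solD[OF s])
  have B0: "B 0 = \<alpha> * F 0" using V0 by (simp add: B_def)
  have n0: "real n > 0" using n1 by simp
  have ev: "eventually (\<lambda>r::real. r > 0) (at_right 0)" by (simp add: eventually_at_right_less)
  \<comment> \<open>L'Hopital for numerator and denominator multiplied by
    \<open>r ^ (n - 1)\<close>, which removes the singular term from the derivative.\<close>
  have "((\<lambda>r. (r ^ (n - 1) * V r) / r ^ n) \<longlongrightarrow> \<alpha> * F 0 / real n) (at_right 0)"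
  proof (rule lhopital_right_0)
    have "continuous_on {0..} (\<lambda>r. r ^ (n - 1) * V r)"
      using solD(3)[OF s] by (intro continuous_intros)
    from halfline_tendsto_at_right[OF this] V0
    show "((\<lambda>r. r ^ (n - 1) * V r) \<longlongrightarrow> 0) (at_right 0)" by simp
    have "continuous_on {0..} (\<lambda>r::real. r ^ n)" by (intro continuous_intros)
    from halfline_tendsto_at_right[OF this] n1
    show "((\<lambda>r::real. r ^ n) \<longlongrightarrow> 0) (at_right 0)" by (simp add: power_0_left)
    show "\<forall>\<^sub>F r::real in at_right 0. r ^ n \<noteq> 0"
      using ev by eventually_elim simp
    show "\<forall>\<^sub>F r::real in at_right 0. real n * r ^ (n - 1) \<noteq> 0"
      using ev by eventually_elim (use n1 in simp)
    show "\<forall>\<^sub>F r in at_right 0. DERIV (\<lambda>r. r ^ (n - 1) * V r) r :> r ^ (n - 1) * B r"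
      using ev
    proof eventually_elim
      case (elim r)
      show ?case by (rule radial_product_derivative[OF n1 elim]) (use solD(5)[OF s elim] in \<open>simp add: B_def\<close>)
    qed
    show "\<forall>\<^sub>F r::real in at_right 0. DERIV (\<lambda>r. r ^ n) r :> real n * r ^ (n - 1)"
      by (intro always_eventually allI) (auto intro!: derivative_eq_intros)
    have "((\<lambda>r. B r / real n) \<longlongrightarrow> \<alpha> * F 0 / real n) (at_right 0)"
      using halfline_tendsto_at_right[OF Bc] n0 unfolding B0 by (intro tendsto_intros) auto
    moreover have "\<forall>\<^sub>F r in at_right 0. B r / real n = r ^ (n - 1) * B r / (real n * r ^ (n - 1))"
      using ev by eventually_elim simp
    ultimately show "((\<lambda>r. r ^ (n - 1) * B r / (real n * r ^ (n - 1))) \<longlongrightarrow> \<alpha> * F 0 / real n) (at_right 0)"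
      by (rule Lim_transform_eventually)
  qed
  moreover have "\<forall>\<^sub>F r in at_right 0. (r ^ (n - 1) * V r) / r ^ n = V r / r"
    using ev
  proof eventually_elim
    case (elim r)
    have "r ^ n = r ^ (n - 1) * r" using n1 by (cases n) auto
    then show ?case using elim by simp
  qed
  ultimately show ?thesis by (rule Lim_transform_eventually)
qed

text \<open>
  As \<open>V ~ \<alpha> r / n\<close> and \<open>k < h + 1\<close>, the absorption \<open>\<nu> V^k\<close> is the leading correction in the equation for \<open>V\<close> at the origin.
\<close>

lemma profile_order_near_0:
  assumes s1: "sol \<nu>1 F1 V1" "F1 0 = 1" and s2: "sol \<nu>2 F2 V2" "F2 0 = 1" and \<nu>: "\<nu>1 < \<nu>2"
  shows "\<exists>d>0. \<forall>r. 0 < r \<longrightarrow> r < d \<longrightarrow> F1 r < F2 r"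
proof -
  have ev: "eventually (\<lambda>r::real. r > 0) (at_right 0)" by (simp add: eventually_at_right_less)
  define a where "a = \<alpha> / real n"
  have a: "a > 0" using \<alpha>0 n1 by (simp add: a_def)
  have pw0: "((\<lambda>r::real. r powr c) \<longlongrightarrow> 0) (at_right 0)" if "c > 0" for c
  proof -
    have "continuous_on {0..} (\<lambda>r::real. r powr c)" using that by (intro continuous_on_powr' continuous_intros) auto
    from halfline_tendsto_at_right[OF this] show ?thesis by simp
  qed
  have lim: "((\<lambda>r. max 0 (V r) powr j / r powr j) \<longlongrightarrow> a powr j) (at_right 0)"
    if "sol \<nu> F V" "F 0 = 1" for \<nu> F V j
  proof -
    have "((\<lambda>r. V r / r) \<longlongrightarrow> a) (at_right 0)"
      using flux_ratio_tendsto[OF that(1)] that(2) by (simp add: a_def)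
    then have "((\<lambda>r. max 0 (V r / r) powr j) \<longlongrightarrow> max 0 a powr j) (at_right 0)"
      by (intro tendsto_powr tendsto_max tendsto_const) (use a in simp_all)
    moreover have "\<forall>\<^sub>F r in at_right 0. max 0 (V r / r) powr j = max 0 (V r) powr j / r powr j"
      using ev
    proof eventually_elim
      case (elim r)
      have "max 0 (V r / r) = max 0 (V r) / r" using elim by (auto simp: max_def zero_le_divide_iff divide_le_0_iff)
      then show ?case using elim by (simp add: powr_divide)
    qed
    ultimately show ?thesis using a by (simp add: max_absorb2 Lim_transform_eventually)
  qed
  \<comment> \<open>\<open>F'\<close> is of order \<open>r^h\<close>, so \<open>F - 1\<close> is of
    order \<open>r^(h+1)\<close>, which is negligible against \<open>r^k\<close> because
    \<open>k < h + 1\<close>.\<close>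
  have F_lim: "((\<lambda>r. (F r - 1) / r powr k) \<longlongrightarrow> 0) (at_right 0)"
    if s: "sol \<nu> F V" "F 0 = 1" for \<nu> F V
  proof (rule lhopital_right_0)
    show "((\<lambda>r. F r - 1) \<longlongrightarrow> 0) (at_right 0)"
      using halfline_tendsto_at_right[OF solD(2)[OF s(1)]] s(2) by (intro LIM_zero) simp
    show "((\<lambda>r::real. r powr k) \<longlongrightarrow> 0) (at_right 0)" by (rule pw0[OF k0])
    show "\<forall>\<^sub>F r::real in at_right 0. r powr k \<noteq> 0" using ev by eventually_elim simp
    show "\<forall>\<^sub>F r::real in at_right 0. k * r powr (k - 1) \<noteq> 0" using ev by eventually_elim (use k0 in simp)
    show "\<forall>\<^sub>F r in at_right 0. DERIV (\<lambda>r. F r - 1) r :> - (max 0 (V r) powr h)"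
      using ev
    proof eventually_elim
      case (elim r)
      show ?case by (rule derivative_eq_intros solD(4)[OF s(1) elim] refl)+ simp
    qed
    show "\<forall>\<^sub>F r in at_right 0. DERIV (\<lambda>r. r powr k) r :> k * r powr (k - 1)"
      using ev by eventually_elim (rule has_real_derivative_powr)
    have "((\<lambda>r. - (max 0 (V r) powr h / r powr h) * r powr (h + 1 - k) / k) \<longlongrightarrow> - (a powr h) * 0 / k) (at_right 0)"
    proof (intro tendsto_divide tendsto_mult tendsto_minus tendsto_const)
      show "((\<lambda>r. max 0 (V r) powr h / r powr h) \<longlongrightarrow> a powr h) (at_right 0)" by (rule lim[OF s])
      show "((\<lambda>r::real. r powr (h + 1 - k)) \<longlongrightarrow> 0) (at_right 0)" by (rule pw0) (use kh in simp)
    qed (use k0 in simp)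
    moreover have "\<forall>\<^sub>F r in at_right 0. - (max 0 (V r) powr h / r powr h) * r powr (h + 1 - k) / k
        = - (max 0 (V r) powr h) / (k * r powr (k - 1))"
      using ev
    proof eventually_elim
      case (elim r)
      have "r powr h = r powr (h + 1 - k) * r powr (k - 1)" by (simp flip: powr_add)
      then show ?case using elim k0 by (simp add: field_simps)
    qed
    ultimately show "((\<lambda>r. - (max 0 (V r) powr h) / (k * r powr (k - 1))) \<longlongrightarrow> 0) (at_right 0)"
      by (simp add: Lim_transform_eventually)
  qed
  have r_lim: "((\<lambda>r. \<beta> * r * max 0 (V r) powr h / r powr k) \<longlongrightarrow> 0) (at_right 0)"
    if s: "sol \<nu> F V" "F 0 = 1" for \<nu> F V
  proof -
    have "((\<lambda>r. \<beta> * (max 0 (V r) powr h / r powr h) * r powr (h + 1 - k)) \<longlongrightarrow> \<beta> * (a powr h) * 0) (at_right 0)"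
      by (rule tendsto_mult[OF tendsto_mult[OF tendsto_const lim[OF s]] pw0]) (use kh in simp)
    moreover have "\<forall>\<^sub>F r in at_right 0. \<beta> * (max 0 (V r) powr h / r powr h) * r powr (h + 1 - k)
        = \<beta> * r * max 0 (V r) powr h / r powr k"
      using ev
    proof eventually_elim
      case (elim r)
      have "r powr (h + 1 - k) * r powr k * r powr k / r powr h = r powr (1 + k)"
        by (simp flip: powr_add powr_diff)
      also have "\<dots> = r * r powr k" using elim by (simp add: powr_add)
      finally show ?case using elim by (simp add: field_simps)
    qed
    ultimately show ?thesis by (simp add: Lim_transform_eventually)
  qed
  \<comment> \<open>The right-hand side without its singular part,
    \<open>(r^(n-1) V)' = r^(n-1) B\<close>; its expansion is \<alpha> minus
    \<open>\<nu> a^k r^k\<close> up to smaller terms.\<close>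
  define B where "B \<nu> F V r = \<alpha> * F r - \<beta> * r * max 0 (V r) powr h - \<nu> * max 0 (V r) powr k" for \<nu> F V and r :: real
  have B_lim: "((\<lambda>r. (B \<nu> F V r - \<alpha>) / r powr k) \<longlongrightarrow> - \<nu> * a powr k) (at_right 0)"
    if s: "sol \<nu> F V" "F 0 = 1" for \<nu> F V
  proof -
    have "((\<lambda>r. \<alpha> * ((F r - 1) / r powr k) - \<beta> * r * max 0 (V r) powr h / r powr k
        - \<nu> * (max 0 (V r) powr k / r powr k)) \<longlongrightarrow> \<alpha> * 0 - 0 - \<nu> * a powr k) (at_right 0)"
      by (rule tendsto_diff[OF tendsto_diff[OF tendsto_mult[OF tendsto_const F_lim[OF s]] r_lim[OF s]]
            tendsto_mult[OF tendsto_const lim[OF s]]])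
    moreover have "\<forall>\<^sub>F r in at_right 0. \<alpha> * ((F r - 1) / r powr k) - \<beta> * r * max 0 (V r) powr h / r powr k
        - \<nu> * (max 0 (V r) powr k / r powr k) = (B \<nu> F V r - \<alpha>) / r powr k"
      using ev by eventually_elim (simp add: B_def diff_divide_distrib right_diff_distrib)
    ultimately show ?thesis by (simp add: Lim_transform_eventually)
  qed
  have "((\<lambda>r. (B \<nu>1 F1 V1 r - \<alpha>) / r powr k - (B \<nu>2 F2 V2 r - \<alpha>) / r powr k)
      \<longlongrightarrow> - \<nu>1 * a powr k - (- \<nu>2 * a powr k)) (at_right 0)"
    by (rule tendsto_diff[OF B_lim[OF s1] B_lim[OF s2]])
  moreover have "- \<nu>1 * a powr k - (- \<nu>2 * a powr k) > 0" using a \<nu> by simp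
  ultimately have "\<forall>\<^sub>F r in at_right 0. (B \<nu>1 F1 V1 r - \<alpha>) / r powr k - (B \<nu>2 F2 V2 r - \<alpha>) / r powr k > 0"
    by (rule order_tendstoD(1))
  with ev have "\<forall>\<^sub>F r in at_right 0. B \<nu>1 F1 V1 r - B \<nu>2 F2 V2 r > 0"
  proof eventually_elim
    case (elim r)
    have "(B \<nu>1 F1 V1 r - \<alpha>) / r powr k - (B \<nu>2 F2 V2 r - \<alpha>) / r powr k
        = (B \<nu>1 F1 V1 r - B \<nu>2 F2 V2 r) / r powr k"
      by (simp flip: diff_divide_distrib)
    then show ?case using elim by (simp add: zero_less_divide_iff)
  qed
  moreover have "\<forall>\<^sub>F r in at_right 0. V1 r / r > 0"
    using flux_ratio_tendsto[OF s1(1)] a s1(2) by (intro order_tendstoD(1)) (auto simp: a_def)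
  ultimately have "\<forall>\<^sub>F r in at_right 0. B \<nu>1 F1 V1 r - B \<nu>2 F2 V2 r > 0 \<and> V1 r / r > 0"
    by (rule eventually_conj)
  then obtain d where d: "d > 0" "\<And>r. 0 < r \<Longrightarrow> r < d \<Longrightarrow> B \<nu>1 F1 V1 r - B \<nu>2 F2 V2 r > 0 \<and> V1 r / r > 0"
    by (auto simp: eventually_at_right_field)
  have Vlt: "V2 r < V1 r" if r: "0 < r" "r < d" for r
  proof -
    define G where "G r = r ^ (n - 1) * (V1 r - V2 r)" for r
    have "G 0 < G r"
    proof (rule DERIV_pos_imp_increasing_open[where f = G, OF r(1)])
      fix x assume x: "0 < x" "x < r"
      have "DERIV G x :> x ^ (n - 1) * (B \<nu>1 F1 V1 x - B \<nu>2 F2 V2 x)"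
        unfolding G_def
      proof (rule radial_product_derivative[OF n1 x(1)])
        show "DERIV (\<lambda>r. V1 r - V2 r) x :> B \<nu>1 F1 V1 x - B \<nu>2 F2 V2 x - (real n - 1) / x * (V1 x - V2 x)"
          using DERIV_diff[OF solD(5)[OF s1(1) x(1)] solD(5)[OF s2(1) x(1)]]
          by (rule back_subst[of "\<lambda>d. DERIV _ x :> d"]) (use x in \<open>simp add: B_def field_simps\<close>)
      qed
      moreover have "x ^ (n - 1) * (B \<nu>1 F1 V1 x - B \<nu>2 F2 V2 x) > 0"
        using d(2)[of x] x r by simp
      ultimately show "\<exists>y. DERIV G x :> y \<and> 0 < y" by blast
    next
      show "continuous_on {0..r} G"
        unfolding G_def using solD(3)[OF s1(1)] solD(3)[OF s2(1)]
        by (intro continuous_intros) (auto intro: continuous_on_subset)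
    qed
    moreover have "G 0 = 0" using solD(1)[OF s1(1)] solD(1)[OF s2(1)] by (simp add: G_def)
    ultimately have "0 < G r" by simp
    then have "0 < r ^ (n - 1) * (V1 r - V2 r)" unfolding G_def .
    then show ?thesis using r by (simp add: zero_less_mult_iff)
  qed
  have "F1 r < F2 r" if r: "0 < r" "r < d" for r
  proof -
    have "F2 0 - F1 0 < F2 r - F1 r"
    proof (rule DERIV_pos_imp_increasing_open[where f = "\<lambda>r. F2 r - F1 r", OF r(1)])
      fix x assume x: "0 < x" "x < r"
      have "V1 x > 0" "V2 x < V1 x" using d(2)[of x] Vlt[of x] x r by (auto simp: zero_less_divide_iff)
      then have "max 0 (V2 x) powr h < max 0 (V1 x) powr h" using h0 by (intro powr_less_mono2) auto
      then show "\<exists>y. DERIV (\<lambda>r. F2 r - F1 r) x :> y \<and> 0 < y"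
        using DERIV_diff[OF solD(4)[OF s2(1) x(1)] solD(4)[OF s1(1) x(1)]]
        by (intro exI[of _ "- (max 0 (V2 x) powr h) - - (max 0 (V1 x) powr h)"]) auto
    next
      show "continuous_on {0..r} (\<lambda>r. F2 r - F1 r)"
        using solD(2)[OF s1(1)] solD(2)[OF s2(1)]
        by (intro continuous_intros) (auto intro: continuous_on_subset)
    qed
    then show ?thesis using s1(2) s2(2) by simp
  qed
  then show ?thesis using d(1) by blast
qed

text \<open>If the slope reached 0, \<open>W\<close> would decrease from a value below
  \<open>wst\<close> to a limit in \<open>[0, wst)\<close>, which is excluded. So \<open>W\<close>
  increases; a finite limit must be \<open>wst\<close>, and divergence would force the slow rate of
  \<open>logsys_slow_decay\<close>, against \<open>fast\<close>.\<close>

lemma fast_decay_connection: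
  assumes s: "sol \<nu> F V" "F 0 = 1" and \<nu>: "\<nu> > 0" and pos: "\<And>r. r \<ge> 0 \<Longrightarrow> F r > 0"
    and fast: "((\<lambda>r. r powr (\<alpha> / \<beta>) * F r) \<longlongrightarrow> 0) at_top"
  shows "\<mu> * (exp (\<mu> * t) * F (exp t)) - (exp ((\<mu> - 1) * t) * V (exp t)) powr h > 0"
    and "((\<lambda>s. exp (\<mu> * s) * F (exp s)) \<longlongrightarrow> wst) at_top"
proof -
  note e0 = less_imp_le[OF \<nu>]
  define W where "W t = exp (\<mu> * t) * F (exp t)" for t
  define Z where "Z t = exp ((\<mu> - 1) * t) * V (exp t)" for t
  have Vpos: "V r > 0" if "r > 0" for r by (rule sol_positive_log(2)[OF s e0 pos that])
  have L: "logsys \<nu> UNIV W Z" unfolding W_def Z_def by (rule sol_positive_log(1)[OF s e0 pos])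
  obtain b where b: "\<And>t. t < b \<Longrightarrow> excess F V (exp t) > 0"
    using excess_positive_near_0[OF s] by blast
  have b': "slope W Z t > 0" if "t < b" for t
    unfolding W_def Z_def using b[OF that] Vpos by (subst slope_excess) auto
  have P: "slope W Z t > 0" for t
  proof (rule ccontr)
    assume "\<not> ?thesis"
    then have np: "slope W Z t \<le> 0" by simp
    obtain s0 where s0: "W s0 < wst" "\<And>t. t > s0 \<Longrightarrow> slope W Z t < 0"
      by (rule logsys_no_return[where b = b, OF L \<nu> _ UNIV_I np]) (use b' in auto)
    have dec: "W y \<le> W x" if "s0 \<le> x" "x \<le> y" for x y
    proof (rule DERIV_nonpos_imp_decreasing_open[where f = W, OF that(2)])
      show "\<exists>d. DERIV W z :> d \<and> d \<le> 0" if "x < z" for z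
        using logsysD(3)[OF L UNIV_I, of z] s0(2)[of z] that \<open>s0 \<le> x\<close>
        by (intro exI[of _ "slope W Z z"]) auto
      show "continuous_on {x..y} W" by (rule logsys_continuous(1)[OF L]) simp
    qed
    have "(\<exists>l. ((\<lambda>t. - W t) \<longlongrightarrow> l) at_top \<and> (\<forall>t\<ge>s0. - W t \<le> l)) \<or> filterlim (\<lambda>t. - W t) at_top at_top"
      by (rule mono_at_top_cases) (use dec in simp)
    moreover have "\<not> filterlim (\<lambda>t. - W t) at_top at_top"
    proof
      assume "filterlim (\<lambda>t. - W t) at_top at_top"
      then have "eventually (\<lambda>t. - W t \<ge> 0) at_top" unfolding filterlim_at_top by blast
      then obtain t where "- W t \<ge> 0" by (auto simp: eventually_at_top_linorder)
      then show False using logsysD(1)[OF L UNIV_I, of t] by simp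
    qed
    ultimately obtain l where l: "((\<lambda>t. - W t) \<longlongrightarrow> l) at_top" "\<And>t. t \<ge> s0 \<Longrightarrow> - W t \<le> l" by blast
    have lim: "(W \<longlongrightarrow> - l) at_top" using tendsto_minus[OF l(1)] by simp
    have "0 \<le> - l"
      by (rule tendsto_lowerbound[OF lim])
         (auto intro!: always_eventually less_imp_le logsysD(1)[OF L UNIV_I])
    moreover have "- l < wst" using l(2)[of s0] s0(1) by simp
    ultimately show False using logsys_limit_not_below[OF L e0 lim] by blast
  qed
  then show "\<mu> * (exp (\<mu> * t) * F (exp t)) - (exp ((\<mu> - 1) * t) * V (exp t)) powr h > 0"
    unfolding W_def Z_def by blast
  have inc: "W x \<le> W y" if "x \<le> y" for x y
    using logsys_increasing[OF L P, of x y] that by (cases "x = y") auto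
  have "(\<exists>l. (W \<longlongrightarrow> l) at_top \<and> (\<forall>t\<ge>0. W t \<le> l)) \<or> filterlim W at_top at_top"
    by (rule mono_at_top_cases) (rule inc)
  then have "(W \<longlongrightarrow> wst) at_top"
  proof
    assume "\<exists>l. (W \<longlongrightarrow> l) at_top \<and> (\<forall>t\<ge>0. W t \<le> l)"
    then obtain l where l: "(W \<longlongrightarrow> l) at_top" "W 0 \<le> l" by blast
    have "l \<ge> 0" using l(2) logsysD(1)[OF L UNIV_I, of 0] by simp
    then have "l = wst"
      using logsys_limit_not_below[OF L e0 l(1)] logsys_limit_not_above[OF L e0 l(1)] by force
    then show ?thesis using l by simp
  next
    assume "filterlim W at_top at_top"
    from logsys_slow_decay[OF L e0 this less_imp_le[OF P]]
    obtain c where c: "c > 0" "eventually (\<lambda>s. exp (- (\<mu> - \<alpha> / \<beta>) * s) * W s \<ge> c) at_top" by blast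
    have e: "exp (- (\<mu> - \<alpha> / \<beta>) * s) * W s = exp s powr (\<alpha> / \<beta>) * F (exp s)" for s
    proof -
      have "exp (- (\<mu> - \<alpha> / \<beta>) * s) * exp (\<mu> * s) = exp (\<alpha> / \<beta> * s)"
        by (subst exp_add[symmetric]) (simp add: algebra_simps)
      then show ?thesis by (simp add: W_def exp_powr_real mult.assoc[symmetric] mult.commute)
    qed
    have "((\<lambda>s. exp s powr (\<alpha> / \<beta>) * F (exp s)) \<longlongrightarrow> 0) at_top"
      by (rule filterlim_compose[OF fast exp_at_top])
    then have "eventually (\<lambda>s. exp s powr (\<alpha> / \<beta>) * F (exp s) < c) at_top"
      using c(1) by (rule order_tendstoD(2))
    with c(2) have "eventually (\<lambda>s::real. False) at_top"
      unfolding e by eventually_elim simp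
    then show ?thesis by simp
  qed
  then show "((\<lambda>s. exp (\<mu> * s) * F (exp s)) \<longlongrightarrow> wst) at_top" unfolding W_def .
qed

lemma fast_decay_absorption_unique:
  assumes s1: "sol \<nu>1 F1 V1" "F1 0 = 1" "\<And>r. r \<ge> 0 \<Longrightarrow> F1 r > 0"
      "((\<lambda>r. r powr (\<alpha> / \<beta>) * F1 r) \<longlongrightarrow> 0) at_top"
    and s2: "sol \<nu>2 F2 V2" "F2 0 = 1" "\<And>r. r \<ge> 0 \<Longrightarrow> F2 r > 0"
      "((\<lambda>r. r powr (\<alpha> / \<beta>) * F2 r) \<longlongrightarrow> 0) at_top"
    and \<nu>: "0 < \<nu>1" "\<nu>1 < \<nu>2"
  shows False
proof -
  have \<nu>2: "\<nu>2 > 0" using \<nu> by simp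
  note L1 = sol_positive_log(1)[OF s1(1,2) less_imp_le[OF \<nu>(1)] s1(3)]
  note L2 = sol_positive_log(1)[OF s2(1,2) less_imp_le[OF \<nu>2] s2(3)]
  note c1 = fast_decay_connection[OF s1(1,2) \<nu>(1) s1(3,4)]
  note c2 = fast_decay_connection[OF s2(1,2) \<nu>2 s2(3,4)]
  have lim0: "((\<lambda>s. F (exp (s + \<tau>))) \<longlongrightarrow> 1) at_bot" if "sol \<nu> F V" "F 0 = 1" for \<nu> F V \<tau>
  proof -
    have "filterlim (\<lambda>s::real. s + \<tau>) at_bot at_bot"
      unfolding filterlim_at_bot eventually_at_bot_linorder
    proof
      fix Z show "\<exists>N. \<forall>s\<le>N. s + \<tau> \<le> Z" by (intro exI[of _ "Z - \<tau>"]) simp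
    qed
    from filterlim_compose[OF exp_at_bot this]
    have "((\<lambda>s. exp (s + \<tau>)) \<longlongrightarrow> 0) at_bot" .
    then have "filterlim (\<lambda>s. exp (s + \<tau>)) (at_right 0) at_bot"
      by (auto simp: filterlim_at)
    from filterlim_compose[OF halfline_tendsto_at_right[OF solD(2)[OF that(1)]] this]
    show ?thesis using that(2) by simp
  qed
  show False
  proof (rule logsys_connection_unique[OF L1 L2 \<nu> c1(1) c2(1) c1(2) c2(2)])
    fix \<tau> :: real assume \<tau>: "\<tau> > 0"
    \<comment> \<open>Both profiles start at 1, so near minus infinity a translation by \<tau> gains
      the factor \<open>exp (\<mu> * \<tau>) > 1\<close>. The summand 0 only matches
      \<open>lim0\<close>.\<close>
    have "((\<lambda>s. exp (\<mu> * \<tau>) * F1 (exp (s + \<tau>)) - F2 (exp (s + 0))) \<longlongrightarrow> exp (\<mu> * \<tau>) * 1 - 1) at_bot"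
      by (intro tendsto_intros lim0[OF s1(1,2)] lim0[OF s2(1,2)])
    moreover have "exp (\<mu> * \<tau>) * 1 - 1 > 0" using \<tau> \<mu>1 by simp
    ultimately have "eventually (\<lambda>s. exp (\<mu> * \<tau>) * F1 (exp (s + \<tau>)) - F2 (exp (s + 0)) > 0) at_bot"
      by (rule order_tendstoD(1))
    then show "eventually (\<lambda>s. exp (\<mu> * (s + \<tau>)) * F1 (exp (s + \<tau>)) > exp (\<mu> * s) * F2 (exp s)) at_bot"
    proof eventually_elim
      case (elim s)
      have "exp (\<mu> * s) * F2 (exp s) < exp (\<mu> * s) * (exp (\<mu> * \<tau>) * F1 (exp (s + \<tau>)))"
        using elim by simp
      then show ?case by (simp add: distrib_left exp_add mult.assoc)
    qed
  next
    obtain d where d: "d > 0" "\<And>r. 0 < r \<Longrightarrow> r < d \<Longrightarrow> F1 r < F2 r"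
      using profile_order_near_0[OF s1(1,2) s2(1,2) \<nu>(2)] by blast
    have "exp s < d" if "s \<le> ln d - 1" for s
    proof -
      have "exp s < exp (ln d)" using that by (subst exp_less_cancel_iff) simp
      then show ?thesis using d by simp
    qed
    then show "eventually (\<lambda>s. exp (\<mu> * s) * F1 (exp s) < exp (\<mu> * s) * F2 (exp s)) at_bot"
      unfolding eventually_at_bot_linorder using d(2) by (intro exI[of _ "ln d - 1"]) auto
  qed
qed

end

section \<open>Profiles\<close>

text \<open>L'Hopital for the difference quotient; this spares any separate computation of
  derivatives at the origin.\<close>

lemma halfline_derivative_at_0:
  fixes f g :: "real \<Rightarrow> real"
  assumes f: "continuous_on {0..} f" and d: "\<And>r. r > 0 \<Longrightarrow> DERIV f r :> g r"
    and lim: "(g \<longlongrightarrow> l) (at_right 0)"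
  shows "(f has_real_derivative l) (at 0 within {0..})"
proof -
  have ev: "eventually (\<lambda>r::real. r > 0) (at_right 0)" by (simp add: eventually_at_right_less)
  have "((\<lambda>r. (f r - f 0) / r) \<longlongrightarrow> l) (at_right 0)"
  proof (rule lhopital_right_0)
    show "((\<lambda>r. f r - f 0) \<longlongrightarrow> 0) (at_right 0)"
      using halfline_tendsto_at_right[OF f] by (rule LIM_zero)
    show "((\<lambda>r::real. r) \<longlongrightarrow> 0) (at_right 0)" by (rule tendsto_ident_at)
    show "\<forall>\<^sub>F r::real in at_right 0. r \<noteq> 0" using ev by eventually_elim simp
    show "\<forall>\<^sub>F r::real in at_right 0. (1::real) \<noteq> 0" by simp
    show "\<forall>\<^sub>F r in at_right 0. DERIV (\<lambda>r. f r - f 0) r :> g r"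
      using ev
    proof eventually_elim
      case (elim r)
      show ?case by (rule derivative_eq_intros d[OF elim] refl)+ simp
    qed
    show "\<forall>\<^sub>F r::real in at_right 0. DERIV (\<lambda>r. r) r :> 1" by simp
    show "((\<lambda>r. g r / 1) \<longlongrightarrow> l) (at_right 0)" using lim by simp
  qed
  then show ?thesis by (simp add: has_field_derivative_iff at_within_Ici_at_right)
qed

lemma halfline_not_bot: "(r::real) \<ge> 0 \<Longrightarrow> at r within {0..} \<noteq> bot"
  using at_within_Ici_at_right[of r] at_le[of "{r..}" "{0..}" r] trivial_limit_at_right_real[of r]
  by (metis atLeast_subset_iff bot.extremum_uniqueI)

lemma deriv_halfline_eqI:
  assumes "r \<ge> 0" "(f has_real_derivative d) (at r within {0..})"
  shows "deriv_halfline f r = d"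
  unfolding deriv_halfline_def
  using assms halfline_not_bot[OF assms(1)]
  by (intro vector_derivative_within) (auto simp: has_real_derivative_iff_has_vector_derivative)

lemma C1_halflineI:
  assumes f: "continuous_on {0..} f" and g: "continuous_on {0..} g"
    and d: "\<And>r. r > 0 \<Longrightarrow> DERIV f r :> g r"
  shows "C1_halfline f" and "\<And>r. r \<ge> 0 \<Longrightarrow> deriv_halfline f r = g r"
proof -
  have der: "(f has_real_derivative g r) (at r within {0..})" if "r \<ge> 0" for r
  proof (cases "r = 0")
    case True
    then show ?thesis using halfline_derivative_at_0[OF f d halfline_tendsto_at_right[OF g]] by simp
  next
    case False
    then show ?thesis using d[of r] that by (simp add: has_field_derivative_at_within)
  qed
  show eq: "deriv_halfline f r = g r" if "r \<ge> 0" for r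
    by (rule deriv_halfline_eqI[OF that der[OF that]])
  have "f differentiable_on {0..}"
    unfolding differentiable_on_def using der
    by (auto intro: real_differentiable_def[THEN iffD2] exI)
  moreover have "continuous_on {0..} (deriv_halfline f)"
    using g by (rule continuous_on_cong[THEN iffD1, rotated 2]) (simp_all add: eq)
  ultimately show "C1_halfline f" by (simp add: C1_halfline_def)
qed

lemma C1_halflineD:
  assumes "C1_halfline f"
  shows "continuous_on {0..} f" and "continuous_on {0..} (deriv_halfline f)"
    and "\<And>r. r > 0 \<Longrightarrow> DERIV f r :> deriv_halfline f r"
proof -
  have d: "f differentiable_on {0..}" using assms by (simp add: C1_halfline_def)
  show "continuous_on {0..} f" by (rule differentiable_imp_continuous_on[OF d])
  show "continuous_on {0..} (deriv_halfline f)" using assms by (simp add: C1_halfline_def)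
  show "DERIV f r :> deriv_halfline f r" if "r > 0" for r
  proof -
    have "f differentiable (at r within {0..})" using d that by (simp add: differentiable_on_def)
    then have "(f has_real_derivative deriv_halfline f r) (at r within {0..})"
      by (simp add: deriv_halfline_def vector_derivative_works has_real_derivative_iff_has_vector_derivative)
    moreover have "at r within {0..} = at r" by (rule at_within_interior) (use that in simp)
    ultimately show ?thesis by simp
  qed
qed

section \<open>From the exponents \<open>p\<close>, \<open>q\<close> to the system and back\<close>

locale profile_exponents =
  fixes N :: nat and p q :: real
  assumes N1: "N \<ge> 1" and p_low: "2 * real N / (real N + 1) < p" and p2: "p < 2"
    and q_low: "p / 2 < q" and q_high: "q < p - real N / (real N + 1)"
begin

lemma p1: "p > 1"
proof -
  have "1 \<le> 2 * real N / (real N + 1)" using N1 by (simp add: field_simps)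
  then show ?thesis using p_low by linarith
qed

lemma q_bounds: "q > p - 1" "q < p" "2 * q - p > 0" "q - p + 1 > 0" "q > 0"
proof -
  have "real N / (real N + 1) > 0" using N1 by simp
  then show "q < p" using q_high by linarith
  show "q > p - 1" "2 * q - p > 0" "q - p + 1 > 0" "q > 0" using q_low p2 p1 by linarith+
qed

lemma mu_beta_alpha: "mu_exp p * beta_exp p q - alpha_exp p q = 1 / (2 - p)"
  using q_bounds(3) p2 unfolding mu_exp_def beta_exp_def alpha_exp_def
  by (simp add: divide_simps) (simp add: algebra_simps)

sublocale profile_params N "1 / (p - 1)" "q / (p - 1)" "alpha_exp p q" "beta_exp p q" "mu_exp p"
proof
  note qb = q_bounds
  show "N \<ge> 1" by (rule N1)
  show "1 < 1 / (p - 1)" using p1 p2 by simp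
  show "1 < q / (p - 1)" using p1 qb by simp
  have "1 / (p - 1) + 1 = p / (p - 1)" using p1 by (simp add: field_simps)
  then show "q / (p - 1) < 1 / (p - 1) + 1" using p1 qb by (simp add: divide_strict_right_mono)
  show "0 < alpha_exp p q" "0 < beta_exp p q" using qb by (auto simp: alpha_exp_def beta_exp_def)
  have "(p - q) * (real N + 1) > real N" using q_high by (simp add: field_simps)
  then have "real N * (q - p + 1) < p - q" by (simp add: algebra_simps)
  then show "real N * beta_exp p q < alpha_exp p q"
    using qb by (simp add: alpha_exp_def beta_exp_def divide_strict_right_mono)
  have "0 < 1 / (2 - p)" using p2 by simp
  then show "alpha_exp p q < mu_exp p * beta_exp p q" using mu_beta_alpha by linarith
  have "2 * real N < p * (real N + 1)" using p_low by (simp add: field_simps)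
  then show "real N < mu_exp p" using p2 by (simp add: mu_exp_def field_simps)
  have m: "mu_exp p - 1 = 2 * (p - 1) / (2 - p)" "mu_exp p + 1 = 2 / (2 - p)"
    using p2 by (simp_all add: mu_exp_def field_simps)
  show "(mu_exp p - 1) * (1 / (p - 1)) = mu_exp p + 1"
  proof -
    define d where "d = p - 1"
    have "d \<noteq> 0" using p1 by (simp add: d_def)
    then show ?thesis unfolding m d_def[symmetric] by simp
  qed
  have "(mu_exp p + 1) * (q / (p - 1)) / (1 / (p - 1)) = 2 * q / (2 - p)"
    unfolding m using p1 by simp
  moreover have "mu_exp p < 2 * q / (2 - p)"
    using p2 qb by (simp add: mu_exp_def divide_strict_right_mono)
  ultimately show "mu_exp p < (mu_exp p + 1) * (q / (p - 1)) / (1 / (p - 1))" by simp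
qed

abbreviation (input) "A \<equiv> alpha_exp p q"
abbreviation (input) "B \<equiv> beta_exp p q"
abbreviation (input) "m \<equiv> mu_exp p"

lemma w_star_eq: "w_star N p q = wst"
proof -
  have "1 - 1 / (1 / (p - 1)) = 2 - p" by simp
  then show ?thesis by (simp add: w_star_def wst_def)
qed

lemma flux_power: "v > 0 \<Longrightarrow> \<bar>- (v powr (1 / (p - 1)))\<bar> powr (p - 2) * - (v powr (1 / (p - 1))) = - v"
proof -
  assume v: "v > 0"
  have "(v powr (1 / (p - 1))) powr (p - 2) * v powr (1 / (p - 1)) = v powr (1 / (p - 1) * (p - 2) + 1 / (p - 1))"
    by (simp add: powr_powr powr_add)
  also have "1 / (p - 1) * (p - 2) + 1 / (p - 1) = 1" using p1 by (simp add: field_simps)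
  finally show ?thesis using v by simp
qed

lemma derivative_of_flux: "\<bar>\<bar>d\<bar> powr (p - 2) * d\<bar> powr (1 / (p - 1)) = \<bar>d\<bar>"
proof (cases "d = 0")
  case False
  have "\<bar>\<bar>d\<bar> powr (p - 2) * d\<bar> = \<bar>d\<bar> powr (p - 1)"
    using False by (simp add: abs_mult powr_diff powr_mult_base power2_eq_square field_simps)
  then show ?thesis using False p1 by (simp add: powr_powr)
qed simp

text \<open>The delicate point is that the flux is continuously differentiable up to 0, where its
  derivative contains the singular quotient \<open>v r / r\<close>;
  \<open>flux_ratio_tendsto\<close> supplies the limit.\<close>

lemma profile_of_sol:
  assumes s: "sol 1 f v" and f: "\<And>r. r \<ge> 0 \<Longrightarrow> f r > 0"
  shows "profile_solution N p q f" and "deriv_halfline f 0 = 0"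
proof -
  have v0: "v 0 = 0" by (rule solD[OF s])
  have vpos: "v r > 0" if "r > 0" for r
    by (rule sol_flux_positive[OF s, of r]) (use that f in auto)
  define g where "g r = - (max 0 (v r) powr (1 / (p - 1)))" for r
  have gc: "continuous_on {0..} g"
    unfolding g_def using solD(3)[OF s] p1 by (intro continuous_intros continuous_on_powr') auto
  have dg: "DERIV f r :> g r" if "r > 0" for r
    unfolding g_def by (rule solD(4)[OF s that])
  have C1: "C1_halfline f" by (rule C1_halflineI(1)[OF solD(2)[OF s] gc]) (rule dg)
  have fD: "deriv_halfline f r = g r" if "r \<ge> 0" for r
    by (rule C1_halflineI(2)[OF solD(2)[OF s] gc _ that]) (rule dg)
  have flux: "p_flux p f r = - v r" if "r \<ge> 0" for r
  proof (cases "r = 0")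
    case True
    then show ?thesis using fD[of 0] v0 by (simp add: p_flux_def g_def)
  next
    case False
    then have "v r > 0" using vpos that by simp
    then show ?thesis unfolding p_flux_def fD[OF that] g_def using flux_power by (simp add: max_absorb2)
  qed
  define w where "w r = A * f r - B * r * max 0 (v r) powr (1 / (p - 1))
     - 1 * max 0 (v r) powr (q / (p - 1)) - (real N - 1) / r * v r" for r
  \<comment> \<open>The value at 0 is forced by
    \<open>A f 0 - (N - 1) * (A f 0 / N) = A f 0 / N\<close>.\<close>
  define W where "W r = (if r = 0 then - (A * f 0 / real N) else - w r)" for r
  have n0: "real N > 0" using N1 by simp
  have "(w \<longlongrightarrow> A * f 0 - B * 0 * max 0 (v 0) powr (1 / (p - 1))
     - 1 * max 0 (v 0) powr (q / (p - 1)) - (real N - 1) * (A * f 0 / real N)) (at_right 0)"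
  proof -
    have c: "continuous_on {0..} (\<lambda>r. A * f r - B * r * max 0 (v r) powr (1 / (p - 1))
     - 1 * max 0 (v r) powr (q / (p - 1)))"
      using solD(2,3)[OF s] h0 k0 by (intro continuous_intros continuous_on_powr') auto
    have "w = (\<lambda>r. A * f r - B * r * max 0 (v r) powr (1 / (p - 1))
     - 1 * max 0 (v r) powr (q / (p - 1)) - (real N - 1) * (v r / r))"
      by (simp add: w_def fun_eq_iff)
    then show ?thesis
      using tendsto_diff[OF halfline_tendsto_at_right[OF c] tendsto_mult[OF tendsto_const flux_ratio_tendsto[OF s]]]
      by simp
  qed
  then have wl: "(w \<longlongrightarrow> A * f 0 / real N) (at_right 0)"
    using n0 v0 p1 by (simp add: field_simps)
  have Wc: "continuous_on {0..} W"
    unfolding continuous_on_def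
  proof
    fix r :: real assume r: "r \<in> {0..}"
    show "(W \<longlongrightarrow> W r) (at r within {0..})"
    proof (cases "r = 0")
      case True
      have "((\<lambda>r. - w r) \<longlongrightarrow> W 0) (at_right 0)" using tendsto_minus[OF wl] by (simp add: W_def)
      moreover have "\<forall>\<^sub>F r in at_right 0. - w r = W r"
        using eventually_at_right_less[of "0::real"] by eventually_elim (simp add: W_def)
      ultimately have "(W \<longlongrightarrow> W 0) (at_right 0)" by (rule Lim_transform_eventually)
      then show ?thesis using True by (simp add: at_within_Ici_at_right)
    next
      case False
      then have r0: "r > 0" using r by simp
      have "continuous_on {0<..} (\<lambda>r. - w r)"
        unfolding w_def using solD(2,3)[OF s] h0 k0
        by (intro continuous_intros continuous_on_powr') (auto intro: continuous_on_subset)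
      then have "continuous_on {0<..} W"
        by (rule continuous_on_cong[THEN iffD1, rotated 2]) (auto simp: W_def)
      then have "isCont W r" using r0 by (simp add: continuous_on_eq_continuous_at)
      then show ?thesis
        using continuous_at_imp_continuous_at_within[of r W "{0..}"] by (simp add: continuous_within)
    qed
  qed
  have "continuous_on {0..} (\<lambda>r. - v r)" using solD(3)[OF s] by (intro continuous_intros)
  then have fc: "continuous_on {0..} (p_flux p f)"
    by (rule continuous_on_cong[THEN iffD1, rotated 2]) (auto simp: flux)
  have fd: "DERIV (p_flux p f) r :> W r" if r: "r > 0" for r
  proof -
    have "DERIV (\<lambda>r. - v r) r :> W r"
      using DERIV_minus[OF solD(5)[OF s r]] r by (simp add: W_def w_def)
    then show ?thesis
    proof (rule DERIV_cong_ev[THEN iffD1, rotated 3, OF _ refl _ refl])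
      show "\<forall>\<^sub>F x in nhds r. - v x = p_flux p f x"
        using eventually_nhds_in_open[of "{0<..}" r] r by (auto elim!: eventually_mono simp: flux)
    qed
  qed
  have C1': "C1_halfline (p_flux p f)" by (rule C1_halflineI(1)[OF fc Wc]) (rule fd)
  have flD: "deriv_halfline (p_flux p f) r = W r" if "r \<ge> 0" for r
    by (rule C1_halflineI(2)[OF fc Wc _ that]) (rule fd)
  have "deriv_halfline (p_flux p f) r + (real N - 1) / r * p_flux p f r
            + A * f r + B * r * deriv_halfline f r
            - \<bar>deriv_halfline f r\<bar> powr q = 0" if r: "r > 0" for r
  proof -
    have "\<bar>g r\<bar> powr q = max 0 (v r) powr (q / (p - 1))" by (simp add: g_def powr_powr)
    then show ?thesis
      using r flD[of r] fD[of r] flux[of r] by (simp add: W_def w_def g_def)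
  qed
  then show "profile_solution N p q f"
    unfolding profile_solution_def using C1 C1' by blast
  show "deriv_halfline f 0 = 0" using fD[of 0] v0 by (simp add: g_def)
qed

text \<open>Since \<open>sol\<close> cuts the powers off at 0, a nonnegative profile must first be
  shown to be nonincreasing, that is \<open>v \<ge> 0\<close>; here the absorption is still active
  at negative \<open>v\<close>.\<close>

lemma sol_of_profile:
  assumes prof: "profile_solution N p q f" and nn: "\<And>r. r \<ge> 0 \<Longrightarrow> f r \<ge> 0" and d0: "deriv_halfline f 0 = 0"
  shows "sol 1 f (\<lambda>r. - p_flux p f r)"
proof -
  define v where "v r = - p_flux p f r" for r
  define D where "D = deriv_halfline f"
  have C: "C1_halfline f" "C1_halfline (p_flux p f)"
    and eq: "\<And>r. r > 0 \<Longrightarrow> deriv_halfline (p_flux p f) r + (real N - 1) / r * p_flux p f r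
            + A * f r + B * r * deriv_halfline f r
            - \<bar>deriv_halfline f r\<bar> powr q = 0"
    using prof unfolding profile_solution_def by auto
  note f = C1_halflineD[OF C(1)] and P = C1_halflineD[OF C(2)]
  have vc: "continuous_on {0..} v" unfolding v_def using P(1) by (intro continuous_intros)
  have absD: "\<bar>D r\<bar> = \<bar>v r\<bar> powr (1 / (p - 1))" for r
    using derivative_of_flux[of "D r"] by (simp add: v_def D_def p_flux_def)
  have sgnD: "v r \<ge> 0 \<Longrightarrow> D r \<le> 0" "v r < 0 \<Longrightarrow> D r > 0" for r
    by (auto simp: v_def D_def p_flux_def zero_le_mult_iff mult_le_0_iff zero_less_mult_iff)
  have v0: "v 0 = 0" using d0 by (simp add: v_def p_flux_def)
  have dv: "DERIV v r :> A * f r + B * r * D r - \<bar>D r\<bar> powr q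
      - (real N - 1) / r * v r" if r: "r > 0" for r
  proof -
    have "- deriv_halfline (p_flux p f) r = A * f r + B * r * D r - \<bar>D r\<bar> powr q
      - (real N - 1) / r * v r"
      using eq[OF r] by (simp add: v_def D_def)
    then show ?thesis using DERIV_minus[OF P(3)[OF r]] unfolding v_def by simp
  qed
  have vnn: "v r \<ge> 0" if r: "r \<ge> 0" for r
  proof (rule ccontr)
    assume "\<not> v r \<ge> 0"
    then have neg: "v r < 0" by simp
    have c0: "continuous_on {0..r} v" by (rule continuous_on_subset[OF vc]) auto
    obtain c where c: "0 \<le> c" "c < r" "v c = 0" "\<And>t. c < t \<Longrightarrow> t \<le> r \<Longrightarrow> v t < 0"
      using last_zero_to_neg[OF r c0 _ neg] v0 by auto
    have "compact (v ` {0..r})" by (intro compact_continuous_image c0) auto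
    then obtain B0 where B0: "\<And>t. 0 \<le> t \<Longrightarrow> t \<le> r \<Longrightarrow> \<bar>v t\<bar> \<le> B0"
      by (force dest!: compact_imp_bounded simp: bounded_iff)
    define kk where "kk = q / (p - 1)"
    have kk: "kk > 1" using k1 by (simp add: kk_def)
    \<comment> \<open>As \<open>kk > 1\<close>, the absorption is at most
      \<open>K * \<bar>v\<bar>\<close> on a bounded range. Where \<open>v < 0\<close> the product
      \<open>exp (- K * t) * v t\<close> is then nondecreasing, so \<open>v\<close> cannot descend
      from its last zero.\<close>
    define K where "K = B0 powr (kk - 1)"
    have "exp (- K * c) * v c \<le> exp (- K * r) * v r"
    proof (rule DERIV_nonneg_imp_increasing_open[where f = "\<lambda>t. exp (- K * t) * v t"])
      fix x assume x: "c < x" "x < r"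
      have x0: "x > 0" using x c by simp
      have vx: "v x < 0" using c(4)[of x] x by simp
      define v' where "v' = A * f x + B * x * D x - \<bar>D x\<bar> powr q - (real N - 1) / x * v x"
      have "\<bar>D x\<bar> powr q = \<bar>v x\<bar> powr kk" unfolding absD by (simp add: kk_def powr_powr)
      also have "\<dots> = \<bar>v x\<bar> powr (kk - 1) * \<bar>v x\<bar>" using vx by (simp add: powr_diff)
      also have "\<dots> \<le> K * \<bar>v x\<bar>"
        unfolding K_def using B0[of x] x x0 kk by (intro mult_right_mono powr_mono2) auto
      finally have "\<bar>D x\<bar> powr q \<le> - K * v x" using vx by simp
      moreover have "A * f x \<ge> 0" using nn[of x] x0 \<alpha>0 by simp
      moreover have "B * x * D x \<ge> 0" using sgnD(2)[OF vx] x0 \<beta>0 by simp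
      moreover have "(real N - 1) / x * v x \<le> 0" using x0 N1 vx by (intro mult_nonneg_nonpos) auto
      ultimately have "v' - K * v x \<ge> 0" unfolding v'_def by linarith
      then have "exp (- K * x) * (v' - K * v x) \<ge> 0" by simp
      moreover have "DERIV (\<lambda>t. exp (- K * t) * v t) x :> exp (- K * x) * (v' - K * v x)"
        by (rule derivative_eq_intros dv[OF x0] refl)+ (simp add: v'_def algebra_simps)
      ultimately show "\<exists>y. DERIV (\<lambda>t. exp (- K * t) * v t) x :> y \<and> 0 \<le> y" by blast
    next
      show "continuous_on {c..r} (\<lambda>t. exp (- K * t) * v t)"
        using c by (intro continuous_intros continuous_on_subset[OF c0]) auto
    qed (use c in simp)
    then show False using c neg by (simp add: zero_le_mult_iff)
  qed
  have Dv: "D r = - (max 0 (v r) powr (1 / (p - 1)))" if "r \<ge> 0" for r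
    using absD[of r] sgnD(1)[OF vnn[OF that]] vnn[OF that] by (simp add: max_absorb2)
  have "sol 1 f v"
    unfolding sol_def
  proof (intro conjI allI impI)
    fix r :: real assume r: "r > 0"
    show "DERIV f r :> - (max 0 (v r) powr (1 / (p - 1)))"
      using f(3)[OF r] Dv[of r] r by (simp add: D_def)
    have "\<bar>D r\<bar> powr q = max 0 (v r) powr (q / (p - 1))"
      using Dv[of r] r by (simp add: powr_powr)
    then show "DERIV v r :> A * f r - B * r * max 0 (v r) powr (1 / (p - 1))
        - 1 * max 0 (v r) powr (q / (p - 1)) - (real N - 1) / r * v r"
      using dv[OF r] Dv[of r] r by simp
  qed (use v0 vc f(1) in auto)
  then show ?thesis unfolding v_def .
qed

text \<open>Scaling trades the unknown value at the origin for an unknown coefficient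
  \<open>b powr - \<kappa>\<close>, the form in which uniqueness was proved.\<close>

lemma fast_decay_profile_normalise:
  assumes g: "fast_decay_profile N p q g"
  obtains b V where "b > 0" "sol (b powr - \<kappa>) (\<lambda>r. b powr m * g (b * r)) V"
    "b powr m * g 0 = 1" "\<And>r. r \<ge> 0 \<Longrightarrow> b powr m * g (b * r) > 0"
    "((\<lambda>r. r powr (A / B) * (b powr m * g (b * r))) \<longlongrightarrow> 0) at_top"
proof -
  have prof: "profile_solution N p q g" and nn: "\<And>r. r \<ge> 0 \<Longrightarrow> g r \<ge> 0"
    and ex: "\<exists>r\<ge>0. g r \<noteq> 0" and d0: "deriv_halfline g 0 = 0"
    and lim: "((\<lambda>r. r powr ((p - q) / (q - p + 1)) * g r) \<longlongrightarrow> 0) at_top"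
    using g unfolding fast_decay_profile_def by auto
  define v where "v r = - p_flux p g r" for r
  have s: "sol 1 g v" unfolding v_def by (rule sol_of_profile[OF prof nn d0])
  have dec: "g r \<le> g 0" if "r \<ge> 0" for r
  proof (rule DERIV_nonpos_imp_decreasing_open[where f = g, OF that])
    show "\<exists>y. DERIV g x :> y \<and> y \<le> 0" if "0 < x" for x
      using solD(4)[OF s that] by (intro exI[of _ "- (max 0 (v x) powr (1 / (p - 1)))"]) auto
    show "continuous_on {0..r} g" by (rule continuous_on_subset[OF solD(2)[OF s]]) auto
  qed
  obtain r0 where "r0 \<ge> 0" "g r0 \<noteq> 0" using ex by blast
  then have g0: "g 0 > 0" using dec[of r0] nn[of r0] by simp
  have pos: "g r > 0" if r: "r \<ge> 0" for r
  proof (rule ccontr)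
    assume "\<not> ?thesis"
    then have ge: "- g r \<ge> 0" by simp
    have "continuous_on {0..r} (\<lambda>t. - g t)"
      by (intro continuous_intros continuous_on_subset[OF solD(2)[OF s]]) auto
    then obtain c where c: "0 < c" "c \<le> r" "- g c = 0" "\<And>t. 0 \<le> t \<Longrightarrow> t < c \<Longrightarrow> - g t < 0"
      using first_zero_from_neg[of 0 r "\<lambda>t. - g t"] r ge g0 by auto
    have Vc: "v c > 0" by (rule sol_flux_positive[OF s, of c]) (use c in auto)
    \<comment> \<open>A zero of the nonnegative \<open>g\<close> is a local minimum, whereas the
      flux there is positive.\<close>
    have "- (max 0 (v c) powr (1 / (p - 1))) = 0"
      by (rule DERIV_local_min[OF solD(4)[OF s c(1)] c(1)]) (use c nn in \<open>auto simp: abs_less_iff\<close>)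
    then show False using Vc by simp
  qed
  define b where "b = g 0 powr (- 1 / m)"
  have b: "b > 0" using g0 by (simp add: b_def)
  have "b powr m = g 0 powr (- 1 / m * m)" unfolding b_def by (rule powr_powr)
  also have "- 1 / m * m = - 1" using \<mu>1 by simp
  finally have bm: "b powr m = 1 / g 0" using g0 by (simp add: powr_minus_divide)
  have ab: "A / B = (p - q) / (q - p + 1)"
    using q_bounds by (simp add: alpha_exp_def beta_exp_def)
  define c where "c = A / B"
  show ?thesis
  proof (rule that[OF b])
    show "sol (b powr - \<kappa>) (\<lambda>r. b powr m * g (b * r)) (\<lambda>r. b powr (m - 1) * v (b * r))"
      using sol_scale[OF s b] by simp
    show "b powr m * g 0 = 1" using bm g0 by simp
    show "b powr m * g (b * r) > 0" if "r \<ge> 0" for r using pos[of "b * r"] b that by simp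
    have "filterlim (\<lambda>r. b * r) at_top at_top"
      using b by (intro filterlim_tendsto_pos_mult_at_top[OF tendsto_const _ filterlim_ident])
    from filterlim_compose[OF lim this]
    have "((\<lambda>r. (b * r) powr c * g (b * r)) \<longlongrightarrow> 0) at_top" by (simp add: c_def ab)
    from tendsto_mult[OF tendsto_const[of "b powr (m - c)"] this]
    have "((\<lambda>r. b powr (m - c) * ((b * r) powr c * g (b * r))) \<longlongrightarrow> 0) at_top" by simp
    moreover have "b powr (m - c) * ((b * r) powr c * g (b * r)) = r powr c * (b powr m * g (b * r))" for r
      using b by (simp add: powr_mult powr_diff)
    ultimately show "((\<lambda>r. r powr (A / B) * (b powr m * g (b * r))) \<longlongrightarrow> 0) at_top"
      unfolding c_def by (simp only:)
  qed
qed

text \<open>Equal coefficients force equal scalings, because \<open>b powr - \<kappa>\<close>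
  determines \<open>b\<close>; the rescaled profiles then solve the same initial value
  problem.\<close>

lemma fast_decay_profile_unique:
  assumes f: "fast_decay_profile N p q f" and g: "fast_decay_profile N p q g" and r: "r \<ge> 0"
  shows "g r = f r"
proof -
  obtain b V where b: "b > 0" "sol (b powr - \<kappa>) (\<lambda>r. b powr m * f (b * r)) V"
    "b powr m * f 0 = 1" "\<And>r. r \<ge> 0 \<Longrightarrow> b powr m * f (b * r) > 0"
    "((\<lambda>r. r powr (A / B) * (b powr m * f (b * r))) \<longlongrightarrow> 0) at_top"
    by (rule fast_decay_profile_normalise[OF f]) (rule that)
  obtain c U where c: "c > 0" "sol (c powr - \<kappa>) (\<lambda>r. c powr m * g (c * r)) U"
    "c powr m * g 0 = 1" "\<And>r. r \<ge> 0 \<Longrightarrow> c powr m * g (c * r) > 0"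
    "((\<lambda>r. r powr (A / B) * (c powr m * g (c * r))) \<longlongrightarrow> 0) at_top"
    by (rule fast_decay_profile_normalise[OF g]) (rule that)
  have b0: "b powr m * f (b * 0) = 1" and c0: "c powr m * g (c * 0) = 1" using b c by auto
  have eps: "b powr - \<kappa> > 0" "c powr - \<kappa> > 0" using b c by auto
  have "\<not> b powr - \<kappa> < c powr - \<kappa>"
    using fast_decay_absorption_unique[OF b(2) b0 b(4,5) c(2) c0 c(4,5) eps(1)] by blast
  moreover have "\<not> c powr - \<kappa> < b powr - \<kappa>"
    using fast_decay_absorption_unique[OF c(2) c0 c(4,5) b(2) b0 b(4,5) eps(2)] by blast
  ultimately have e: "b powr - \<kappa> = c powr - \<kappa>" by simp
  have bc: "b = c"
  proof -
    have "(b powr - \<kappa>) powr (- 1 / \<kappa>) = (c powr - \<kappa>) powr (- 1 / \<kappa>)" using e by simp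
    then show ?thesis using b(1) c(1) \<kappa>0 by (simp add: powr_powr)
  qed
  have "b powr m * f (b * (r / b)) = c powr m * g (c * (r / b))"
    by (rule sol_unique[OF b(2) b0 _ c(2)[folded e] c0]) (use b r in auto)
  then show ?thesis using bc b(1) by simp
qed

lemma fast_decay_profile_exists:
  obtains f where "fast_decay_profile N p q f" "((\<lambda>r. r powr (p / (2 - p)) * f r) \<longlongrightarrow> w_star N p q) at_top"
proof -
  obtain \<nu> F V where s: "\<nu> > 0" "sol \<nu> F V" "F 0 = 1" "\<And>r. r \<ge> 0 \<Longrightarrow> F r > 0"
    "((\<lambda>r. r powr m * F r) \<longlongrightarrow> wst) at_top"
    by (rule connection_exists) (rule that)
  \<comment> \<open>The scaling that turns the coefficient \<nu> found by shooting into 1.\<close>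
  define b where "b = \<nu> powr (1 / \<kappa>)"
  have b: "b > 0" using s(1) by (simp add: b_def)
  have "\<nu> * b powr - \<kappa> = 1" using s(1) \<kappa>0 by (simp add: b_def powr_powr powr_minus)
  define f where "f r = b powr m * F (b * r)" for r
  have fs: "sol 1 f (\<lambda>r. b powr (m - 1) * V (b * r))"
    using sol_scale[OF s(2) b] \<open>\<nu> * b powr - \<kappa> = 1\<close> unfolding f_def by simp
  have fpos: "f r > 0" if "r \<ge> 0" for r using s(4)[of "b * r"] b that by (simp add: f_def)
  have "filterlim (\<lambda>r. b * r) at_top at_top"
    using b by (intro filterlim_tendsto_pos_mult_at_top[OF tendsto_const _ filterlim_ident])
  from filterlim_compose[OF s(5) this]
  have lim: "((\<lambda>r. r powr m * f r) \<longlongrightarrow> w_star N p q) at_top"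
    using b by (simp add: f_def powr_mult mult_ac w_star_eq)
  define c where "c = (p - q) / (q - p + 1)"
  \<comment> \<open>The decay rate \<mu> is faster than the required
    \<open>\<alpha> / \<beta>\<close>, so the limit at rate \<mu> implies the fast decay
    condition.\<close>
  have "c < m"
  proof -
    have "A / B = c"
      using q_bounds by (simp add: alpha_exp_def beta_exp_def c_def)
    then show ?thesis using \<mu>\<beta> \<beta>0 by (simp add: pos_divide_less_eq[symmetric])
  qed
  then have "((\<lambda>r. r powr (c - m)) \<longlongrightarrow> 0) at_top"
    by (intro tendsto_neg_powr filterlim_ident) simp
  from tendsto_mult[OF this lim]
  have "((\<lambda>r. r powr (c - m) * (r powr m * f r)) \<longlongrightarrow> 0) at_top" by simp
  moreover have "\<forall>\<^sub>F r in at_top. r powr (c - m) * (r powr m * f r) = r powr c * f r"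
    using eventually_gt_at_top[of 0] by eventually_elim (simp add: powr_diff)
  ultimately have "((\<lambda>r. r powr c * f r) \<longlongrightarrow> 0) at_top" by (rule Lim_transform_eventually)
  moreover have "\<exists>r\<ge>0. f r \<noteq> 0" using fpos[of 0] by (intro exI[of _ 0]) auto
  moreover have "\<forall>r\<ge>0. f r \<ge> 0" using fpos less_imp_le by blast
  ultimately have "fast_decay_profile N p q f"
    unfolding fast_decay_profile_def c_def using profile_of_sol[OF fs fpos] by blast
  then show ?thesis using that lim by (simp add: mu_exp_def)
qed

end

theorem theorem1p1:
  fixes N :: nat and p q :: real
  assumes "N \<ge> 1"
    and "2 * real N / (real N + 1) < p" and "p < 2"
    and "p / 2 < q" and "q < p - real N / (real N + 1)"
  shows "w_star N p q > 0 \<and>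
    (\<exists>f. fast_decay_profile N p q f \<and>
         (\<forall>g. fast_decay_profile N p q g \<longrightarrow> (\<forall>r\<ge>0. g r = f r)) \<and>
         ((\<lambda>r. r powr (p / (2 - p)) * f r) \<longlongrightarrow> w_star N p q) at_top)"
proof -
  interpret profile_exponents N p q using assms by unfold_locales
  obtain f where "fast_decay_profile N p q f" "((\<lambda>r. r powr (p / (2 - p)) * f r) \<longlongrightarrow> w_star N p q) at_top"
    by (rule fast_decay_profile_exists) (rule that)
  moreover have "w_star N p q > 0" using wst_pos by (simp add: w_star_eq)
  ultimately show ?thesis using fast_decay_profile_unique by blast
qed

end
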